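(* Let $Z_d$ be a quasi star configuration of points in $\mathbb{P}^2$ and let $I=I(Z_d)\subset \mathbb{K}[\mathbb{P}^2]$ be its defining ideal. Put $c_4=2$, $c_5=2$, $c_6=\frac{12}{5}$, $c_7=\frac{21}{8}$, $c_8=\frac{48}{17}$, $c_9=3$. Then: (a) if $4\le d\le 9$, then $2-\frac{2c_d}{d+c_d}\le \rho(I)\le 2-\frac{2}{d+1}$; (b) if $d\ge 10$, then $2-\frac{2}{\sqrt{d}+1}\le \rho(I)\le 2-\frac{2}{d+1}$.
   Context: $\mathbb{K}$ is an algebraically closed field and $R=\mathbb{K}[\mathbb{P}^2]=\mathbb{K}[x_0,x_1,x_2]$ is the coordinate ring of the projective plane $\mathbb{P}^2$ over $\mathbb{K}$. Quasi star configuration: let $d\ge 3$ and let $L_1,\dots,L_d$ be general lines in $\mathbb{P}^2$ (pairwise distinct, no three passing through a common point). The star configuration $S_2(2,d)$ is the set of the $\binom{d}{2}$ points of pairwise intersection of these lines. Let $T_d=\{q_1,\dots,q_d\}$ be a set of $d$ distinct points of $\mathbb{P}^2$ with $T_d\cap S_2(2,d)=\varnothing$, with $q_i\in L_i$ for each $i=1,\dots,d$, and such that the points of $T_d$ are not collinear. Then $Z_d=T_d+S_2(2,d)$ (the union of these two sets of reduced points) is called a quasi star configuration. Its defining ideal $I(Z_d)$ is the radical homogeneous ideal generated by all forms vanishing at every point of $Z_d$. Symbolic powers: for a nontrivial homogeneous ideal $I\subset R$ and a positive integer $m$, $I^{(m)}=R\cap I^mR_U$, where $U=R-\bigcup_{P\in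 \mathrm{Ass}(I)}P$. If $I$ is the radical ideal of a finite set of points $p_1,\dots,p_n$, then $I^{(m)}=\bigcap_i I(p_i)^m$, where $I(p_i)$ is the ideal of $p_i$. $I^m$ is the ordinary power. Resurgence: $\rho(I)=\sup\{\frac{m}{r} \mid m,r \text{ positive integers},\ I^{(m)}\nsubseteq I^r\}$. *)

theory Defs
  imports
    "HOL-Analysis.Analysis"
    "HOL-Library.Poly_Mapping"
    "HOL-Computational_Algebra.Polynomial"
    "HOL-Computational_Algebra.Fraction_Field"
    "HOL-Algebra.Ideal_Product"
    "HOL-Algebra.Algebraic_Closure_Type"
begin

section \<open>Symbolic powers and resurgence in an integral domain\<close>

text \<open>The type \<open>'a\<close> is regarded as a ring in the sense of HOL-Algebra through
  \<^const>\<open>ring_of_type_algebra\<close>, whose carrier is the whole type.\<close>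

definition ideal_power :: "'a::idom set \<Rightarrow> nat \<Rightarrow> 'a set" where
  "ideal_power I m = I [^]\<^bsub>ideals_set ring_of_type_algebra\<^esub> m"

text \<open>\<open>Ass(I)\<close> is the set of associated primes of the module \<open>R/I\<close>: the primes of the form \<open>(I : f)\<close>.\<close>

definition associated_primes :: "'a::idom set \<Rightarrow> 'a set set" where
  "associated_primes I =
     {P. primeideal P ring_of_type_algebra \<and> (\<exists>f. P = {g. g * f \<in> I})}"

text \<open>The localization at \<open>U\<close>, as a subring of the fraction field; \<open>U\<close> is supposed to be
  multiplicatively closed, with \<open>1 \<in> U\<close> and \<open>0 \<notin> U\<close>.\<close>

definition localization :: "'a::idom set \<Rightarrow> 'a fract ring" where
  "localization U = ring_of_type_algebra \<lparr>carrier := {Fract a u | a u. u \<in> U}\<rparr>"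

definition symbolic_power :: "'a::idom set \<Rightarrow> nat \<Rightarrow> 'a set" where
  "symbolic_power I m =
     (let U = UNIV - \<Union> (associated_primes I)
      in {f. Fract f 1 \<in> Idl\<^bsub>localization U\<^esub> ((\<lambda>g. Fract g 1) ` ideal_power I m)})"

text \<open>The supremum is taken in the extended reals, so that it is meaningful without
  knowing beforehand that the set is bounded.\<close>

definition resurgence :: "'a::idom set \<Rightarrow> ereal" where
  "resurgence I =
     Sup {ereal (real m / real r) | m r.
            m > 0 \<and> r > 0 \<and> \<not> symbolic_power I m \<subseteq> ideal_power I r}"

section \<open>Forms on the projective plane\<close>

text \<open>A polynomial in \<open>x\<^sub>0, x\<^sub>1, x\<^sub>2\<close> maps exponent vectors to coefficients; the three
  variables are indexed by the type \<open>3\<close>.\<close>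

type_synonym 'k ternary_poly = "(3 \<Rightarrow>\<^sub>0 nat) \<Rightarrow>\<^sub>0 'k"

definition poly_eval :: "'k::field ternary_poly \<Rightarrow> 'k^3 \<Rightarrow> 'k" where
  "poly_eval F v =
     (\<Sum>e\<in>Poly_Mapping.keys F. Poly_Mapping.lookup F e * (\<Prod>i\<in>UNIV. (v $ i) ^ Poly_Mapping.lookup e i))"

definition is_form :: "'k::field ternary_poly \<Rightarrow> bool" where
  "is_form F \<longleftrightarrow>
     (\<exists>n. \<forall>e\<in>Poly_Mapping.keys F. (\<Sum>i\<in>UNIV. Poly_Mapping.lookup e i) = n)"

text \<open>A point of the plane is the set of all its homogeneous coordinate vectors.\<close>

type_synonym 'k ppoint = "('k^3) set"

definition proj_rel :: "(('k::field^3) \<times> ('k^3)) set" where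
  "proj_rel = {(v, w). v \<noteq> 0 \<and> w \<noteq> 0 \<and> (\<exists>c. c \<noteq> 0 \<and> w = c *s v)}"

definition proj_plane :: "'k::field ppoint set" where
  "proj_plane = {v. v \<noteq> 0} // proj_rel"

definition is_line :: "'k::field ppoint set \<Rightarrow> bool" where
  "is_line L \<longleftrightarrow>
     (\<exists>a::'k^3. a \<noteq> 0 \<and> L = {p \<in> proj_plane. \<forall>v\<in>p. (\<Sum>i\<in>UNIV. a $ i * v $ i) = 0})"

definition vanishing_ideal :: "'k::field ppoint set \<Rightarrow> 'k ternary_poly set" where
  "vanishing_ideal Z =
     Idl\<^bsub>ring_of_type_algebra\<^esub> {F. is_form F \<and> (\<forall>p\<in>Z. \<forall>v\<in>p. poly_eval F v = 0)}"

section \<open>Quasi star configurations\<close>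

definition general_lines :: "nat \<Rightarrow> (nat \<Rightarrow> 'k::field ppoint set) \<Rightarrow> bool" where
  "general_lines d L \<longleftrightarrow>
     (\<forall>i\<in>{1..d}. is_line (L i)) \<and> inj_on L {1..d} \<and>
     (\<forall>i\<in>{1..d}. \<forall>j\<in>{1..d}. \<forall>k\<in>{1..d}.
        i \<noteq> j \<and> i \<noteq> k \<and> j \<noteq> k \<longrightarrow> L i \<inter> L j \<inter> L k = {})"

definition star_configuration :: "nat \<Rightarrow> (nat \<Rightarrow> 'k::field ppoint set) \<Rightarrow> 'k ppoint set" where
  "star_configuration d L = (\<Union>i\<in>{1..d}. \<Union>j\<in>{1..d} - {i}. L i \<inter> L j)"

definition quasi_star_configuration :: "nat \<Rightarrow> 'k::field ppoint set \<Rightarrow> bool" where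
  "quasi_star_configuration d Z \<longleftrightarrow> d \<ge> 3 \<and>
     (\<exists>L q. general_lines d L \<and>
        inj_on q {1..d} \<and> (\<forall>i\<in>{1..d}. q i \<in> L i) \<and>
        q ` {1..d} \<inter> star_configuration d L = {} \<and>
        \<not> (\<exists>M. is_line M \<and> q ` {1..d} \<subseteq> M) \<and>
        Z = q ` {1..d} \<union> star_configuration d L)"

end

theory Submission
  imports Defs
begin

text \<open>
  Let \<open>\<Lambda>\<close> be the product of the \<open>d\<close> lines, \<open>q_i\<close> the extra point on the line \<open>L_i\<close>, and \<open>M_i\<close> a
  second line through \<open>q_i\<close>. All bounds come from counting zeros on the lines: each \<open>L_i\<close> carries
  exactly \<open>d\<close> points of \<open>Z\<close>, namely \<open>d - 1\<close> star points and \<open>q_i\<close>.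

  Upper bound. Let \<open>F\<close> be a nonzero form of degree \<open>t\<close> with multiplicity at least \<open>x\<close> at the star points
  and \<open>y\<close> at the \<open>q_i\<close>. If \<open>t < (d - 1) x + y\<close>, then \<open>F\<close> has too many zeros on every line, so \<open>\<Lambda>\<close>
  divides \<open>F\<close>, and the quotient has the data \<open>(t - d, x - 2, y - 1)\<close>. By induction
  \<open>(d - 1) x + 2 y \<le> 2 t\<close> (\<open>degree_bound\<close>). Hence forms in the symbolic power \<open>I^(m)\<close> have degree at least
  \<open>m (d + 1) / 2\<close>. On the other hand, in degrees at least \<open>r d\<close> the symbolic power \<open>I^(r)\<close> agrees with
  the ordinary power \<open>I^r\<close> (\<open>fat_forms_in_power\<close>). So \<open>m (d + 1) \<ge> 2 d r\<close> gives \<open>I^(m) \<subseteq> I^r\<close>, and the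
  resurgence is at most \<open>2 d / (d + 1) = 2 - 2 / (d + 1)\<close>.

  The agreement of the two powers is proved without cohomology. A form \<open>F\<close> of degree \<open>t \<ge> r d\<close> in
  \<open>I^(r)\<close> restricts to \<open>L_i\<close> as \<open>G_i^r H\<close>, where \<open>G_i\<close> is the product of \<open>M_i\<close> and all lines other than
  \<open>L_i\<close>; so \<open>F - G_i^r H\<close> is divisible by \<open>L_i\<close>, and \<open>G_i^r \<in> I^r\<close>. The quotient has smaller
  multiplicities, and the argument is repeated, running through the lines again and again, until what
  remains is a multiple of \<open>\<Lambda>^r \<in> I^r\<close>. From the second round on, the restriction no longer contains the
  full power of \<open>G_i\<close>, and the cofactor \<open>H\<close> has to be chosen well modulo \<open>L_i\<close>; this is possible because
  the points off \<open>L_i\<close> are again a quasi star, whose ideal restricts onto all binary forms of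
  degree at least \<open>d - 1\<close> on \<open>L_i\<close> (\<open>lift_into_ideal_power\<close>).

  Lower bound. Nonzero forms in \<open>I\<close> have degree at least \<open>d\<close>, so nonzero forms in \<open>I^r\<close> have degree at least
  \<open>r d\<close>. A nonzero form of degree \<open>t\<close> in \<open>I^(m)\<close> therefore gives, through its powers, the bound
  \<open>m d / t\<close> for the resurgence (\<open>resurgence_ge\<close>). If \<open>G\<close> has degree \<open>s\<close> and multiplicity \<open>k\<close> at every
  \<open>q_i\<close>, then \<open>\<Lambda>^k G\<close> lies in \<open>I^(2 k)\<close> and has degree \<open>d k + s\<close>. Such \<open>G\<close> are found by counting linear
  conditions, directly or as products of \<open>d\<close> forms with one distinguished point each; the ratios
  \<open>s / k\<close> obtained are \<open>c d\<close> for \<open>4 \<le> d \<le> 9\<close>, and approach \<open>sqrt d\<close> for large \<open>k\<close>.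

  Points are represented by coordinate vectors throughout.
\<close>

section \<open>Ideals and their powers\<close>

lemma type_ring_simps [simp]:
  "carrier (ring_of_type_algebra :: 'a::ring_1 ring) = UNIV"
  "x \<otimes>\<^bsub>ring_of_type_algebra\<^esub> y = (x * y :: 'a)"
  "x \<oplus>\<^bsub>ring_of_type_algebra\<^esub> y = (x + y :: 'a)"
  "\<one>\<^bsub>ring_of_type_algebra\<^esub> = (1 :: 'a)"
  "\<zero>\<^bsub>ring_of_type_algebra\<^esub> = (0 :: 'a)"
  by (simp_all add: ring_of_type_algebra_def)

lemma cring_type_ring: "cring (ring_of_type_algebra :: 'a::comm_ring_1 ring)"
  by (rule cring_from_type_algebra)

lemma ring_type_ring: "ring (ring_of_type_algebra :: 'a::comm_ring_1 ring)"
  using cring_type_ring by (rule cring.axioms)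

lemma idealD:
  fixes I :: "'a::comm_ring_1 set"
  assumes "ideal I ring_of_type_algebra"
  shows "0 \<in> I" "x \<in> I \<Longrightarrow> y \<in> I \<Longrightarrow> x + y \<in> I" "x \<in> I \<Longrightarrow> a * x \<in> I" "x \<in> I \<Longrightarrow> x * a \<in> I"
    "x \<in> I \<Longrightarrow> - x \<in> I" "x \<in> I \<Longrightarrow> y \<in> I \<Longrightarrow> x - y \<in> I"
proof -
  interpret ideal I ring_of_type_algebra by fact
  note sg = additive_subgroup_axioms
  show "0 \<in> I" using additive_subgroup.zero_closed[OF sg] by simp
  show add: "x + y \<in> I" if "x \<in> I" "y \<in> I" for x y using additive_subgroup.a_closed[OF sg that] by simp
  show mul: "a * x \<in> I" if "x \<in> I" for x a using I_l_closed[OF that, of a] by simp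
  show "x \<in> I \<Longrightarrow> x * a \<in> I" for a using mul[of x a] by (simp add: mult.commute)
  have neg: "- x \<in> I" if "x \<in> I" for x using mul[OF that, of "-1"] by simp
  show "x \<in> I \<Longrightarrow> - x \<in> I" by (rule neg)
  show "x \<in> I \<Longrightarrow> y \<in> I \<Longrightarrow> x - y \<in> I" using add[OF _ neg, of x y] by simp
qed

lemma ideal_sum:
  fixes I :: "'a::comm_ring_1 set"
  assumes "ideal I ring_of_type_algebra" "\<And>x. x \<in> A \<Longrightarrow> f x \<in> I"
  shows "sum f A \<in> I"
  using assms(2) by (induction A rule: infinite_finite_induct) (auto intro: idealD[OF assms(1)])

lemma ideal_typeI:
  fixes I :: "'a::comm_ring_1 set"
  assumes z: "0 \<in> I" and add: "\<And>x y. x \<in> I \<Longrightarrow> y \<in> I \<Longrightarrow> x + y \<in> I"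
    and mul: "\<And>x a. x \<in> I \<Longrightarrow> a * x \<in> I"
  shows "ideal I ring_of_type_algebra"
proof -
  interpret cring "ring_of_type_algebra :: 'a ring" by (rule cring_type_ring)
  have neg: "- x \<in> I" if "x \<in> I" for x using mul[OF that, of "-1"] by simp
  have inv: "\<ominus>\<^bsub>ring_of_type_algebra\<^esub> x = - x" for x :: 'a
    by (rule minus_equality) auto
  show ?thesis
  proof (rule idealI)
    show "subgroup I (add_monoid ring_of_type_algebra)"
    proof (unfold_locales, goal_cases)
      case 4 then show ?case using inv neg by (simp add: a_inv_def)
    qed (auto simp: z add)
  qed (auto simp: mul ring_type_ring, metis mul mult.commute)
qed

lemma genideal_is_ideal: "ideal (Idl\<^bsub>ring_of_type_algebra\<^esub> (S :: 'a::comm_ring_1 set)) ring_of_type_algebra"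
  by (rule ring.genideal_ideal[OF ring_type_ring]) simp

lemma genideal_superset: "S \<subseteq> Idl\<^bsub>ring_of_type_algebra\<^esub> (S :: 'a::comm_ring_1 set)"
  by (auto simp: genideal_def)

lemma genideal_least:
  fixes S :: "'a::comm_ring_1 set"
  assumes "ideal J ring_of_type_algebra" "S \<subseteq> J"
  shows "Idl\<^bsub>ring_of_type_algebra\<^esub> S \<subseteq> J"
  using assms by (auto simp: genideal_def)

lemma ideal_power_0 [simp]: "ideal_power I 0 = UNIV"
  by (simp add: ideal_power_def ideals_set_def nat_pow_def)

lemma ideal_power_Suc:
  "ideal_power I (Suc m) = ideal_prod ring_of_type_algebra (ideal_power I m) I"
  by (simp add: ideal_power_def ideals_set_def nat_pow_def)

lemma ideal_ideal_power:
  assumes "ideal I (ring_of_type_algebra :: 'a::idom ring)"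
  shows "ideal (ideal_power I m) ring_of_type_algebra"
proof (induction m)
  case 0
  show ?case by (rule ideal_typeI) auto
next
  case (Suc m)
  show ?case unfolding ideal_power_Suc
    by (rule ring.ideal_prod_is_ideal[OF ring_type_ring Suc assms])
qed

lemma ideal_power_SucI: "x \<in> ideal_power I m \<Longrightarrow> y \<in> I \<Longrightarrow> x * y \<in> ideal_power I (Suc m)"
  using ideal_prod.prod[of x "ideal_power I m" y I "ring_of_type_algebra"]
  by (simp add: ideal_power_Suc)

text \<open>The powers of an ideal are compared in this way with the filtrations by multiplicity at a point and
  by lowest degree.\<close>

lemma ideal_power_least:
  fixes I :: "'a::idom set"
  assumes "Q 0 = UNIV" "\<And>m x y. x \<in> Q m \<Longrightarrow> y \<in> Q m \<Longrightarrow> x + y \<in> Q m"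
    "\<And>m x y. x \<in> Q m \<Longrightarrow> y \<in> I \<Longrightarrow> x * y \<in> Q (Suc m)"
  shows "ideal_power I m \<subseteq> Q m"
proof (induction m)
  case 0 then show ?case using assms by simp
next
  case (Suc m)
  show ?case
  proof
    fix x assume "x \<in> ideal_power I (Suc m)"
    then show "x \<in> Q (Suc m)" unfolding ideal_power_Suc
    proof (induction rule: ideal_prod.induct)
      case (prod i j) then show ?case using Suc assms(3)[of i m j] by auto
    next
      case (sum s1 s2) then show ?case using assms(2) by simp
    qed
  qed
qed

lemma ideal_power_mult:
  fixes I :: "'a::idom set"
  assumes I: "ideal I ring_of_type_algebra"
    and x: "x \<in> ideal_power I m" and y: "y \<in> ideal_power I n"
  shows "x * y \<in> ideal_power I (m + n)"
proof -
  let ?Q = "\<lambda>n. {y. \<forall>x \<in> ideal_power I m. x * y \<in> ideal_power I (m + n)}"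
  have "ideal_power I n \<subseteq> ?Q n"
  proof (rule ideal_power_least)
    show "?Q 0 = UNIV" by (auto intro: idealD[OF ideal_ideal_power[OF I]])
    show "u + v \<in> ?Q k" if "u \<in> ?Q k" "v \<in> ?Q k" for k u v
      using that by (auto simp: algebra_simps intro: idealD[OF ideal_ideal_power[OF I]])
    show "u * v \<in> ?Q (Suc k)" if "u \<in> ?Q k" "v \<in> I" for k u v
      using that ideal_power_SucI[of _ I "m + k" v] by (auto simp: mult.assoc[symmetric])
  qed
  with x y show ?thesis by auto
qed

lemma ideal_power_power:
  assumes "x \<in> I"
  shows "x ^ n \<in> ideal_power I n"
  by (induction n) (auto simp: mult.commute[of x] intro: ideal_power_SucI assms)

lemma ideal_power_1: "x \<in> I \<Longrightarrow> x \<in> ideal_power I 1"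
  using ideal_power_power[of x I 1] by simp

section \<open>Symbolic powers\<close>

lemma ring_localization:
  fixes U :: "'a::idom set"
  assumes U1: "1 \<in> U" and U0: "0 \<notin> U" and Um: "\<And>x y. x \<in> U \<Longrightarrow> y \<in> U \<Longrightarrow> x * y \<in> U"
  shows "ring (localization U)"
proof -
  let ?C = "{Fract a u | a u. u \<in> U}"
  have nz: "u \<noteq> 0" if "u \<in> U" for u using that U0 by auto
  have add: "x + y \<in> ?C" if "x \<in> ?C" "y \<in> ?C" for x y
  proof -
    from that obtain a u b v where "x = Fract a u" "y = Fract b v" "u \<in> U" "v \<in> U" by auto
    moreover from this have "x + y = Fract (a * v + b * u) (u * v)" using nz by simp
    ultimately show ?thesis using Um by blast
  qed
  have mult: "x * y \<in> ?C" if "x \<in> ?C" "y \<in> ?C" for x y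
  proof -
    from that obtain a u b v where "x = Fract a u" "y = Fract b v" "u \<in> U" "v \<in> U" by auto
    moreover from this have "x * y = Fract (a * b) (u * v)" by simp
    ultimately show ?thesis using Um by blast
  qed
  have one: "1 \<in> ?C" using U1 by (auto simp: One_fract_def)
  have zero: "0 \<in> ?C" using U1 by (auto simp: Zero_fract_def)
  have neg: "- x \<in> ?C" if x: "x \<in> ?C" for x
  proof -
    from x obtain a u where "x = Fract a u" "u \<in> U" by auto
    then have "- x = Fract (- a) u" by simp
    then show ?thesis using \<open>u \<in> U\<close> by blast
  qed
  show ?thesis
  proof (rule ringI)
    show "abelian_group (localization U)"
    proof (rule abelian_groupI, goal_cases)
      case (6 x)
      then have "- x \<in> carrier (localization U)"
        using neg by (simp add: localization_def)
      then show ?case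
        by (intro bexI[of _ "- x"]) (auto simp: localization_def ring_of_type_algebra_def)
    qed (use add zero in \<open>auto simp: localization_def ring_of_type_algebra_def add_ac\<close>)
    show "monoid (localization U)"
      by (rule monoidI)
        (use mult one in \<open>auto simp: localization_def ring_of_type_algebra_def mult_ac\<close>)
  qed (auto simp: localization_def ring_of_type_algebra_def algebra_simps)
qed

text \<open>Clearing denominators: the fractions \<open>a/u\<close> with \<open>a \<in> I^m\<close> already form an ideal of the localization.
  An associated prime must exist because otherwise \<open>0\<close> would be an admissible denominator.\<close>

lemma symbolic_power_iff:
  fixes I :: "'a::idom set"
  assumes I: "ideal I ring_of_type_algebra" and ne: "associated_primes I \<noteq> {}"
  shows "f \<in> symbolic_power I m \<longleftrightarrow>
    (\<exists>u. (\<forall>P\<in>associated_primes I. u \<notin> P) \<and> u * f \<in> ideal_power I m)"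
proof -
  define U where "U = UNIV - \<Union> (associated_primes I)"
  define Lo where "Lo = localization U"
  have pr: "ideal P ring_of_type_algebra" "1 \<notin> P" "x * y \<in> P \<Longrightarrow> x \<in> P \<or> y \<in> P"
    if P: "P \<in> associated_primes I" for P x y
  proof -
    interpret primeideal P ring_of_type_algebra using P by (auto simp: associated_primes_def)
    show i: "ideal P ring_of_type_algebra" by (rule is_ideal)
    show "1 \<notin> P" using I_notcarr idealD(3)[OF i, of 1] by auto
    show "x * y \<in> P \<Longrightarrow> x \<in> P \<or> y \<in> P" using I_prime[of x y] by simp
  qed
  have U1: "1 \<in> U" using pr(2) by (auto simp: U_def)
  have U0: "0 \<notin> U" using ne pr(1) idealD(1) by (auto simp: U_def)
  have Um: "x * y \<in> U" if "x \<in> U" "y \<in> U" for x y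
    using that pr(3) unfolding U_def by blast
  have rL: "ring Lo" unfolding Lo_def by (rule ring_localization[OF U1 U0 Um])
  have nz: "u \<noteq> 0" if "u \<in> U" for u using that U0 by auto
  let ?J = "{Fract a u | a u. u \<in> U \<and> a \<in> ideal_power I m}"
  note id = idealD[OF ideal_ideal_power[OF I, of m]]
  have carr: "carrier Lo = {Fract a u | a u. u \<in> U}"
    and ops: "x \<oplus>\<^bsub>Lo\<^esub> y = x + y" "x \<otimes>\<^bsub>Lo\<^esub> y = x * y" for x y
    by (auto simp: Lo_def localization_def ring_of_type_algebra_def)
  have zLo: "\<zero>\<^bsub>Lo\<^esub> = 0" by (auto simp: Lo_def localization_def ring_of_type_algebra_def)
  interpret L: ring Lo by (rule rL)
  have Jmul: "x * y \<in> ?J" if x: "x \<in> carrier Lo" and y: "y \<in> ?J" for x y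
  proof -
    from x obtain b v where bv: "x = Fract b v" "v \<in> U" by (auto simp: carr)
    from y obtain a u where au: "y = Fract a u" "u \<in> U" "a \<in> ideal_power I m" by auto
    have "x * y = Fract (b * a) (v * u)" using bv au by simp
    then show ?thesis using id(3)[OF au(3), of b] Um[OF bv(2) au(2)] by blast
  qed
  have idJ: "ideal ?J Lo"
  proof (rule idealI[OF rL])
    show "subgroup ?J (add_monoid Lo)"
    proof (rule group.subgroupI[OF L.a_group], goal_cases)
      case 1 then show ?case by (auto simp: carr)
    next
      case 2 then show ?case using id(1) U1 by auto
    next
      case (3 x)
      have minus1: "\<ominus>\<^bsub>Lo\<^esub> \<one>\<^bsub>Lo\<^esub> \<in> carrier Lo" by simp
      have xc: "x \<in> carrier Lo" using 3 by (auto simp: carr)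
      have "\<ominus>\<^bsub>Lo\<^esub> x = (\<ominus>\<^bsub>Lo\<^esub> \<one>\<^bsub>Lo\<^esub>) \<otimes>\<^bsub>Lo\<^esub> x" using xc by (simp add: L.l_minus)
      then show ?case using Jmul[OF minus1 3] by (simp add: ops a_inv_def)
    next
      case (4 x y)
      then obtain a u b v where *: "x = Fract a u" "y = Fract b v" "u \<in> U" "v \<in> U"
        "a \<in> ideal_power I m" "b \<in> ideal_power I m" by auto
      have "x + y = Fract (a * v + b * u) (u * v)" using * nz by simp
      moreover have "a * v + b * u \<in> ideal_power I m" using * id by blast
      ultimately show ?case using Um[OF *(3,4)] by (auto simp: ops)
    qed
  next
    fix a x assume "a \<in> ?J" "x \<in> carrier Lo"
    then show "x \<otimes>\<^bsub>Lo\<^esub> a \<in> ?J" "a \<otimes>\<^bsub>Lo\<^esub> x \<in> ?J"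
      using Jmul[of x a] by (simp_all add: ops mult.commute)
  qed
  have sp: "f \<in> symbolic_power I m \<longleftrightarrow> Fract f 1 \<in> Idl\<^bsub>Lo\<^esub> ((\<lambda>g. Fract g 1) ` ideal_power I m)"
    by (simp add: symbolic_power_def Let_def U_def Lo_def)
  have "Fract f 1 \<in> Idl\<^bsub>Lo\<^esub> ((\<lambda>g. Fract g 1) ` ideal_power I m) \<longleftrightarrow> (\<exists>u\<in>U. u * f \<in> ideal_power I m)"
  proof
    assume "Fract f 1 \<in> Idl\<^bsub>Lo\<^esub> ((\<lambda>g. Fract g 1) ` ideal_power I m)"
    moreover have "(\<lambda>g. Fract g 1) ` ideal_power I m \<subseteq> ?J" using U1 by auto
    ultimately have "Fract f 1 \<in> ?J" using idJ by (auto simp: genideal_def)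
    then obtain a u where au: "Fract f 1 = Fract a u" "u \<in> U" "a \<in> ideal_power I m" by auto
    then have "u * f = a" using nz[of u] by (simp add: eq_fract mult.commute)
    then show "\<exists>u\<in>U. u * f \<in> ideal_power I m" using au by auto
  next
    assume "\<exists>u\<in>U. u * f \<in> ideal_power I m"
    then obtain u where u: "u \<in> U" "u * f \<in> ideal_power I m" by auto
    have "Fract f 1 = Fract 1 u * Fract (u * f) 1" using nz[OF u(1)] by (simp add: eq_fract)
    moreover have "Fract 1 u \<in> carrier Lo" using u by (auto simp: carr)
    ultimately show "Fract f 1 \<in> Idl\<^bsub>Lo\<^esub> ((\<lambda>g. Fract g 1) ` ideal_power I m)"
      using ideal.I_l_closed[of _ Lo "Fract (u * f) 1" "Fract 1 u"] u(2)
      by (auto simp: genideal_def ops)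
  qed
  then show ?thesis unfolding sp by (auto simp: U_def)
qed

section \<open>Ternary forms\<close>

definition dot :: "'k::comm_ring_1^3 \<Rightarrow> 'k^3 \<Rightarrow> 'k" where
  "dot a v = (\<Sum>i\<in>UNIV. a $ i * v $ i)"

definition mdeg :: "(3 \<Rightarrow>\<^sub>0 nat) \<Rightarrow> nat" where
  "mdeg e = (\<Sum>i\<in>UNIV. Poly_Mapping.lookup e i)"

text \<open>Forms with their degree. The zero polynomial is a form of every degree, so differences and
  quotients of forms can be handled without case distinctions.\<close>

definition hform :: "nat \<Rightarrow> 'k::field ternary_poly \<Rightarrow> bool" where
  "hform n F \<longleftrightarrow> (\<forall>e\<in>Poly_Mapping.keys F. mdeg e = n)"

lemma is_form_iff: "is_form F \<longleftrightarrow> (\<exists>n. hform n F)"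
  by (simp add: is_form_def hform_def mdeg_def)

lemma mdeg_add: "mdeg (e + e') = mdeg e + mdeg e'"
  by (simp add: mdeg_def lookup_add sum.distrib)

lemma mdeg_0 [simp]: "mdeg 0 = 0"
  by (simp add: mdeg_def)

lemma mdeg_single [simp]: "mdeg (Poly_Mapping.single i n) = n"
  by (simp add: mdeg_def lookup_single when_def)

lemma hform_0 [simp]: "hform n 0"
  by (simp add: hform_def)

lemma hform_add: "hform n F \<Longrightarrow> hform n G \<Longrightarrow> hform n (F + G)"
  using keys_add[of F G] by (auto simp: hform_def)

lemma hform_uminus: "hform n F \<Longrightarrow> hform n (- F)"
  by (auto simp: hform_def in_keys_iff)

lemma hform_diff: "hform n F \<Longrightarrow> hform n G \<Longrightarrow> hform n (F - G)"
  using hform_add[OF _ hform_uminus, of n F G] by simp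

lemma hform_mult: "hform m F \<Longrightarrow> hform n G \<Longrightarrow> hform (m + n) (F * G)"
  using keys_mult[of F G] by (fastforce simp: hform_def mdeg_add)

lemma hform_1 [simp]: "hform 0 1"
  by (simp add: hform_def)

lemma hform_power: "hform m F \<Longrightarrow> hform (m * n) (F ^ n)"
  by (induction n) (auto intro: hform_mult)

lemma hform_sum: "(\<And>x. x \<in> A \<Longrightarrow> hform n (f x)) \<Longrightarrow> hform n (sum f A)"
  by (induction A rule: infinite_finite_induct) (auto intro: hform_add)

lemma hform_prod: "(\<And>x. x \<in> A \<Longrightarrow> hform (n x) (f x)) \<Longrightarrow> hform (sum n A) (prod f A)"
  by (induction A rule: infinite_finite_induct) (auto intro: hform_mult)

lemma hform_unique: "hform m F \<Longrightarrow> hform n F \<Longrightarrow> F \<noteq> 0 \<Longrightarrow> m = n"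
  using keys_eq_empty[of F] by (auto simp: hform_def)

definition Cst :: "'k::comm_ring_1 \<Rightarrow> 'k ternary_poly" where
  "Cst c = Poly_Mapping.single 0 c"

definition Var :: "3 \<Rightarrow> 'k::comm_ring_1 ternary_poly" where
  "Var i = Poly_Mapping.single (Poly_Mapping.single i 1) 1"

definition lin :: "'k::comm_ring_1^3 \<Rightarrow> 'k ternary_poly" where
  "lin a = (\<Sum>i\<in>UNIV. Cst (a $ i) * Var i)"

lemma hform_Cst [simp]: "hform 0 (Cst c)"
  by (auto simp: hform_def Cst_def)

lemma hform_Var [simp]: "hform 1 (Var i)"
  by (auto simp: hform_def Var_def)

lemma hform_lin [simp]: "hform 1 (lin a)"
  unfolding lin_def using hform_mult[OF hform_Cst hform_Var] by (intro hform_sum) simp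

lemma hform_Cst_mult: "hform n F \<Longrightarrow> hform n (Cst c * F)"
  using hform_mult[OF hform_Cst] by fastforce

lemma Cst_mult_Var: "Cst c * Var i = Poly_Mapping.single (Poly_Mapping.single i 1) c"
  by (simp add: Cst_def Var_def mult_single)

lemma lookup_lin: "Poly_Mapping.lookup (lin a) (Poly_Mapping.single i 1) = a $ i"
proof -
  have "Poly_Mapping.lookup (lin a) (Poly_Mapping.single i 1) = (\<Sum>j\<in>UNIV. if j = i then a $ j else 0)"
    unfolding lin_def Cst_mult_Var lookup_sum
    by (intro sum.cong) (auto simp: lookup_single when_def inj_single[THEN inj_eq] poly_mapping_eq_iff fun_eq_iff split: if_splits)
  then show ?thesis by simp
qed

lemma lin_eq_0_iff [simp]: "lin a = 0 \<longleftrightarrow> a = 0"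
proof
  assume "lin a = 0"
  then show "a = 0" using lookup_lin[of a] by (simp add: vec_eq_iff)
next
  show "a = 0 \<Longrightarrow> lin a = 0" by (simp add: lin_def Cst_def)
qed

definition hcomp :: "nat \<Rightarrow> 'k::field ternary_poly \<Rightarrow> 'k ternary_poly" where
  "hcomp n F = Poly_Mapping.mapp (\<lambda>e c. if mdeg e = n then c else 0) F"

lemma lookup_hcomp: "Poly_Mapping.lookup (hcomp n F) e = (if mdeg e = n then Poly_Mapping.lookup F e else 0)"
  by (auto simp: hcomp_def lookup_mapp when_def in_keys_iff)

lemma hform_hcomp: "hform n (hcomp n F)"
  by (auto simp: hform_def in_keys_iff lookup_hcomp split: if_splits)

lemma hcomp_hform: "hform m F \<Longrightarrow> hcomp n F = (if n = m then F else 0)"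
  by (rule poly_mapping_eqI) (auto simp: hform_def lookup_hcomp in_keys_iff)

lemma sum_hcomp: "F = (\<Sum>n\<in>mdeg ` Poly_Mapping.keys F. hcomp n F)"
proof (rule poly_mapping_eqI)
  fix e
  have "(\<Sum>n\<in>mdeg ` Poly_Mapping.keys F. if mdeg e = n then Poly_Mapping.lookup F e else 0) = Poly_Mapping.lookup F e"
    by (auto simp: in_keys_iff image_iff)
  then show "Poly_Mapping.lookup F e = Poly_Mapping.lookup (\<Sum>n\<in>mdeg ` Poly_Mapping.keys F. hcomp n F) e"
    by (simp add: lookup_sum lookup_hcomp)
qed

section \<open>Substitutions\<close>

definition rhom :: "('a::comm_ring_1 \<Rightarrow> 'b::comm_ring_1) \<Rightarrow> bool" where
  "rhom f \<longleftrightarrow> f 1 = 1 \<and> (\<forall>x y. f (x + y) = f x + f y) \<and> (\<forall>x y. f (x * y) = f x * f y)"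

lemma rhomD:
  assumes "rhom f"
  shows "f 0 = 0" "f 1 = 1" "f (x + y) = f x + f y" "f (x * y) = f x * f y"
    "f (- x) = - f x" "f (x - y) = f x - f y" "f (x ^ n) = f x ^ n"
    "f (sum g A) = (\<Sum>x\<in>A. f (g x))" "f (prod g A) = (\<Prod>x\<in>A. f (g x))"
proof -
  show add: "f (x + y) = f x + f y" for x y using assms by (simp add: rhom_def)
  show mult: "f (x * y) = f x * f y" for x y using assms by (simp add: rhom_def)
  show one: "f 1 = 1" using assms by (simp add: rhom_def)
  show zero: "f 0 = 0" using add[of 0 0] by simp
  show neg: "f (- x) = - f x" for x using add[of x "- x"] zero by (simp add: eq_neg_iff_add_eq_0 add.commute)
  show "f (x - y) = f x - f y" using add[of x "- y"] neg by simp
  show "f (x ^ n) = f x ^ n" by (induction n) (auto simp: one mult)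
  show "f (sum g A) = (\<Sum>x\<in>A. f (g x))" by (induction A rule: infinite_finite_induct) (auto simp: zero add)
  show "f (prod g A) = (\<Prod>x\<in>A. f (g x))" by (induction A rule: infinite_finite_induct) (auto simp: one mult)
qed

text \<open>Evaluation at a vector, restriction to a line and expansion at a point are all instances; the
  coefficients enter the target ring through \<open>h\<close>.\<close>

definition pev :: "('k::field \<Rightarrow> 'r::comm_ring_1) \<Rightarrow> (3 \<Rightarrow> 'r) \<Rightarrow> 'k ternary_poly \<Rightarrow> 'r" where
  "pev h y F = (\<Sum>e\<in>Poly_Mapping.keys F. h (Poly_Mapping.lookup F e) * (\<Prod>i\<in>UNIV. y i ^ Poly_Mapping.lookup e i))"

lemma poly_eval_pev: "poly_eval F v = pev (\<lambda>c. c) (($) v) F"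
  by (simp add: poly_eval_def pev_def)

lemma pev_superset:
  assumes "rhom h" "finite A" "Poly_Mapping.keys F \<subseteq> A"
  shows "pev h y F = (\<Sum>e\<in>A. h (Poly_Mapping.lookup F e) * (\<Prod>i\<in>UNIV. y i ^ Poly_Mapping.lookup e i))"
  unfolding pev_def
  by (rule sum.mono_neutral_left) (use assms in \<open>auto simp: in_keys_iff rhomD\<close>)

lemma pev_add:
  assumes h: "rhom h"
  shows "pev h y (F + G) = pev h y F + pev h y G"
proof -
  let ?A = "Poly_Mapping.keys F \<union> Poly_Mapping.keys G"
  have k: "Poly_Mapping.keys (F + G) \<subseteq> ?A" by (rule keys_add)
  have "pev h y F = (\<Sum>e\<in>?A. h (Poly_Mapping.lookup F e) * (\<Prod>i\<in>UNIV. y i ^ Poly_Mapping.lookup e i))"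
    "pev h y G = (\<Sum>e\<in>?A. h (Poly_Mapping.lookup G e) * (\<Prod>i\<in>UNIV. y i ^ Poly_Mapping.lookup e i))"
    "pev h y (F + G) = (\<Sum>e\<in>?A. h (Poly_Mapping.lookup (F + G) e) * (\<Prod>i\<in>UNIV. y i ^ Poly_Mapping.lookup e i))"
    by (rule pev_superset[OF h]; use k in auto)+
  then show ?thesis
    by (simp add: lookup_add rhomD[OF h] algebra_simps sum.distrib)
qed

lemma pev_single:
  assumes h: "rhom h"
  shows "pev h y (Poly_Mapping.single e c) = h c * (\<Prod>i\<in>UNIV. y i ^ Poly_Mapping.lookup e i)"
  by (subst pev_superset[OF h, of "{e}"]) auto

lemma pev_0 [simp]: "pev h y 0 = 0"
  by (simp add: pev_def)

lemma pev_sum: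
  assumes h: "rhom h"
  shows "pev h y (sum f A) = (\<Sum>x\<in>A. pev h y (f x))"
  by (induction A rule: infinite_finite_induct) (auto simp: pev_add[OF h])

lemma sum_singles: "F = (\<Sum>e\<in>Poly_Mapping.keys F. Poly_Mapping.single e (Poly_Mapping.lookup F e))"
proof (rule poly_mapping_eqI)
  fix e'
  have "(\<Sum>e\<in>Poly_Mapping.keys F. if e = e' then Poly_Mapping.lookup F e else 0) = Poly_Mapping.lookup F e'"
    by (auto simp: in_keys_iff)
  then show "Poly_Mapping.lookup F e' = Poly_Mapping.lookup (\<Sum>e\<in>Poly_Mapping.keys F. Poly_Mapping.single e (Poly_Mapping.lookup F e)) e'"
    by (simp add: lookup_sum lookup_single when_def)
qed

lemma pev_mult:
  assumes h: "rhom h"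
  shows "pev h y (F * G) = pev h y F * pev h y G"
proof -
  have s: "pev h y (Poly_Mapping.single e c * Poly_Mapping.single e' c') =
      pev h y (Poly_Mapping.single e c) * pev h y (Poly_Mapping.single e' c')" for e c e' c'
    by (simp add: mult_single pev_single[OF h] rhomD[OF h] lookup_add power_add prod.distrib algebra_simps)
  have "pev h y (F * G) = pev h y ((\<Sum>e\<in>Poly_Mapping.keys F. Poly_Mapping.single e (Poly_Mapping.lookup F e))
      * (\<Sum>e\<in>Poly_Mapping.keys G. Poly_Mapping.single e (Poly_Mapping.lookup G e)))"
    using sum_singles[of F] sum_singles[of G] by simp
  also have "\<dots> = (\<Sum>e\<in>Poly_Mapping.keys F. pev h y (Poly_Mapping.single e (Poly_Mapping.lookup F e)))
      * (\<Sum>e\<in>Poly_Mapping.keys G. pev h y (Poly_Mapping.single e (Poly_Mapping.lookup G e)))"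
    by (simp add: sum_product pev_sum[OF h] s)
  also have "\<dots> = pev h y F * pev h y G"
    by (simp add: pev_sum[OF h, symmetric] sum_singles[symmetric])
  finally show ?thesis .
qed

lemma rhom_pev: "rhom h \<Longrightarrow> rhom (pev h y)"
  using pev_single[of h y 0 1] rhomD(2)[of h]
  by (simp add: rhom_def[of "pev h y"] pev_add pev_mult)

lemma pev_comp: "rhom g \<Longrightarrow> g (pev h y F) = pev (\<lambda>c. g (h c)) (\<lambda>i. g (y i)) F"
  by (simp add: pev_def rhomD)

lemma pev_Cst: "rhom h \<Longrightarrow> pev h y (Cst c) = h c"
  by (simp add: Cst_def pev_single)

lemma pev_Var: "rhom h \<Longrightarrow> pev h y (Var i) = y i"
proof -
  assume "rhom h"
  moreover have "(\<Prod>j\<in>UNIV. y j ^ Poly_Mapping.lookup (Poly_Mapping.single i 1) j) = (\<Prod>j\<in>UNIV. if j = i then y j else 1)"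
    by (intro prod.cong) (auto simp: lookup_single when_def)
  ultimately show ?thesis by (simp add: Var_def pev_single rhomD)
qed

lemma pev_lin: "rhom h \<Longrightarrow> pev h y (lin a) = (\<Sum>i\<in>UNIV. h (a $ i) * y i)"
  by (simp add: lin_def rhomD[OF rhom_pev] pev_Cst pev_Var)

lemma rhom_id: "rhom (\<lambda>c. c)"
  by (simp add: rhom_def)

lemma rhom_poly_eval: "rhom (\<lambda>F. poly_eval F v)"
  unfolding poly_eval_pev by (rule rhom_pev[OF rhom_id])

lemma poly_eval_lin [simp]: "poly_eval (lin a) v = dot a v"
  by (simp add: poly_eval_pev pev_lin[OF rhom_id] dot_def)

lemma poly_eval_Cst [simp]: "poly_eval (Cst c) v = c"
  by (simp add: poly_eval_pev pev_Cst[OF rhom_id])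

lemma poly_eval_Var [simp]: "poly_eval (Var i) v = v $ i"
  by (simp add: poly_eval_pev pev_Var[OF rhom_id])

lemmas poly_eval_simps = rhomD[OF rhom_poly_eval]

lemma rhom_Cst: "rhom Cst"
  by (simp add: rhom_def Cst_def mult_single single_add)

lemma Cst_eq_0_iff [simp]: "Cst c = 0 \<longleftrightarrow> c = 0"
  by (metis Cst_def lookup_single_eq lookup_zero single_zero)

lemma rhom_const_poly: "rhom h \<Longrightarrow> rhom (\<lambda>c. [:h c:])"
  by (simp add: rhom_def one_pCons)

lemma rhom_poly: "rhom (\<lambda>p. poly p c)"
  by (simp add: rhom_def)

lemma rhom_coeff_0: "rhom (\<lambda>p. Polynomial.coeff p 0)"
  by (simp add: rhom_def Polynomial.coeff_mult)

lemma rhom_map_poly: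
  assumes h: "rhom h"
  shows "rhom (map_poly h)"
proof -
  note c = coeff_map_poly[of h, OF rhomD(1)[OF h]]
  show ?thesis
    unfolding rhom_def
    by (auto simp: poly_eq_iff c Polynomial.coeff_mult rhomD[OF h])
qed

lemma rhom_comp: "rhom f \<Longrightarrow> rhom g \<Longrightarrow> rhom (\<lambda>x. f (g x))"
  by (simp add: rhom_def)

section \<open>Multiplicity at a point\<close>

text \<open>The expansion of \<open>F(x (v + s Y))\<close> at \<open>s = 0\<close>: the outer variable is \<open>s\<close>, the inner one \<open>x\<close>, and the
  direction \<open>Y\<close> is generic. Since \<open>Y\<close> consists of indeterminates, the target ring is a domain in which \<open>s\<close> is
  prime, so that orders of vanishing add up. The factor \<open>x\<close> makes \<open>v\<close> run through all representatives of
  the projective point, which is what is needed for inhomogeneous polynomials.\<close>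

definition jet :: "'k::field^3 \<Rightarrow> 'k ternary_poly \<Rightarrow> 'k ternary_poly poly poly" where
  "jet v = pev (\<lambda>c. [:[:Cst c:]:]) (\<lambda>i. [:[:0, Cst (v $ i):], [:0, Var i:]:])"

text \<open>For \<open>m = 1\<close> this is the prime ideal of the projective point \<open>v\<close>, and for a form it says that the curve
  has multiplicity at least \<open>m\<close> at \<open>v\<close>.\<close>

definition mult_ge :: "'k::field^3 \<Rightarrow> nat \<Rightarrow> 'k ternary_poly \<Rightarrow> bool" where
  "mult_ge v m F \<longleftrightarrow> Polynomial.monom 1 m dvd jet v F"

text \<open>\<open>F(v + s w)\<close>: the restriction of \<open>F\<close> to the line through \<open>v\<close> and \<open>w\<close>, in an affine coordinate
  centred at \<open>v\<close>.\<close>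

definition line_poly :: "'k::field^3 \<Rightarrow> 'k^3 \<Rightarrow> 'k ternary_poly \<Rightarrow> 'k poly" where
  "line_poly v w = pev (\<lambda>c. [:c:]) (\<lambda>i. [:v $ i, w $ i:])"

lemma rhom_jet: "rhom (jet v)"
  unfolding jet_def by (intro rhom_pev rhom_const_poly rhom_Cst)

lemma rhom_line_poly: "rhom (line_poly v w)"
  unfolding line_poly_def by (intro rhom_pev rhom_const_poly rhom_id)

lemmas jet_simps = rhomD[OF rhom_jet]
lemmas line_poly_simps = rhomD[OF rhom_line_poly]

lemma sum_pCons: "(\<Sum>i\<in>A. pCons (f i) (g i)) = pCons (sum f A) (sum g A)"
  by (induction A rule: infinite_finite_induct) auto

lemma line_poly_lin: "line_poly v w (lin a) = [:dot a v, dot a w:]"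
  by (simp add: line_poly_def pev_lin[OF rhom_const_poly[OF rhom_id]] sum_pCons dot_def
      mult.commute)

lemma jet_lin: "jet v (lin a) = [:[:0, Cst (dot a v):], [:0, lin a:]:]"
  by (simp add: jet_def pev_lin[OF rhom_const_poly[OF rhom_const_poly[OF rhom_Cst]]] sum_pCons
      dot_def rhomD[OF rhom_Cst] mult.commute) (simp add: lin_def mult.commute)

text \<open>The polynomial variable is prime over a domain.\<close>

lemma monom_dvd_cancel:
  fixes A B :: "'a::idom poly"
  assumes A: "Polynomial.coeff A 0 \<noteq> 0" and d: "Polynomial.monom 1 m dvd A * B"
  shows "Polynomial.monom 1 m dvd B"
  unfolding monom_1_dvd_iff'
proof (intro allI impI)
  fix k assume "k < m"
  then show "Polynomial.coeff B k = 0"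
  proof (induction k rule: less_induct)
    case (less k)
    have "0 = Polynomial.coeff (A * B) k" using d less.prems by (simp add: monom_1_dvd_iff')
    also have "\<dots> = (\<Sum>i\<le>k. Polynomial.coeff A i * Polynomial.coeff B (k - i))" by (rule Polynomial.coeff_mult)
    also have "\<dots> = (\<Sum>i\<in>{0}. Polynomial.coeff A i * Polynomial.coeff B (k - i))"
      by (rule sum.mono_neutral_right) (use less in auto)
    finally show ?case using A by simp
  qed
qed

lemma mult_ge_0 [simp]: "mult_ge v 0 F"
  by (simp add: mult_ge_def)

lemma mult_ge_zero [simp]: "mult_ge v m 0"
  by (simp add: mult_ge_def jet_simps)

lemma mult_ge_mono: "mult_ge v m F \<Longrightarrow> n \<le> m \<Longrightarrow> mult_ge v n F"
  by (auto simp: mult_ge_def monom_1_dvd_iff')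

lemma mult_ge_add: "mult_ge v m F \<Longrightarrow> mult_ge v m G \<Longrightarrow> mult_ge v m (F + G)"
  by (simp add: mult_ge_def jet_simps)

lemma mult_ge_diff: "mult_ge v m F \<Longrightarrow> mult_ge v m G \<Longrightarrow> mult_ge v m (F - G)"
  by (simp add: mult_ge_def jet_simps)

lemma mult_ge_mult: "mult_ge v m F \<Longrightarrow> mult_ge v n G \<Longrightarrow> mult_ge v (m + n) (F * G)"
  unfolding mult_ge_def jet_simps using mult_dvd_mono[of "Polynomial.monom 1 m" _ "Polynomial.monom 1 n"]
  by (simp add: mult_monom)

lemma mult_ge_multL: "mult_ge v m F \<Longrightarrow> mult_ge v m (G * F)"
  using mult_ge_mult[of v 0 G m F] by simp

lemma mult_ge_sum: "(\<And>x. x \<in> A \<Longrightarrow> mult_ge v m (f x)) \<Longrightarrow> mult_ge v m (sum f A)"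
  by (induction A rule: infinite_finite_induct) (auto intro: mult_ge_add)

lemma mult_ge_cancel:
  assumes "\<not> mult_ge v 1 G" "mult_ge v m (G * F)"
  shows "mult_ge v m F"
  using monom_dvd_cancel[of "jet v G" m "jet v F"] assms
  by (auto simp: mult_ge_def jet_simps monom_1_dvd_iff')

text \<open>If \<open>a\<close> vanishes at \<open>v\<close>, its expansion is \<open>s\<close> times a nonzero element that does not
  involve \<open>s\<close>, so a line has multiplicity
  exactly one at each of its points.\<close>

lemma mult_ge_lin_cancel:
  assumes a: "a \<noteq> 0" and m: "mult_ge v m (lin a * F)"
  shows "mult_ge v (if dot a v = 0 then m - 1 else m) F"
proof (cases "dot a v = 0")
  case False
  then have "\<not> mult_ge v 1 (lin a)" by (simp add: mult_ge_def jet_lin monom_1_dvd_iff')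
  then show ?thesis using False mult_ge_cancel m by auto
next
  case True
  show ?thesis
  proof (cases m)
    case (Suc n)
    have "jet v (lin a * F) = pCons 0 ([:[:0, lin a:]:] * jet v F)"
      by (simp add: jet_simps jet_lin True)
    then have "Polynomial.monom 1 (Suc n) dvd pCons 0 ([:[:0, lin a:]:] * jet v F)"
      using m Suc by (simp add: mult_ge_def)
    then have "Polynomial.monom 1 n dvd [:[:0, lin a:]:] * jet v F"
      unfolding monom_1_dvd_iff' by (metis Suc_less_eq coeff_pCons_Suc)
    then have "Polynomial.monom 1 n dvd jet v F" by (rule monom_dvd_cancel[rotated]) (use a in auto)
    then show ?thesis using True Suc by (simp add: mult_ge_def)
  qed auto
qed

text \<open>The coefficient of every power of \<open>s\<close> is homogeneous of degree \<open>l\<close> in \<open>x\<close>.\<close>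

definition xhom :: "nat \<Rightarrow> 'a::comm_ring_1 poly poly \<Rightarrow> bool" where
  "xhom l P \<longleftrightarrow> (\<forall>k. \<exists>r. Polynomial.coeff P k = Polynomial.monom r l)"

lemma xhom_sum: 
  assumes "\<And>x. x \<in> A \<Longrightarrow> xhom l (f x)"
  shows "xhom l (sum f A)"
  unfolding xhom_def
proof
  fix k
  from assms have "\<forall>x\<in>A. \<exists>r. Polynomial.coeff (f x) k = Polynomial.monom r l" by (auto simp: xhom_def)
  then obtain r where "\<forall>x\<in>A. Polynomial.coeff (f x) k = Polynomial.monom (r x) l" by metis
  then have "Polynomial.coeff (sum f A) k = Polynomial.monom (sum r A) l" by (simp add: coeff_sum monom_sum)
  then show "\<exists>r. Polynomial.coeff (sum f A) k = Polynomial.monom r l" ..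
qed

lemma xhom_mult:
  assumes "xhom a P" "xhom b Q"
  shows "xhom (a + b) (P * Q)"
  unfolding xhom_def
proof
  fix k
  from assms obtain r s where "\<And>k. Polynomial.coeff P k = Polynomial.monom (r k) a" "\<And>k. Polynomial.coeff Q k = Polynomial.monom (s k) b"
    unfolding xhom_def by metis
  then have "Polynomial.coeff (P * Q) k = Polynomial.monom (\<Sum>i\<le>k. r i * s (k - i)) (a + b)"
    by (simp add: Polynomial.coeff_mult mult_monom monom_sum)
  then show "\<exists>r. Polynomial.coeff (P * Q) k = Polynomial.monom r (a + b)" ..
qed

lemma xhom_const: "xhom 0 [:[:c:]:]"
  unfolding xhom_def
proof
  fix k show "\<exists>r. Polynomial.coeff [:[:c:]:] k = Polynomial.monom r 0"
    by (cases k) (auto simp: Polynomial.monom_0 intro: exI[of _ c] exI[of _ 0])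
qed

lemma xhom_power: "xhom a P \<Longrightarrow> xhom (a * n) (P ^ n)"
  using xhom_const[of 1] by (induction n) (auto simp: one_pCons[symmetric] intro: xhom_mult)

lemma xhom_prod: "(\<And>x. x \<in> A \<Longrightarrow> xhom (n x) (f x)) \<Longrightarrow> xhom (sum n A) (prod f A)"
  using xhom_const[of 1] by (induction A rule: infinite_finite_induct) (auto simp: one_pCons[symmetric] intro: xhom_mult)

lemma xhom_jet:
  assumes "hform n F"
  shows "xhom n (jet v F)"
proof -
  let ?y = "\<lambda>i. [:[:0, Cst (v $ i):], [:0, Var i:]:]"
  have y: "xhom 1 (?y i)" for i
    unfolding xhom_def
  proof
    fix k
    show "\<exists>r. Polynomial.coeff (?y i) k = Polynomial.monom r 1"
      by (cases k; cases "k - 1")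
        (auto simp: monom_Suc Polynomial.monom_0 intro: exI[of _ "Cst (v $ i)"] exI[of _ "Var i"] exI[of _ 0])
  qed
  have "xhom (0 + mdeg e) ([:[:Cst c:]:] * (\<Prod>i\<in>UNIV. ?y i ^ Poly_Mapping.lookup e i))" for e c
    unfolding mdeg_def using xhom_power[OF y] by (intro xhom_mult xhom_prod xhom_const) simp
  then show ?thesis unfolding jet_def pev_def
    using assms by (intro xhom_sum) (auto simp: hform_def)
qed

text \<open>The components of different degrees contribute different powers of \<open>x\<close> to each coefficient of the
  expansion and cannot cancel.\<close>

lemma mult_ge_hcomp:
  assumes "mult_ge v m F"
  shows "mult_ge v m (hcomp n F)"
proof (cases "n \<in> mdeg ` Poly_Mapping.keys F")
  case True
  show ?thesis unfolding mult_ge_def monom_1_dvd_iff'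
  proof (intro allI impI)
    fix k assume k: "k < m"
    have "\<forall>n. \<exists>r. Polynomial.coeff (jet v (hcomp n F)) k = Polynomial.monom r n"
      using xhom_jet[OF hform_hcomp[where F = F], where v = v] by (auto simp: xhom_def)
    then obtain r where r: "\<And>n. Polynomial.coeff (jet v (hcomp n F)) k = Polynomial.monom (r n) n" by metis
    have "0 = Polynomial.coeff (jet v F) k" using assms k by (simp add: mult_ge_def monom_1_dvd_iff')
    also have "jet v F = (\<Sum>n\<in>mdeg ` Poly_Mapping.keys F. jet v (hcomp n F))"
      by (subst sum_hcomp[of F]) (simp add: jet_simps)
    also have "Polynomial.coeff \<dots> k = (\<Sum>n\<in>mdeg ` Poly_Mapping.keys F. Polynomial.monom (r n) n)"
      by (simp add: coeff_sum r)
    also have "Polynomial.coeff \<dots> n = r n" using True by (simp add: coeff_sum)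
    finally have "r n = 0" by simp
    then show "Polynomial.coeff (jet v (hcomp n F)) k = 0" by (simp add: r)
  qed
next
  case False
  then have "hcomp n F = 0"
    by (intro poly_mapping_eqI) (auto simp: lookup_hcomp in_keys_iff image_iff)
  then show ?thesis by simp
qed

lemma coeff_jet_0:
  assumes "hform n F"
  shows "Polynomial.coeff (jet v F) 0 = Polynomial.monom (Cst (poly_eval F v)) n"
proof -
  obtain r where r: "Polynomial.coeff (jet v F) 0 = Polynomial.monom r n"
    using xhom_jet[OF assms, of v] by (auto simp: xhom_def)
  have "r = poly (Polynomial.coeff (jet v F) 0) 1" by (simp add: r poly_monom)
  also have "\<dots> = pev (\<lambda>c. Cst c) (\<lambda>i. Cst (v $ i)) F"
    unfolding jet_def by (subst pev_comp[OF rhom_coeff_0], subst pev_comp[OF rhom_poly]) simp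
  also have "\<dots> = Cst (poly_eval F v)"
    unfolding poly_eval_pev by (subst pev_comp[OF rhom_Cst]) simp
  finally show ?thesis using r by simp
qed

lemma mult_ge_1_iff:
  assumes "hform n F"
  shows "mult_ge v 1 F \<longleftrightarrow> poly_eval F v = 0"
  by (simp add: mult_ge_def monom_1_dvd_iff' coeff_jet_0[OF assms])

lemma mult_ge_1_hcomp_iff: "mult_ge v 1 F \<longleftrightarrow> (\<forall>n. poly_eval (hcomp n F) v = 0)"
proof
  assume "mult_ge v 1 F"
  then show "\<forall>n. poly_eval (hcomp n F) v = 0"
    using mult_ge_hcomp mult_ge_1_iff[OF hform_hcomp] by blast
next
  assume "\<forall>n. poly_eval (hcomp n F) v = 0"
  then have "mult_ge v 1 (\<Sum>n\<in>mdeg ` Poly_Mapping.keys F. hcomp n F)"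
    using mult_ge_1_iff[OF hform_hcomp] by (intro mult_ge_sum) blast
  then show "mult_ge v 1 F" by (simp add: sum_hcomp[symmetric])
qed

text \<open>Specialize the generic direction \<open>Y\<close> to \<open>w\<close>, and \<open>x\<close> to \<open>1\<close>.\<close>

lemma mult_ge_line_poly:
  assumes "mult_ge v m F"
  shows "Polynomial.monom 1 m dvd line_poly v w F"
proof -
  let ?g = "\<lambda>r. poly_eval (poly r 1) w"
  have g: "rhom ?g" by (rule rhom_comp[OF rhom_poly_eval rhom_poly])
  have g0: "?g 0 = 0" by (rule rhomD[OF g])
  have "map_poly ?g (jet v F) = line_poly v w F"
    unfolding jet_def line_poly_def
    by (subst pev_comp[OF rhom_map_poly[OF g]])
      (simp add: map_poly_pCons[of ?g, OF g0] poly_eval_simps)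
  then have "Polynomial.coeff (line_poly v w F) k = ?g (Polynomial.coeff (jet v F) k)" for k
    using coeff_map_poly[of ?g, OF g0] by metis
  then show ?thesis using assms g0 by (simp add: mult_ge_def monom_1_dvd_iff')
qed

lemma ideal_power_mult_ge:
  fixes I :: "'k::field ternary_poly set"
  assumes "\<And>F. F \<in> I \<Longrightarrow> mult_ge v 1 F" "F \<in> ideal_power I m"
  shows "mult_ge v m F"
proof -
  have "ideal_power I m \<subseteq> {F. mult_ge v m F}"
  proof (rule ideal_power_least)
    fix m x y assume "x \<in> {F. mult_ge v m F}" "y \<in> I"
    then show "x * y \<in> {F. mult_ge v (Suc m) F}"
      using mult_ge_mult[of v m x 1 y] assms(1) by simp
  qed (auto intro: mult_ge_add)
  with assms(2) show ?thesis by auto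
qed

lemma line_poly_0:
  "Polynomial.coeff (line_poly v w F) 0 = poly_eval F v"
  unfolding line_poly_def poly_eval_pev by (subst pev_comp[OF rhom_coeff_0]) simp

section \<open>Linear forms and restriction to a line\<close>

text \<open>The intersection point of two lines and, dually, the line through two points.\<close>

definition cross :: "'k::comm_ring_1^3 \<Rightarrow> 'k^3 \<Rightarrow> 'k^3" where
  "cross a b = vector [a$2 * b$3 - a$3 * b$2, a$3 * b$1 - a$1 * b$3, a$1 * b$2 - a$2 * b$1]"

lemmas vec3_simps = dot_def cross_def sum_3 vec_eq_iff forall_3 vector_3

lemma dot_commute: "dot a b = dot b a"
  by (simp add: dot_def mult.commute)

lemma dot_scale: "dot (k *s a) c = k * dot a c" "dot a (k *s c) = k * dot a c"
  by (simp_all add: dot_def sum_distrib_left algebra_simps)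

lemma dot_0 [simp]: "dot 0 a = 0" "dot a 0 = 0"
  by (simp_all add: dot_def)

lemma dot_cross [simp]: "dot a (cross a b) = 0" "dot b (cross a b) = 0"
  "dot (cross a b) a = 0" "dot (cross a b) b = 0"
  by (simp_all add: vec3_simps algebra_simps)

lemma cross_cross: "cross (cross a b) c = dot a c *s b - dot b c *s a"
  by (simp add: vec3_simps algebra_simps)

lemma dot_cross_swap: "dot (cross a b) c = - dot (cross a c) b"
  by (simp add: vec3_simps algebra_simps)

lemma cross_swap: "cross a b = - cross b a"
  by (simp add: vec3_simps algebra_simps)

lemma cramer:
  "dot (cross a b) c *s n = dot (cross b c) n *s a + dot (cross c a) n *s b + dot (cross a b) n *s c"
  by (simp add: vec3_simps algebra_simps)

lemma cross_eq_0D: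
  fixes a b :: "'k::field^3"
  assumes "cross a b = 0" "a \<noteq> 0"
  shows "\<exists>k. b = k *s a"
proof -
  from assms(2) obtain i where i: "a $ i \<noteq> 0" by (auto simp: vec_eq_iff)
  have "a $ i * b $ j = a $ j * b $ i" for j
    using assms(1) exhaust_3[of i] exhaust_3[of j] by (auto simp: vec3_simps algebra_simps)
  then have "b = (b $ i / a $ i) *s a" using i by (simp add: vec_eq_iff field_simps)
  then show ?thesis ..
qed

lemma orthogonal_unique:
  fixes a b :: "'k::field^3"
  assumes "cross a b \<noteq> 0" "dot a v = 0" "dot b v = 0"
  shows "\<exists>k. v = k *s cross a b"
  using cross_eq_0D[of "cross a b" v] assms by (simp add: cross_cross)

lemma exists_dot_nonzero:
  fixes a :: "'k::field^3"
  assumes "a \<noteq> 0"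
  shows "\<exists>c. dot a c \<noteq> 0"
proof -
  from assms obtain i where i: "a $ i \<noteq> 0" by (auto simp: vec_eq_iff)
  have "dot a (axis i 1) = (\<Sum>j\<in>UNIV. if j = i then a $ j else 0)"
    unfolding dot_def by (intro sum.cong) (auto simp: axis_def)
  then show ?thesis using i by (intro exI[of _ "axis i 1"]) simp
qed

lemma exists_separating:
  fixes u v :: "'k::field^3"
  assumes "u \<noteq> 0" "\<not> (\<exists>k. v = k *s u)"
  shows "\<exists>l. dot l u = 0 \<and> dot l v \<noteq> 0"
proof -
  have "cross u v \<noteq> 0" using cross_eq_0D[of u v] assms by auto
  then obtain c where "dot (cross u v) c \<noteq> 0" using exists_dot_nonzero by blast
  then have "dot (cross u c) u = 0 \<and> dot (cross u c) v \<noteq> 0"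
    using dot_cross_swap[of u v c] by simp
  then show ?thesis by blast
qed

lemma lin_add: "lin (a + b) = lin a + lin b"
  by (simp add: lin_def rhomD[OF rhom_Cst] algebra_simps sum.distrib)

lemma lin_scale: "lin (k *s a) = Cst k * lin a"
  by (simp add: lin_def rhomD[OF rhom_Cst] algebra_simps sum_distrib_left)

lemma Var_eq_lin: "Var i = (lin (axis i 1) :: 'k::comm_ring_1 ternary_poly)"
proof -
  have "(lin (axis i 1) :: 'k ternary_poly) = (\<Sum>j\<in>UNIV. if j = i then Var j else 0)"
    unfolding lin_def by (intro sum.cong) (auto simp: axis_def rhomD[OF rhom_Cst])
  then show ?thesis by simp
qed

text \<open>Three linear forms without a common zero span all linear forms, by Cramer's rule.\<close>

lemma lin_combination:
  fixes a b c :: "'k::field^3"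
  assumes "dot (cross a b) c \<noteq> 0"
  shows "\<exists>\<alpha> \<beta> \<gamma>. lin n = Cst \<alpha> * lin a + Cst \<beta> * lin b + Cst \<gamma> * lin c"
proof -
  let ?D = "dot (cross a b) c"
  have "n = (1 / ?D) *s (?D *s n)" using assms by (simp add: vector_smult_assoc)
  also have "\<dots> = (dot (cross b c) n / ?D) *s a + (dot (cross c a) n / ?D) *s b + (dot (cross a b) n / ?D) *s c"
    unfolding cramer[of a b c n] by (simp add: vector_smult_assoc vector_add_ldistrib)
  finally have "lin n = lin \<dots>" by simp
  then show ?thesis unfolding lin_add lin_scale by blast
qed

text \<open>A form is a sum of monomials, and a monomial is built up by multiplying with one variable at a
  time.\<close>

lemma hform_induct [consumes 1, case_names Cst add Var]:
  assumes F: "hform n F"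
    and C: "\<And>c. P 0 (Cst c)"
    and A: "\<And>n F G. hform n F \<Longrightarrow> hform n G \<Longrightarrow> P n F \<Longrightarrow> P n G \<Longrightarrow> P n (F + G)"
    and V: "\<And>n F i. hform n F \<Longrightarrow> P n F \<Longrightarrow> P (Suc n) (Var i * F)"
  shows "P n (F :: 'k::field ternary_poly)"
proof -
  have z: "P n 0" for n
  proof (induction n)
    case 0 then show ?case using C[of 0] by (simp add: rhomD(1)[OF rhom_Cst])
  next
    case (Suc n) then show ?case using V[OF hform_0 Suc, of 1] by simp
  qed
  have mono: "P (mdeg e) (Poly_Mapping.single e c)" for e c
  proof (induction "mdeg e" arbitrary: e)
    case 0
    then have "e = 0" by (intro poly_mapping_eqI) (simp add: mdeg_def)
    then show ?case using C[of c] by (simp add: Cst_def)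
  next
    case (Suc n)
    then obtain i where i: "Poly_Mapping.lookup e i \<noteq> 0"
      by (metis mdeg_def sum.neutral nat.distinct(1))
    define e' where "e' = e - Poly_Mapping.single i 1"
    have e: "e = Poly_Mapping.single i 1 + e'"
      using i by (intro poly_mapping_eqI) (auto simp: e'_def lookup_add lookup_minus lookup_single when_def)
    then have "mdeg e' = n" using Suc(2) by (simp add: mdeg_add)
    moreover have "hform (mdeg e') (Poly_Mapping.single e' c)" by (auto simp: hform_def)
    ultimately have "P (Suc n) (Var i * Poly_Mapping.single e' c)"
      using V[of n "Poly_Mapping.single e' c" i] Suc(1)[of e'] by auto
    then show ?case using e Suc(2) by (simp add: Var_def mult_single)
  qed
  have sum: "hform n (sum f A) \<and> P n (sum f A)" if "finite A" "\<And>e. e \<in> A \<Longrightarrow> hform n (f e) \<and> P n (f e)"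
    for A and f :: "(3 \<Rightarrow>\<^sub>0 nat) \<Rightarrow> 'k ternary_poly"
    using that by (induction A rule: finite_induct) (auto intro: A z hform_add)
  have parts: "hform n (Poly_Mapping.single e (Poly_Mapping.lookup F e)) \<and> P n (Poly_Mapping.single e (Poly_Mapping.lookup F e))"
    if e: "e \<in> Poly_Mapping.keys F" for e
  proof -
    have "mdeg e = n" using F e by (simp add: hform_def)
    then show ?thesis using mono[of e] by (auto simp: hform_def)
  qed
  have "P n (\<Sum>e\<in>Poly_Mapping.keys F. Poly_Mapping.single e (Poly_Mapping.lookup F e))"
    by (rule conjunct2[OF sum[OF finite_keys parts]])
  then show ?thesis by (simp only: sum_singles[symmetric])
qed

text \<open>The ideal of the intersection point of two lines is generated by their equations. Complete them by a
  third form \<open>c\<close> to a system of coordinates; then only a multiple of \<open>c^n\<close> survives modulo \<open>a\<close> and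
  \<open>b\<close>, and it vanishes because \<open>c\<close> does not vanish at \<open>v\<close>.\<close>

lemma point_ideal_generators:
  fixes F :: "'k::field ternary_poly"
  assumes ab: "cross a b \<noteq> 0" and v: "v \<noteq> 0" "dot a v = 0" "dot b v = 0"
    and F: "hform n F" and Fv: "poly_eval F v = 0"
  shows "\<exists>F1 F2. F = lin b * F1 + lin a * F2 \<and> hform (n - 1) F1 \<and> hform (n - 1) F2 \<and> (n = 0 \<longrightarrow> F = 0)"
proof -
  obtain c where c: "dot (cross a b) c \<noteq> 0" using exists_dot_nonzero[OF ab] by blast
  obtain k where k: "v = k *s cross a b" using orthogonal_unique[OF ab v(2,3)] by blast
  have cv: "dot c v \<noteq> 0" using k c v(1) by (auto simp: dot_scale dot_commute)
  have "\<exists>\<gamma> F1 F2. F = Cst \<gamma> * lin c ^ n + lin b * F1 + lin a * F2 \<and> hform (n - 1) F1 \<and> hform (n - 1) F2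
      \<and> (n = 0 \<longrightarrow> F1 = 0 \<and> F2 = 0)"
    using F
  proof (induction rule: hform_induct)
    case (Cst c)
    show ?case by (rule exI[of _ c], rule exI[of _ 0], rule exI[of _ 0]) simp
  next
    case (add n F G)
    then obtain g F1 F2 g' G1 G2 where
      *: "F = Cst g * lin c ^ n + lin b * F1 + lin a * F2" "hform (n - 1) F1" "hform (n - 1) F2"
      "n = 0 \<longrightarrow> F1 = 0 \<and> F2 = 0"
      "G = Cst g' * lin c ^ n + lin b * G1 + lin a * G2" "hform (n - 1) G1" "hform (n - 1) G2"
      "n = 0 \<longrightarrow> G1 = 0 \<and> G2 = 0" by blast
    have "F + G = Cst (g + g') * lin c ^ n + lin b * (F1 + G1) + lin a * (F2 + G2)"
      by (simp add: *(1,5) rhomD[OF rhom_Cst] algebra_simps)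
    moreover have "hform (n - 1) (F1 + G1)" "hform (n - 1) (F2 + G2)"
      using * by (auto intro: hform_add)
    ultimately show ?case using *(4,8) by (metis add_0)
  next
    case (Var n F i)
    then obtain g F1 F2 where
      *: "F = Cst g * lin c ^ n + lin b * F1 + lin a * F2" "hform (n - 1) F1" "hform (n - 1) F2"
      "n = 0 \<longrightarrow> F1 = 0 \<and> F2 = 0" by blast
    obtain \<alpha> \<beta> \<gamma> where x: "(Var i :: 'k ternary_poly) = Cst \<alpha> * lin a + Cst \<beta> * lin b + Cst \<gamma> * lin c"
      unfolding Var_eq_lin using lin_combination[OF c] by blast
    have lc: "hform n (Cst \<gamma> * lin c * G)" if "hform (n - 1) G" "n = 0 \<longrightarrow> G = 0" for G
      using hform_mult[OF hform_Cst_mult[OF hform_lin[of c], of \<gamma>] that(1)] that(2) by (cases n) auto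
    have "Var i * F = Cst (\<gamma> * g) * lin c ^ Suc n + lin b * (Cst \<beta> * F + Cst \<gamma> * lin c * F1)
        + lin a * (Cst \<alpha> * F + Cst \<gamma> * lin c * F2)"
      unfolding x by (simp add: rhomD[OF rhom_Cst] *(1) algebra_simps)
    moreover have "hform n (Cst \<beta> * F + Cst \<gamma> * lin c * F1)" "hform n (Cst \<alpha> * F + Cst \<gamma> * lin c * F2)"
      using * Var(1) by (auto intro!: hform_add lc hform_Cst_mult)
    ultimately show ?case by (metis diff_Suc_1 nat.distinct(1))
  qed
  then obtain \<gamma> F1 F2 where
    *: "F = Cst \<gamma> * lin c ^ n + lin b * F1 + lin a * F2" "hform (n - 1) F1" "hform (n - 1) F2"
    "n = 0 \<longrightarrow> F1 = 0 \<and> F2 = 0" by blast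
  have "\<gamma> * dot c v ^ n = 0" using Fv v(2,3) unfolding *(1) by (simp add: poly_eval_simps)
  then have "\<gamma> = 0" using cv by simp
  then have "F = lin b * F1 + lin a * F2" using *(1) by simp
  then show ?thesis using *(2-4) by (metis add_0 mult_zero_right)
qed

lemma monom_Suc_dvd_pCons: "Polynomial.monom 1 (Suc n) dvd pCons 0 p \<longleftrightarrow> Polynomial.monom 1 n dvd p"
  unfolding monom_1_dvd_iff' by (auto simp: coeff_pCons split: nat.split)

text \<open>The factorization of a binary form by prescribed zeros, lifted to the plane. The points \<open>v j\<close> lie on the
  line \<open>a\<close>, which \<open>b j\<close> meets in \<open>v j\<close>, and \<open>w j\<close> is an auxiliary point that fixes an affine coordinate on
  the line. One zero is split off at a time, using that the ideal of \<open>v j\<close> is generated by \<open>a\<close> and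
  \<open>b j\<close>. The last clause is Bezout's theorem for a line: with more than \<open>t\<close> zeros, the line is a component.\<close>

lemma restrict_to_line:
  fixes F :: "'k::field ternary_poly"
  assumes J: "finite J" and a: "a \<noteq> 0"
    and v: "\<And>j. j \<in> J \<Longrightarrow> v j \<noteq> 0 \<and> dot a (v j) = 0 \<and> dot (b j) (v j) = 0"
    and w: "\<And>j. j \<in> J \<Longrightarrow> dot a (w j) = 0 \<and> dot (b j) (w j) \<noteq> 0"
    and b: "\<And>j k. j \<in> J \<Longrightarrow> k \<in> J \<Longrightarrow> k \<noteq> j \<Longrightarrow> dot (b k) (v j) \<noteq> 0"
    and F: "hform t F" and m: "\<And>j. j \<in> J \<Longrightarrow> Polynomial.monom 1 (m j) dvd line_poly (v j) (w j) F"
  shows "\<exists>H F2. F = (\<Prod>j\<in>J. lin (b j) ^ m j) * H + lin a * F2 \<and> hform (t - sum m J) H \<and>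
    hform (t - 1) F2 \<and> (t < sum m J \<longrightarrow> H = 0)"
  using F m
proof (induction "sum m J" arbitrary: m F t)
  case 0
  have s0: "sum m J = 0" using 0(1) by (rule sym)
  have "m j = 0" if "j \<in> J" for j using that J s0 by simp
  then have p: "(\<Prod>j\<in>J. lin (b j) ^ m j) = 1" by (intro prod.neutral) simp
  show ?case
    by (rule exI[of _ F], rule exI[of _ 0]) (use 0(2) in \<open>simp add: p s0\<close>)
next
  case (Suc N)
  have "\<exists>j\<in>J. m j \<noteq> 0" using Suc(2) by (metis nat.distinct(1) sum.neutral)
  then obtain j where j: "j \<in> J" "m j \<noteq> 0" by blast
  have ab: "cross a (b j) \<noteq> 0"
  proof
    assume "cross a (b j) = 0"
    then obtain k where "b j = k *s a" using cross_eq_0D a by blast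
    then show False using w[OF j(1)] by (auto simp: dot_scale)
  qed
  have "Polynomial.coeff (line_poly (v j) (w j) F) 0 = 0"
    using Suc(4)[OF j(1)] j(2) unfolding monom_1_dvd_iff' by blast
  then have "poly_eval F (v j) = 0" unfolding line_poly_0 .
  then obtain F1 F2 where F12: "F = lin (b j) * F1 + lin a * F2" "hform (t - 1) F1" "hform (t - 1) F2"
    "t = 0 \<longrightarrow> F = 0"
    using point_ideal_generators[OF ab _ _ _ Suc(3)] v[OF j(1)] by blast
  define m' where "m' = m(j := m j - 1)"
  have split: "sum f J = f j + sum f (J - {j})" "prod g J = g j * prod g (J - {j})"
    for f :: "_ \<Rightarrow> nat" and g :: "_ \<Rightarrow> 'k ternary_poly"
    by (rule sum.remove prod.remove; use J j in simp)+
  have summ': "sum m J = Suc (sum m' J)" unfolding split(1) using j(2) by (simp add: m'_def)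
  have "Polynomial.monom 1 (m' k) dvd line_poly (v k) (w k) F1" if k: "k \<in> J" for k
  proof -
    have lF: "line_poly (v k) (w k) F = [:dot (b j) (v k), dot (b j) (w k):] * line_poly (v k) (w k) F1"
      using v[OF k] w[OF k] by (simp add: F12(1) line_poly_simps line_poly_lin)
    show ?thesis
    proof (cases "k = j")
      case True
      have "Polynomial.monom 1 (Suc (m' j)) dvd pCons 0 (Polynomial.smult (dot (b j) (w j)) (line_poly (v j) (w j) F1))"
        using Suc(4)[OF j(1)] lF v[OF j(1)] j(2) True by (simp add: m'_def)
      then show ?thesis using w[OF j(1)] True unfolding monom_Suc_dvd_pCons by (simp add: monom_1_dvd_iff')
    next
      case False
      have "Polynomial.monom 1 (m k) dvd line_poly (v k) (w k) F1"
        by (rule monom_dvd_cancel[rotated, OF Suc(4)[OF k, unfolded lF]]) (use b[OF k j(1)] False in simp)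
      then show ?thesis using False by (simp add: m'_def)
    qed
  qed
  from Suc(1)[OF _ F12(2) this] Suc(2) summ' obtain H F3 where
    H: "F1 = (\<Prod>k\<in>J. lin (b k) ^ m' k) * H + lin a * F3" "hform (t - 1 - sum m' J) H" "hform (t - 1 - 1) F3"
    "t - 1 < sum m' J \<longrightarrow> H = 0" by auto
  have pm: "(\<Prod>k\<in>J. lin (b k) ^ m k) = lin (b j) * (\<Prod>k\<in>J. lin (b k) ^ m' k)"
    unfolding split(2) using j(2) by (cases "m j") (simp_all add: m'_def)
  show ?case
  proof (cases t)
    case 0
    then show ?thesis using F12(4) by (intro exI[of _ 0]) auto
  next
    case (Suc s)
    \<comment> \<open>If \<open>t = 1\<close>, the degree \<open>t - 1 - 1\<close> is truncated, so \<open>F1\<close> has to be treated separately as a constant.\<close>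
    show ?thesis
    proof (cases s)
      case 0
      have "hform 0 F1" using F12(2) Suc 0 by simp
      show ?thesis
      proof (cases "sum m' J")
        case 0
        have m0: "m' k = 0" if "k \<in> J" for k using 0 that J by simp
        have "F = (\<Prod>k\<in>J. lin (b k) ^ m k) * F1 + lin a * F2" using m0 by (simp add: F12(1) pm)
        then show ?thesis using F12(2,3) Suc \<open>s = 0\<close> summ' 0 by auto
      next
        case (Suc r)
        have H0: "H = 0" using H(4) \<open>t = Suc s\<close> \<open>s = 0\<close> Suc by simp
        then have "F1 = lin a * F3" using H(1) by simp
        have "F1 = 0"
        proof (rule ccontr)
          assume "F1 \<noteq> 0"
          moreover have "hform 1 F1" using hform_mult[OF hform_lin H(3)] \<open>F1 = lin a * F3\<close> \<open>t = Suc s\<close> \<open>s = 0\<close> by simp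
          ultimately show False using hform_unique \<open>hform 0 F1\<close> by fastforce
        qed
        then show ?thesis
          by (intro exI[of _ "0 :: 'k ternary_poly"] exI[of _ F2] conjI F12(3)) (simp_all add: F12(1))
      qed
    next
      case (Suc u)
      have eq: "F = (\<Prod>k\<in>J. lin (b k) ^ m k) * H + lin a * (F2 + lin (b j) * F3)"
        by (simp add: F12(1) H(1) pm algebra_simps)
      have "hform (t - 1) (F2 + lin (b j) * F3)"
        using hform_mult[OF hform_lin[of "b j"] H(3)] \<open>t = Suc s\<close> Suc F12(3) by (auto intro: hform_add)
      moreover have "hform (t - sum m J) H" "t < sum m J \<longrightarrow> H = 0" using H(2,4) \<open>t = Suc s\<close> summ' by auto
      ultimately show ?thesis using eq by blast
    qed
  qed
qed

text \<open>A form of degree \<open>t\<close> that vanishes on the line has in particular a zero of order \<open>t + 1\<close> at \<open>v\<close>.\<close>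

lemma line_divides:
  fixes F :: "'k::field ternary_poly"
  assumes a: "a \<noteq> 0" and vw: "v \<noteq> 0" "dot a v = 0" "dot b v = 0" "dot a w = 0" "dot b w \<noteq> 0"
    and F: "hform t F" and 0: "line_poly v w F = 0"
  shows "\<exists>F2. F = lin a * F2 \<and> hform (t - 1) F2"
  using restrict_to_line[of "{()}" a "\<lambda>_. v" "\<lambda>_. b" "\<lambda>_. w" t F "\<lambda>_. Suc t"] assms by auto

lemma hcomp_add: "hcomp n (F + G) = hcomp n F + hcomp n G"
  by (rule poly_mapping_eqI) (simp add: lookup_hcomp lookup_add)

lemma hcomp_0 [simp]: "hcomp n 0 = 0"
  by (rule poly_mapping_eqI) (simp add: lookup_hcomp)

lemma hcomp_sum: "hcomp n (sum f A) = (\<Sum>x\<in>A. hcomp n (f x))"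
  by (induction A rule: infinite_finite_induct) (simp_all add: hcomp_add)

lemma hcomp_eq_0: "n \<notin> mdeg ` Poly_Mapping.keys F \<Longrightarrow> hcomp n F = 0"
  by (intro poly_mapping_eqI) (auto simp: lookup_hcomp in_keys_iff image_iff)

lemma hcomp_mult_hform:
  assumes "hform m G"
  shows "hcomp (m + n) (G * F) = G * hcomp n F"
proof -
  let ?A = "mdeg ` Poly_Mapping.keys F"
  have "hcomp (m + n) (G * F) = hcomp (m + n) (G * (\<Sum>k\<in>?A. hcomp k F))"
    by (simp only: sum_hcomp[symmetric])
  also have "\<dots> = (\<Sum>k\<in>?A. hcomp (m + n) (G * hcomp k F))"
    by (simp add: sum_distrib_left hcomp_sum)
  also have "\<dots> = (\<Sum>k\<in>?A. if k = n then G * hcomp n F else 0)"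
    by (intro sum.cong refl) (auto simp: hcomp_hform[OF hform_mult[OF assms hform_hcomp]])
  also have "\<dots> = G * hcomp n F" by (simp add: hcomp_eq_0)
  finally show ?thesis .
qed

text \<open>The components of a product with a form \<open>G\<close> are the products of \<open>G\<close> with the components, so those of
  the wrong degree vanish.\<close>

lemma hform_cancel:
  assumes G: "hform m G" "G \<noteq> 0" and GF: "hform t (G * F)"
  shows "hform (t - m) (F :: 'k::field ternary_poly)"
proof -
  have "hcomp n F = 0" if "m + n \<noteq> t" for n
  proof -
    have "G * hcomp n F = hcomp (m + n) (G * F)" by (rule hcomp_mult_hform[OF G(1), symmetric])
    also have "\<dots> = 0" using that by (simp add: hcomp_hform[OF GF])
    finally show ?thesis using G(2) by simp
  qed
  then have "hform (t - m) (hcomp n F)" for n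
    using hform_hcomp[of n F] by (cases "m + n = t") auto
  then have "hform (t - m) (\<Sum>n\<in>mdeg ` Poly_Mapping.keys F. hcomp n F)" by (intro hform_sum)
  then show ?thesis by (simp only: sum_hcomp[symmetric])
qed

lemma mult_ge_prod_cancel:
  fixes a :: "'i \<Rightarrow> 'k::field^3"
  assumes "finite S" "\<And>j. j \<in> S \<Longrightarrow> a j \<noteq> 0" "mult_ge v m ((\<Prod>j\<in>S. lin (a j) ^ e j) * F)"
  shows "mult_ge v (m - (\<Sum>j\<in>S. if dot (a j) v = 0 then e j else 0)) F"
proof -
  have pow: "mult_ge v (m - (if dot c v = 0 then n else 0)) F" if "c \<noteq> 0" "mult_ge v m (lin c ^ n * F)" for n m F c
    using that(2)
  proof (induction n arbitrary: m)
    case (Suc n)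
    have "mult_ge v m (lin c * (lin c ^ n * F))" using Suc(2) by (simp add: mult.assoc)
    from Suc(1)[OF mult_ge_lin_cancel[OF that(1) this]]
    show ?case by (cases "dot c v = 0") simp_all
  qed auto
  show ?thesis using assms
  proof (induction S arbitrary: m rule: finite_induct)
    case (insert x S)
    have "mult_ge v m (lin (a x) ^ e x * ((\<Prod>j\<in>S. lin (a j) ^ e j) * F))"
      using insert.prems(2) insert.hyps by (simp add: mult.assoc)
    from insert.IH[OF _ pow[OF _ this]] show ?case using insert.prems(1) insert.hyps by simp
  qed auto
qed

section \<open>Bezout bounds for quasi star configurations\<close>

text \<open>The line \<open>L_i\<close> has the equation \<open>a i\<close> and contains the extra point \<open>q i\<close>. The vectors \<open>b i\<close> are
  equations of auxiliary lines through \<open>q i\<close> that contain none of the star points on \<open>L_i\<close>.\<close>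

locale quasi_star =
  fixes d :: nat and a q b :: "nat \<Rightarrow> 'k::field^3"
  assumes d: "2 \<le> d"
    and q_nonzero: "i \<in> {1..d} \<Longrightarrow> q i \<noteq> 0"
    and q_on_line: "i \<in> {1..d} \<Longrightarrow> dot (a i) (q i) = 0"
    and q_off_lines: "i \<in> {1..d} \<Longrightarrow> j \<in> {1..d} \<Longrightarrow> i \<noteq> j \<Longrightarrow> dot (a j) (q i) \<noteq> 0"
    and lines_distinct: "i \<in> {1..d} \<Longrightarrow> j \<in> {1..d} \<Longrightarrow> i \<noteq> j \<Longrightarrow> cross (a i) (a j) \<noteq> 0"
    and no_three: "i \<in> {1..d} \<Longrightarrow> j \<in> {1..d} \<Longrightarrow> k \<in> {1..d} \<Longrightarrow> i \<noteq> j \<Longrightarrow> i \<noteq> k \<Longrightarrow> j \<noteq> k \<Longrightarrow>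
      dot (a k) (cross (a i) (a j)) \<noteq> 0"
    and b_q: "i \<in> {1..d} \<Longrightarrow> dot (b i) (q i) = 0"
    and b_star: "i \<in> {1..d} \<Longrightarrow> j \<in> {1..d} \<Longrightarrow> i \<noteq> j \<Longrightarrow> dot (b i) (cross (a i) (a j)) \<noteq> 0"
begin

abbreviation D :: "nat set" where "D \<equiv> {1..d}"

text \<open>Since \<open>cross\<close> is antisymmetric, the indices are ordered to get one representative for each star
  point.\<close>

definition pt :: "nat \<Rightarrow> nat \<Rightarrow> 'k^3" where
  "pt i j = cross (a (min i j)) (a (max i j))"

lemma pt_commute: "pt i j = pt j i"
  by (simp add: pt_def min.commute max.commute)

lemma pt_cases: "pt i j = cross (a i) (a j) \<or> pt i j = - cross (a i) (a j)"
  using cross_swap[of "a i" "a j"] by (cases "i \<le> j") (auto simp: pt_def min_def max_def)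

lemma dot_minus [simp]: "dot x (- y) = - dot x (y :: 'k^3)"
  by (simp add: dot_def sum_negf)

lemma pt_nonzero: "i \<in> D \<Longrightarrow> j \<in> D \<Longrightarrow> i \<noteq> j \<Longrightarrow> pt i j \<noteq> 0"
  using pt_cases[of i j] lines_distinct[of i j] by auto

lemma pt_on: "dot (a i) (pt i j) = 0" "dot (a j) (pt i j) = 0"
  using pt_cases[of i j] by auto

lemma pt_off: "i \<in> D \<Longrightarrow> j \<in> D \<Longrightarrow> k \<in> D \<Longrightarrow> i \<noteq> j \<Longrightarrow> k \<noteq> i \<Longrightarrow> k \<noteq> j \<Longrightarrow> dot (a k) (pt i j) \<noteq> 0"
  using pt_cases[of i j] no_three[of i j k] by auto

lemma b_pt: "i \<in> D \<Longrightarrow> j \<in> D \<Longrightarrow> i \<noteq> j \<Longrightarrow> dot (b i) (pt i j) \<noteq> 0"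
  using pt_cases[of i j] b_star[of i j] by auto

lemma exists_other: "\<exists>j\<in>D. j \<noteq> i"
  using d by (intro bexI[of _ "if i = 1 then 2 else 1"]) auto

lemma a_nonzero:
  assumes "i \<in> D"
  shows "a i \<noteq> 0"
proof
  assume "a i = 0"
  obtain j where "j \<in> D" "j \<noteq> i" using exists_other by blast
  with assms have "dot (a i) (q j) \<noteq> 0" by (intro q_off_lines)
  with \<open>a i = 0\<close> show False by simp
qed

definition pts :: "('k^3) set" where
  "pts = q ` D \<union> {pt i j | i j. i \<in> D \<and> j \<in> D \<and> i \<noteq> j}"

abbreviation L :: "nat \<Rightarrow> 'k ternary_poly" where "L i \<equiv> lin (a i)"
abbreviation M :: "nat \<Rightarrow> 'k ternary_poly" where "M i \<equiv> lin (b i)"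
abbreviation Lam :: "nat set \<Rightarrow> 'k ternary_poly" where "Lam S \<equiv> \<Prod>j\<in>S. L j"

definition mult_pts :: "nat \<Rightarrow> nat \<Rightarrow> 'k ternary_poly \<Rightarrow> bool" where
  "mult_pts x y F \<longleftrightarrow> (\<forall>i\<in>D. \<forall>j\<in>D. i \<noteq> j \<longrightarrow> mult_ge (pt i j) x F) \<and> (\<forall>i\<in>D. mult_ge (q i) y F)"

lemma mult_pts_iff: "mult_pts m m F \<longleftrightarrow> (\<forall>v\<in>pts. mult_ge v m F)"
  unfolding mult_pts_def pts_def by blast

text \<open>The restriction to \<open>L_i\<close>, whose \<open>d\<close> marked points are cut out by the other lines and by \<open>M i\<close>.\<close>

lemma star_line:
  assumes i: "i \<in> D" and F: "hform t F"
    and m: "\<And>j. j \<in> D \<Longrightarrow> j \<noteq> i \<Longrightarrow> mult_ge (pt i j) (m j) F" "mult_ge (q i) (m i) F"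
  shows "\<exists>H F2. F = M i ^ m i * (\<Prod>j\<in>D - {i}. L j ^ m j) * H + L i * F2 \<and> hform (t - sum m D) H \<and>
    hform (t - 1) F2 \<and> (t < sum m D \<longrightarrow> H = 0)"
proof -
  obtain j0 where j0: "j0 \<in> D" "j0 \<noteq> i" using exists_other by blast
  let ?v = "\<lambda>j. if j = i then q i else pt i j"
  \<comment> \<open>A second point of \<open>L_i\<close>, different from the marked point \<open>j\<close>.\<close>
  let ?w = "\<lambda>j. if j = i then pt i j0 else q i"
  let ?b = "\<lambda>j. if j = i then b i else a j"
  have "\<exists>H F2. F = (\<Prod>j\<in>D. lin (?b j) ^ m j) * H + lin (a i) * F2 \<and> hform (t - sum m D) H \<and>
    hform (t - 1) F2 \<and> (t < sum m D \<longrightarrow> H = 0)"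
  proof (rule restrict_to_line[where v = ?v and w = ?w])
    show "finite D" "a i \<noteq> 0" "hform t F" using a_nonzero i F by auto
    fix j assume j: "j \<in> D"
    show "?v j \<noteq> 0 \<and> dot (a i) (?v j) = 0 \<and> dot (?b j) (?v j) = 0"
      using i j q_nonzero q_on_line b_q pt_nonzero[of i j] pt_on by auto
    show "dot (a i) (?w j) = 0 \<and> dot (?b j) (?w j) \<noteq> 0"
      using i j j0 q_on_line b_pt[of i j0] q_off_lines[of i j] pt_on by auto
    show "Polynomial.monom 1 (m j) dvd line_poly (?v j) (?w j) F"
      using m(2) m(1)[OF j] by (auto intro!: mult_ge_line_poly)
    fix k assume k: "k \<in> D" "k \<noteq> j"
    show "dot (?b k) (?v j) \<noteq> 0"
      using i j k b_pt[of i j] q_off_lines[of i k] pt_off[of i j k] by auto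
  qed
  moreover have "(\<Prod>j\<in>D. lin (?b j) ^ m j) = M i ^ m i * (\<Prod>j\<in>D - {i}. L j ^ m j)"
  proof -
    have "(\<Prod>j\<in>D. lin (?b j) ^ m j) = lin (?b i) ^ m i * (\<Prod>j\<in>D - {i}. lin (?b j) ^ m j)"
      by (rule prod.remove) (use i in auto)
    moreover have "(\<Prod>j\<in>D - {i}. lin (?b j) ^ m j) = (\<Prod>j\<in>D - {i}. L j ^ m j)"
      by (intro prod.cong) auto
    ultimately show ?thesis by simp
  qed
  ultimately show ?thesis by simp
qed

lemma bezout_line:
  assumes "i \<in> D" "hform t F" "mult_pts x y F" "t < (d - 1) * x + y"
  shows "\<exists>F2. F = L i * F2"
proof -
  let ?m = "\<lambda>j. if j = i then y else x"
  have "sum ?m D = y + (\<Sum>j\<in>D - {i}. ?m j)" by (subst sum.remove[of D i]) (use assms(1) in auto)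
  also have "(\<Sum>j\<in>D - {i}. ?m j) = (\<Sum>j\<in>D - {i}. x)" by (intro sum.cong) auto
  finally have s: "sum ?m D = (d - 1) * x + y" using assms(1) by simp
  show ?thesis using star_line[OF assms(1,2), of ?m] assms(1,3,4) s by (auto simp: mult_pts_def)
qed

text \<open>On \<open>L_i\<close>, no product of other lines vanishes identically.\<close>

lemma line_dvd_Lam_mult:
  assumes i: "i \<in> D" "S \<subseteq> D - {i}" and F: "hform t F" and dv: "Lam S * F = L i * F2"
  shows "\<exists>F3. F = L i * F3"
proof -
  obtain j0 where j0: "j0 \<in> D" "j0 \<noteq> i" using exists_other by blast
  let ?l = "line_poly (q i) (pt i j0)"
  have li: "?l (L i) = 0" using q_on_line[OF i(1)] by (simp add: line_poly_lin pt_on)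
  have "?l (L j) \<noteq> 0" if "j \<in> S" for j
  proof -
    have "dot (a j) (q i) \<noteq> 0" using that i by (intro q_off_lines) auto
    then show ?thesis by (simp add: line_poly_lin)
  qed
  moreover have "finite S" using i(2) finite_subset by blast
  ultimately have "?l (Lam S) \<noteq> 0" by (simp add: line_poly_simps)
  moreover have "?l (Lam S) * ?l F = ?l (L i) * ?l F2" using dv by (simp add: line_poly_simps(4)[symmetric])
  ultimately have "?l F = 0" using li by simp
  then show ?thesis
    using line_divides[OF a_nonzero[OF i(1)] q_nonzero[OF i(1)] q_on_line[OF i(1)] b_q[OF i(1)] pt_on(1) b_pt[OF i(1) j0(1)] F]
      j0 by auto
qed

lemma hform_Lam: "hform (card S) (Lam S)"
  using hform_prod[of S "\<lambda>_. 1" "\<lambda>j. L j", OF hform_lin] by simp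

lemma Lam_nonzero: "S \<subseteq> D \<Longrightarrow> Lam S \<noteq> 0"
  using a_nonzero finite_subset[of S D] by auto

lemma Lam_dvd:
  assumes S: "S \<subseteq> D" and F: "hform t F" and dv: "\<And>i. i \<in> S \<Longrightarrow> \<exists>F2. F = L i * F2"
  shows "\<exists>F2. F = Lam S * F2 \<and> hform (t - card S) F2"
proof -
  have "finite S" using S finite_subset by blast
  then have "\<exists>F2. F = Lam S * F2" using S dv
  proof (induction S rule: finite_induct)
    case (insert i S)
    then obtain F2 where F2: "F = Lam S * F2" by blast
    have h: "hform (t - card S) F2"
      using hform_cancel[OF hform_Lam Lam_nonzero] F insert.prems(1) F2 by blast
    obtain F3 where "F = L i * F3" using insert.prems(2) by blast
    then have "Lam S * F2 = L i * F3" using F2 by simp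
    from line_dvd_Lam_mult[OF _ _ h this] obtain F4 where "F2 = L i * F4" using insert by auto
    then have "F = Lam (insert i S) * F4" using F2 insert.hyps by (simp add: mult_ac)
    then show ?case by blast
  qed simp
  then obtain F2 where F2: "F = Lam S * F2" by blast
  then have "hform (t - card S) F2"
    using hform_cancel[OF hform_Lam Lam_nonzero] F S by blast
  with F2 show ?thesis by blast
qed

text \<open>Every line is a component of a curve of low degree, hence so is their union.\<close>

lemma bezout:
  assumes "hform t F" "mult_pts x y F" "t < (d - 1) * x + y"
  shows "\<exists>F2. F = Lam D * F2 \<and> hform (t - d) F2"
  using Lam_dvd[OF _ assms(1), of D] bezout_line[OF _ assms] by auto

lemma mult_pts_prod_cancel:
  assumes "mult_pts x y ((\<Prod>j\<in>D. L j ^ e j) * F)"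
  shows "i \<in> D \<Longrightarrow> j \<in> D \<Longrightarrow> i \<noteq> j \<Longrightarrow> mult_ge (pt i j) (x - (e i + e j)) F"
    and "i \<in> D \<Longrightarrow> mult_ge (q i) (y - e i) F"
proof -
  note c = mult_ge_prod_cancel[of D a _ _ e F, OF _ a_nonzero]
  show "mult_ge (pt i j) (x - (e i + e j)) F" if ij: "i \<in> D" "j \<in> D" "i \<noteq> j"
  proof -
    have "(\<Sum>l\<in>D. if dot (a l) (pt i j) = 0 then e l else 0) = (\<Sum>l\<in>{i, j}. if dot (a l) (pt i j) = 0 then e l else 0)"
      by (rule sum.mono_neutral_right) (use ij pt_off[OF ij(1,2)] in auto)
    also have "\<dots> = e i + e j" using ij by (simp add: pt_on)
    finally show ?thesis using c[of "pt i j" x] assms ij by (simp add: mult_pts_def)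
  qed
  show "mult_ge (q i) (y - e i) F" if i: "i \<in> D"
  proof -
    have "(\<Sum>l\<in>D. if dot (a l) (q i) = 0 then e l else 0) = (\<Sum>l\<in>{i}. if dot (a l) (q i) = 0 then e l else 0)"
      by (rule sum.mono_neutral_right) (use i q_off_lines[OF i] in auto)
    also have "\<dots> = e i" using i by (simp add: q_on_line)
    finally show ?thesis using c[of "q i" y] assms i by (simp add: mult_pts_def)
  qed
qed

text \<open>Dividing by the product of all lines lowers \<open>(t, x, y)\<close> by \<open>(d, 2, 1)\<close>, and both sides of the
  inequality by \<open>2 d\<close>. When this division is not possible, \<open>t \<ge> (d - 1) x + y\<close> is
  already stronger than the claim.\<close>

lemma degree_bound:
  assumes "hform t F" "F \<noteq> 0" "mult_pts x y F"
  shows "(d - 1) * x + 2 * y \<le> 2 * t"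
  using assms
proof (induction t arbitrary: F x y rule: less_induct)
  case (less t)
  show ?case
  proof (cases "t < (d - 1) * x + y")
    case True
    obtain F2 where F2: "F = Lam D * F2" "hform (t - d) F2" using bezout[OF less.prems(1,3) True] by blast
    then have nz: "F2 \<noteq> 0" using less.prems(2) by auto
    have "hform (d + (t - d)) F" using hform_mult[OF hform_Lam F2(2), of D] F2(1) by simp
    from hform_unique[OF this less.prems(1,2)] have td: "d \<le> t" by simp
    have "mult_pts x y ((\<Prod>j\<in>D. L j ^ 1) * F2)" using less.prems(3) F2(1) by simp
    from mult_pts_prod_cancel[OF this] have "mult_pts (x - 2) (y - 1) F2"
      by (simp add: mult_pts_def numeral_2_eq_2)
    from less.IH[OF _ F2(2) nz this] td d have IH: "(d - 1) * (x - 2) + 2 * (y - 1) \<le> 2 * (t - d)" by simp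
    obtain d' where d': "d = Suc d'" using d by (cases d) auto
    have "(d - 1) * x \<le> (d - 1) * (x - 2) + 2 * (d - 1)" 
      unfolding add_mult_distrib2[symmetric] mult.commute[of 2] by (rule mult_le_mono2) simp
    then have "(d - 1) * x + 2 * y \<le> (d - 1) * (x - 2) + 2 * (d - 1) + 2 * (y - 1) + 2" by simp
    also have "\<dots> \<le> 2 * t" using IH td d by simp
    finally show ?thesis .
  qed simp
qed

text \<open>A nonzero form of degree less than \<open>d\<close> with \<open>d\<close> zeros on each of the \<open>d\<close> lines would be divisible by
  all of them.\<close>

lemma initial_degree:
  assumes "hform t F" "F \<noteq> 0" "mult_pts 1 1 F"
  shows "d \<le> t"
proof (rule ccontr)
  assume "\<not> d \<le> t"
  then obtain F2 where F2: "F = Lam D * F2" "hform (t - d) F2" using bezout[OF assms(1,3)] d by auto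
  have "hform (d + (t - d)) F" using hform_mult[OF hform_Lam F2(2), of D] F2(1) by simp
  from hform_unique[OF this assms(1,2)] \<open>\<not> d \<le> t\<close> show False by simp
qed

end

section \<open>Symbolic and ordinary powers agree in high degree\<close>

definition form_ideal :: "('k::field^3) set \<Rightarrow> 'k ternary_poly set" where
  "form_ideal P = Idl\<^bsub>ring_of_type_algebra\<^esub> {F. is_form F \<and> (\<forall>v\<in>P. poly_eval F v = 0)}"

lemma ideal_form_ideal: "ideal (form_ideal P) ring_of_type_algebra"
  unfolding form_ideal_def by (rule genideal_is_ideal)

lemma form_idealI: "hform n F \<Longrightarrow> (\<And>v. v \<in> P \<Longrightarrow> poly_eval F v = 0) \<Longrightarrow> F \<in> form_ideal P"
  unfolding form_ideal_def by (rule subsetD[OF genideal_superset]) (auto simp: is_form_iff)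

lemma ideal_mult_ge: "ideal {F. mult_ge v m F} ring_of_type_algebra"
  by (rule ideal_typeI) (auto intro: mult_ge_add mult_ge_multL)

lemma form_ideal_mult_ge:
  assumes "v \<in> P" "F \<in> form_ideal P"
  shows "mult_ge v 1 F"
proof -
  have "form_ideal P \<subseteq> {F. mult_ge v 1 F}"
    unfolding form_ideal_def
  proof (rule genideal_least[OF ideal_mult_ge], safe)
    fix F :: "'a ternary_poly" assume "is_form F" "\<forall>v\<in>P. poly_eval F v = 0"
    then show "mult_ge v 1 F" using assms(1) mult_ge_1_iff by (auto simp: is_form_iff)
  qed
  then show ?thesis using assms by blast
qed

context quasi_star
begin

abbreviation I :: "'k ternary_poly set" where "I \<equiv> form_ideal pts"

lemma power_I_ideal: "ideal (ideal_power I n) ring_of_type_algebra"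
  by (rule ideal_ideal_power[OF ideal_form_ideal])

lemma Lam_in_I: "Lam D \<in> I"
proof (rule form_idealI[OF hform_Lam])
  fix v assume "v \<in> pts"
  then obtain i where "i \<in> D" "dot (a i) v = 0"
    unfolding pts_def using q_on_line pt_on(1) by blast
  moreover have "finite D" by simp
  ultimately have "(\<Prod>j\<in>D. dot (a j) v) = 0" by (intro prod_zero) blast+
  then show "poly_eval (Lam D) v = 0" by (simp add: poly_eval_simps)
qed

text \<open>The product of the lines other than \<open>L_i\<close> misses only \<open>q i\<close>.\<close>

lemma M_Lam_in_I:
  assumes i: "i \<in> D"
  shows "M i * Lam (D - {i}) \<in> I"
proof (rule form_idealI[OF hform_mult[OF hform_lin hform_Lam]])
  fix v assume v: "v \<in> pts"
  show "poly_eval (M i * Lam (D - {i})) v = 0"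
  proof (cases "v = q i")
    case True
    then show ?thesis using b_q[OF i] by (simp add: poly_eval_simps)
  next
    case False
    have "\<exists>j\<in>D - {i}. dot (a j) v = 0"
    proof -
      consider j where "j \<in> D" "v = q j" | j l where "j \<in> D" "l \<in> D" "j \<noteq> l" "v = pt j l"
        using v unfolding pts_def by blast
      then show ?thesis
      proof cases
        case 1
        then have "j \<in> D - {i}" "dot (a j) v = 0" using False q_on_line by auto
        then show ?thesis by blast
      next
        case 2
        then have "j \<in> D - {i} \<and> dot (a j) v = 0 \<or> l \<in> D - {i} \<and> dot (a l) v = 0"
          using pt_on by auto
        then show ?thesis by blast
      qed
    qed
    moreover have "finite (D - {i})" by simp
    ultimately have "(\<Prod>j\<in>D - {i}. dot (a j) v) = 0" by (intro prod_zero) blast+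
    then show ?thesis by (simp add: poly_eval_simps)
  qed
qed

lemma Lam_insert: "finite S \<Longrightarrow> i \<notin> S \<Longrightarrow> Lam (insert i S) = L i * Lam S"
  by simp

text \<open>Changing \<open>H\<close> by a multiple of \<open>L_i\<close> amounts to choosing another extension of a binary form on \<open>L_i\<close>. For
  \<open>n = 1\<close> and \<open>S = {}\<close> the lemma says that every binary form of degree at least \<open>d - 1\<close> on \<open>L_i\<close> extends
  to a form that vanishes at all points of the configuration off \<open>L_i\<close>. The lines in \<open>S\<close> are those whose
  equation has already been split off. For \<open>j\<close> outside \<open>S\<close> there is a product \<open>E\<close> of lines that
  has the required property itself and is nonzero at the point where \<open>L_j\<close> meets \<open>L_i\<close>; subtracting a multiple of \<open>E\<close> makes the binary form
  vanish there, and \<open>L_j\<close> can be split off. When all lines are in \<open>S\<close>, their product with \<open>L_i\<close> lies in \<open>I\<close>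
  and uses up one factor of the power.\<close>

lemma lift_into_ideal_power:
  assumes i: "i \<in> D"
  shows "S \<subseteq> D - {i} \<Longrightarrow> hform h H \<Longrightarrow> n * (d - 1) \<le> h + card S \<Longrightarrow>
    \<exists>K. hform h (H + L i * K) \<and> L i ^ n * Lam S * (H + L i * K) \<in> ideal_power I n"
proof (induction "n * d + card (D - {i} - S)" arbitrary: n S h H rule: less_induct)
  case less
  have fS: "finite S" using less.prems(1) finite_subset by blast
  have cS: "card S + card (D - {i} - S) = d - 1"
    using card_Un_disjoint[of S "D - {i} - S"] fS less.prems(1) i by (simp add: Un_absorb1)
  show ?case
  proof (cases n)
    case 0
    then show ?thesis using less.prems by (intro exI[of _ 0]) simp
  next
    case (Suc n')
    show ?thesis
    proof (cases "D - {i} - S = {}")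
      case True
      then have S: "S = D - {i}" using less.prems(1) by blast
      have "n' * (d - 1) \<le> h + card {}" using less.prems(3) cS True Suc by simp
      moreover have "n' * d + card (D - {i} - {}) < n * d + card (D - {i} - S)" using Suc d i by simp
      ultimately obtain K where K: "hform h (H + L i * K)" "L i ^ n' * Lam {} * (H + L i * K) \<in> ideal_power I n'"
        using less.hyps[of n' "{}" h H] less.prems(2) by blast
      have "Lam D = L i * Lam S" unfolding S using i by (simp add: prod.remove)
      then have eq: "L i ^ n * Lam S * (H + L i * K) = (L i ^ n' * Lam {} * (H + L i * K)) * Lam D"
        unfolding Suc by (simp add: mult_ac)
      have "L i ^ n * Lam S * (H + L i * K) \<in> ideal_power I n"
        unfolding eq using ideal_power_SucI[OF K(2) Lam_in_I] unfolding Suc .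
      with K(1) show ?thesis by blast
    next
      case False
      then obtain j where j: "j \<in> D" "j \<noteq> i" "j \<notin> S" by blast
      define W where "W = D - {i} - S - {j}"
      define V where "V = D - {i} - {j}"
      have cW: "card (D - {i} - S) = Suc (card W)"
        unfolding W_def using j by (subst card.remove[of _ j]) auto
      have cV: "card V = d - 2" unfolding V_def using i j by simp
      let ?p = "pt i j"
      have pn: "?p \<noteq> 0" using pt_nonzero i j by blast
      obtain x where x: "dot x ?p \<noteq> 0" using exists_dot_nonzero[OF pn] dot_commute by metis
      define r where "r = h - Suc (card W) - n' * (d - 1)"
      \<comment> \<open>The exponents are such that \<open>L_i^n\<close>, the lines in \<open>S\<close> and \<open>E\<close> together contain the \<open>n\<close>-th power of
        the element of \<open>I\<close> belonging to \<open>q j\<close>.\<close>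
      define E where "E = M j * Lam W * (M j * Lam V) ^ n' * lin x ^ r"
      have cV': "(1 + card V) * n' = n' * (d - 1)"
      proof -
        have "1 + card V = d - 1" using cV d by simp
        then show ?thesis by (simp only: mult.commute)
      qed
      have nd: "n * (d - 1) = (d - 1) + n' * (d - 1)" unfolding Suc by simp
      have hh: "h = (1 + card W) + (1 + card V) * n' + 1 * r"
        unfolding cV' r_def using less.prems(3) cS cW unfolding nd by linarith
      have "hform ((1 + card W) + (1 + card V) * n' + 1 * r) E"
        unfolding E_def by (intro hform_mult hform_power hform_lin hform_Lam)
      then have hE: "hform h E" using hh by simp
      have "dot (b j) ?p \<noteq> 0" using b_pt[OF j(1) i] j by (simp add: pt_commute)
      moreover have "dot (a l) ?p \<noteq> 0" if "l \<in> W \<union> V" for l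
        using that i j by (intro pt_off) (auto simp: W_def V_def)
      ultimately have Ep: "poly_eval E ?p \<noteq> 0"
        unfolding E_def using x by (simp add: poly_eval_simps W_def V_def)
      define c where "c = poly_eval H ?p / poly_eval E ?p"
      have "poly_eval (H - Cst c * E) ?p = 0" using Ep by (simp add: poly_eval_simps c_def)
      moreover have "hform h (H - Cst c * E)" using less.prems(2) hE by (intro hform_diff hform_Cst_mult)
      ultimately obtain F1 F2 where F: "H - Cst c * E = L j * F1 + L i * F2" "hform (h - 1) F1"
        using point_ideal_generators[OF lines_distinct[OF i j(1)] pn pt_on(1) pt_on(2)] j by blast
      have "n * (d - 1) \<le> h - 1 + card (insert j S)"
        using less.prems(3) fS j(3) hh by simp
      moreover have "n * d + card (D - {i} - insert j S) < n * d + card (D - {i} - S)"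
      proof -
        have "D - {i} - insert j S = W" unfolding W_def by blast
        then show ?thesis using cW by simp
      qed
      moreover have "insert j S \<subseteq> D - {i}" using less.prems(1) j by blast
      ultimately obtain K where K: "hform (h - 1) (F1 + L i * K)" "L i ^ n * Lam (insert j S) * (F1 + L i * K) \<in> ideal_power I n"
        using less.hyps[of n "insert j S" "h - 1" F1] F(2) by blast
      have eq: "H + L i * (L j * K - F2) = Cst c * E + L j * (F1 + L i * K)"
        using F(1) by (simp add: algebra_simps)
      have "1 + (h - 1) = h" using hh by simp
      then have "hform h (L j * (F1 + L i * K))" using hform_mult[OF hform_lin K(1)] by metis
      then have 1: "hform h (H + L i * (L j * K - F2))" unfolding eq using hE by (intro hform_add hform_Cst_mult)
      have Dj: "D - {j} = insert i (S \<union> W)" "D - {j} = insert i V"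
        using i j less.prems(1) by (auto simp: W_def V_def)
      have "Lam (S \<union> W) = Lam S * Lam W" by (rule prod.union_disjoint) (use fS in \<open>auto simp: W_def\<close>)
      then have G1: "M j * Lam (D - {j}) = L i * Lam S * (M j * Lam W)"
        unfolding Dj(1) using fS less.prems(1) by (subst Lam_insert) (auto simp: W_def mult_ac)
      have G2: "M j * Lam (D - {j}) = L i * (M j * Lam V)"
        unfolding Dj(2) by (subst Lam_insert) (auto simp: V_def mult_ac)
      have "L i ^ n * Lam S * E = (L i * Lam S * (M j * Lam W)) * (L i * (M j * Lam V)) ^ n' * lin x ^ r"
        unfolding E_def Suc by (simp add: power_mult_distrib mult_ac)
      also have "\<dots> = (M j * Lam (D - {j})) ^ n * lin x ^ r"
        unfolding G1[symmetric] G2[symmetric] Suc by simp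
      also have "\<dots> \<in> ideal_power I n"
        using ideal_power_power[OF M_Lam_in_I[OF j(1)]] idealD(4)[OF power_I_ideal] by blast
      finally have EI: "L i ^ n * Lam S * E \<in> ideal_power I n" .
      have "L i ^ n * Lam S * (H + L i * (L j * K - F2)) =
        Cst c * (L i ^ n * Lam S * E) + L i ^ n * Lam (insert j S) * (F1 + L i * K)"
        unfolding eq using fS j(3) by (simp add: algebra_simps)
      also have "\<dots> \<in> ideal_power I n"
        using EI K(2) idealD(2,3)[OF power_I_ideal] by blast
      finally show ?thesis using 1 by blast
    qed
  qed
qed

text \<open>The exponents \<open>e j\<close> count how often \<open>L_j\<close> has been split off. The line \<open>L_i\<close> processed next is one with the
  least exponent \<open>k\<close>, so that all exponents stay in \<open>{k, k + 1}\<close>. The restriction of \<open>F\<close> to \<open>L_i\<close> is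
  \<open>Y H\<close>, where \<open>Y\<close> collects the forced zeros. As long as \<open>2 k < r\<close>, the product of \<open>Y\<close> with the lines split off so
  far is \<open>L_i^k G^(r - k)\<close> with \<open>G \<in> I\<close>, and \<open>H\<close> has to be lifted so that \<open>L_i^k H \<in> I^k\<close>. Afterwards the
  multiplicities at the star points are used up, the lines split off contribute powers of their full product, and
  \<open>H\<close> together with the lines of exponent \<open>k + 1\<close> has to be lifted into \<open>I^(r - k)\<close>. Multiplicities of the new
  quotient come for free: the part taken away lies in \<open>I^r\<close>, and the order of vanishing is additive.\<close>

lemma fat_forms_in_power_step:
  assumes rd: "r * d \<le> t"
    and e: "\<And>i. i \<in> D \<Longrightarrow> e i \<le> r" "\<And>i j. i \<in> D \<Longrightarrow> j \<in> D \<Longrightarrow> e i \<le> e j + 1"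
    and F: "hform (t - sum e D) F" and m: "mult_pts r r ((\<Prod>j\<in>D. L j ^ e j) * F)"
  shows "(\<Prod>j\<in>D. L j ^ e j) * F \<in> ideal_power I r"
  using e F m
proof (induction "\<Sum>j\<in>D. r - e j" arbitrary: e F rule: less_induct)
  case less
  show ?case
  proof (cases "\<forall>i\<in>D. e i = r")
    case True
    then have "(\<Prod>j\<in>D. L j ^ e j) = Lam D ^ r" by (simp add: prod_power_distrib)
    then show ?thesis using ideal_power_power[OF Lam_in_I] idealD(4)[OF power_I_ideal] by simp
  next
    case False
    define k where "k = Min (e ` D)"
    have "k \<in> e ` D" unfolding k_def using d by (intro Min_in) auto
    then obtain i where i: "i \<in> D" "e i = k" by auto
    have kmin: "k \<le> e j" if "j \<in> D" for j unfolding k_def using that by (intro Min_le) auto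
    have kr: "k < r"
    proof -
      obtain j where j: "j \<in> D" "e j \<noteq> r" using False by blast
      then show ?thesis using kmin[OF j(1)] less.prems(1)[OF j(1)] by linarith
    qed
    have kmax: "e j \<le> k + 1" if "j \<in> D" for j using less.prems(2)[OF that i(1)] i(2) by simp
    let ?D = "D - {i}"
    let ?m = "\<lambda>j. if j = i then r - k else r - k - e j"
    define Y where "Y = M i ^ (r - k) * (\<Prod>j\<in>?D. L j ^ (r - k - e j))"
    have rem: "sum f D = f i + sum f ?D" "prod g D = g i * prod g ?D"
      for f :: "nat \<Rightarrow> nat" and g :: "nat \<Rightarrow> 'k ternary_poly"
      by (rule sum.remove prod.remove; use i(1) in simp)+
    have sum_m: "sum ?m D = (r - k) + (\<Sum>j\<in>?D. r - k - e j)"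
    proof -
      have "sum ?m ?D = (\<Sum>j\<in>?D. r - k - e j)" by (intro sum.cong) auto
      then show ?thesis using rem(1)[of ?m] by simp
    qed
    note mF = mult_pts_prod_cancel[OF less.prems(4)]
    have "mult_ge (pt i j) (?m j) F" if "j \<in> D" "j \<noteq> i" for j
      using mF(1)[OF i(1) that(1)] that(2) i(2) by simp
    moreover have "mult_ge (q i) (?m i) F" using mF(2)[OF i(1)] i(2) by simp
    ultimately obtain H F2 where HF: "F = M i ^ ?m i * (\<Prod>j\<in>?D. L j ^ ?m j) * H + L i * F2"
      "hform (t - sum e D - sum ?m D) H"
      using star_line[OF i(1) less.prems(3), of ?m] by blast
    have "(\<Prod>j\<in>?D. L j ^ ?m j) = (\<Prod>j\<in>?D. L j ^ (r - k - e j))" by (intro prod.cong) auto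
    then have FX: "F = Y * H + L i * F2" using HF(1) by (simp add: Y_def)
    have cD: "card ?D = d - 1" using i(1) by simp
    have Ds: "sum e D + sum ?m D = r + (\<Sum>j\<in>?D. max (e j) (r - k))"
    proof -
      have "sum e D + sum ?m D = r + ((\<Sum>j\<in>?D. e j) + (\<Sum>j\<in>?D. r - k - e j))"
        unfolding sum_m rem(1)[of e] i(2) using kr by simp
      also have "(\<Sum>j\<in>?D. e j) + (\<Sum>j\<in>?D. r - k - e j) = (\<Sum>j\<in>?D. max (e j) (r - k))"
        unfolding sum.distrib[symmetric] by (intro sum.cong) auto
      finally show ?thesis .
    qed
    have rd1: "r + (d - 1) * r \<le> t" using rd d by (cases d) (auto simp: algebra_simps)
    \<comment> \<open>The improved cofactor \<open>H'\<close>; the degree count also shows that the subtractions of degrees are not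
      truncated.\<close>
    obtain H' K where H': "H' = H + L i * K" "hform (t - sum e D - sum ?m D) H'"
      and XH': "(\<Prod>j\<in>D. L j ^ e j) * Y * H' \<in> ideal_power I r" and tle: "sum e D + sum ?m D \<le> t"
    proof (cases "2 * k < r")
      case True
      have mx: "max (e j) (r - k) = r - k" if "j \<in> ?D" for j using kmax[of j] that True by auto
      have "(\<Sum>j\<in>?D. max (e j) (r - k)) = (\<Sum>j\<in>?D. r - k)" by (intro sum.cong refl mx)
      also have "\<dots> = (d - 1) * (r - k)" unfolding sum_constant cD by simp
      finally have s: "sum e D + sum ?m D = r + (d - 1) * (r - k)" unfolding Ds by simp
      have "r + (d - 1) * (r - k) + k * (d - 1) = r + (d - 1) * r"
      proof -
        have "(d - 1) * (r - k) + (d - 1) * k = (d - 1) * r"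
          unfolding add_mult_distrib2[symmetric] using kr by simp
        then show ?thesis by (simp only: mult.commute[of k] add.assoc)
      qed
      then have le: "sum e D + sum ?m D + k * (d - 1) \<le> t" using rd1 s by linarith
      then have "k * (d - 1) \<le> (t - sum e D - sum ?m D) + card {}" by simp
      from lift_into_ideal_power[OF i(1) _ HF(2) this] obtain K where
        K: "hform (t - sum e D - sum ?m D) (H + L i * K)" "L i ^ k * Lam {} * (H + L i * K) \<in> ideal_power I k"
        by blast
      have "(\<Prod>j\<in>?D. L j ^ e j) * (\<Prod>j\<in>?D. L j ^ (r - k - e j)) = (\<Prod>j\<in>?D. L j ^ (r - k))"
        unfolding prod.distrib[symmetric] power_add[symmetric]
        by (intro prod.cong refl arg_cong[of _ _ "\<lambda>n. _ ^ n"]) (use mx in \<open>force simp: max_def split: if_splits\<close>)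
      also have "\<dots> = Lam ?D ^ (r - k)" by (simp add: prod_power_distrib)
      finally have pp: "(\<Prod>j\<in>?D. L j ^ e j) * (\<Prod>j\<in>?D. L j ^ (r - k - e j)) = Lam ?D ^ (r - k)" .
      have "(\<Prod>j\<in>D. L j ^ e j) * Y * (H + L i * K) =
        M i ^ (r - k) * ((\<Prod>j\<in>?D. L j ^ e j) * (\<Prod>j\<in>?D. L j ^ (r - k - e j))) * (L i ^ k * Lam {} * (H + L i * K))"
        unfolding Y_def rem(2) i(2) by (simp add: mult_ac)
      also have "\<dots> = (M i * Lam ?D) ^ (r - k) * (L i ^ k * Lam {} * (H + L i * K))"
        unfolding pp by (simp add: power_mult_distrib)
      also have "\<dots> \<in> ideal_power I ((r - k) + k)"
        by (rule ideal_power_mult[OF ideal_form_ideal ideal_power_power[OF M_Lam_in_I[OF i(1)]] K(2)])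
      finally show ?thesis using that[OF refl K(1)] kr le by simp
    next
      case False
      define S where "S = {j \<in> ?D. e j = k + 1}"
      have mx: "max (e j) (r - k) = e j" if "j \<in> ?D" for j using kmin[of j] that False by auto
      have ek: "e j = k + (if j \<in> S then 1 else 0)" if "j \<in> ?D" for j
        using kmin[of j] kmax[of j] that by (auto simp: S_def)
      have SD: "S \<subseteq> ?D" by (auto simp: S_def)
      have "(\<Sum>j\<in>?D. max (e j) (r - k)) = (\<Sum>j\<in>?D. k + (if j \<in> S then 1 else 0))"
        by (intro sum.cong refl) (use mx ek in simp)
      also have "\<dots> = (d - 1) * k + card S"
      proof -
        have "(\<Sum>j\<in>?D. if j \<in> S then 1 else 0) = (\<Sum>j\<in>S. 1 :: nat)"
          by (rule sum.mono_neutral_cong_right) (use SD in auto)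
        then show ?thesis unfolding sum.distrib sum_constant cD by simp
      qed
      finally have s: "sum e D + sum ?m D = r + ((d - 1) * k + card S)" unfolding Ds by simp
      have cS: "card S \<le> d - 1" using card_mono[OF _ SD] cD by simp
      have rk: "(d - 1) * r = (d - 1) * k + (d - 1) * (r - k)" using kr by (simp add: add_mult_distrib2[symmetric])
      have "(d - 1) * 1 \<le> (d - 1) * (r - k)" by (rule mult_le_mono2) (use kr in arith)
      then have le: "sum e D + sum ?m D \<le> t" using s cS rk rd1 unfolding mult_1_right by linarith
      have "(r - k) * (d - 1) \<le> (t - sum e D - sum ?m D) + card S"
        unfolding mult.commute[of "r - k"] using s cS rk rd1 le by linarith
      from lift_into_ideal_power[OF i(1) SD HF(2) this] obtain K where
        K: "hform (t - sum e D - sum ?m D) (H + L i * K)"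
          "L i ^ (r - k) * Lam S * (H + L i * K) \<in> ideal_power I (r - k)"
        by blast
      have Y: "Y = M i ^ (r - k)"
      proof -
        have "(\<Prod>j\<in>?D. L j ^ (r - k - e j)) = 1"
          by (intro prod.neutral) (use kmin False in \<open>force simp: diff_le_self\<close>)
        then show ?thesis by (simp add: Y_def)
      qed
      have pe: "(\<Prod>j\<in>?D. L j ^ e j) = Lam ?D ^ k * Lam S"
      proof -
        have "(\<Prod>j\<in>?D. L j ^ e j) = (\<Prod>j\<in>?D. L j ^ k * (if j \<in> S then L j else 1))"
          by (intro prod.cong refl) (use ek in simp)
        also have "\<dots> = Lam ?D ^ k * (\<Prod>j\<in>?D. if j \<in> S then L j else 1)"
          by (simp add: prod.distrib prod_power_distrib)
        also have "(\<Prod>j\<in>?D. if j \<in> S then L j else 1) = Lam S"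
          by (rule prod.mono_neutral_cong_right) (use SD in auto)
        finally show ?thesis .
      qed
      have k2: "k = (k - (r - k)) + (r - k)" using False by simp
      have pk: "A ^ k = A ^ (k - (r - k)) * A ^ (r - k)" for A :: "'k ternary_poly"
        by (subst k2) (rule power_add)
      have "(\<Prod>j\<in>D. L j ^ e j) * Y * (H + L i * K) =
        (L i * Lam ?D) ^ k * M i ^ (r - k) * Lam S * (H + L i * K)"
        unfolding Y rem(2) i(2) pe by (simp add: power_mult_distrib mult_ac)
      also have "L i * Lam ?D = Lam D" by (rule rem(2)[symmetric])
      also have "Lam D ^ k = Lam D ^ (k - (r - k)) * (L i * Lam ?D) ^ (r - k)"
        by (subst pk) (simp only: rem(2)[of L])
      also have "Lam D ^ (k - (r - k)) * (L i * Lam ?D) ^ (r - k) * M i ^ (r - k) * Lam S * (H + L i * K) =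
        (Lam D ^ (k - (r - k)) * (M i * Lam ?D) ^ (r - k)) * (L i ^ (r - k) * Lam S * (H + L i * K))"
        by (simp add: power_mult_distrib mult_ac)
      also have "\<dots> \<in> ideal_power I (((k - (r - k)) + (r - k)) + (r - k))"
        by (rule ideal_power_mult[OF ideal_form_ideal ideal_power_mult[OF ideal_form_ideal
          ideal_power_power[OF Lam_in_I] ideal_power_power[OF M_Lam_in_I[OF i(1)]]] K(2)])
      finally show ?thesis using that[OF refl K(1)] kr le k2[symmetric] by simp
    qed
    define F3 where "F3 = F2 - Y * K"
    have FX': "F = Y * H' + L i * F3" unfolding FX H'(1) F3_def by (simp add: algebra_simps)
    have "hform (1 * (r - k) + (\<Sum>j\<in>?D. 1 * (r - k - e j))) Y"
      unfolding Y_def by (intro hform_mult hform_power hform_prod hform_lin)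
    then have "hform (sum ?m D) Y" unfolding sum_m by simp
    from hform_mult[OF this H'(2)] have "hform (t - sum e D) (Y * H')" using tle by simp
    then have "hform (t - sum e D) (L i * F3)" using hform_diff[OF less.prems(3)] FX' by fastforce
    then have h3: "hform (t - sum e D - 1) F3"
      by (rule hform_cancel[OF hform_lin, rotated]) (use a_nonzero[OF i(1)] in simp)
    define e' where "e' = e(i := Suc k)"
    have sume': "sum e' D = Suc (sum e D)" 
    proof -
      have "sum e' ?D = sum e ?D" by (intro sum.cong) (auto simp: e'_def)
      then show ?thesis unfolding rem(1) i(2) by (simp add: e'_def)
    qed
    have prode': "(\<Prod>j\<in>D. L j ^ e' j) = (\<Prod>j\<in>D. L j ^ e j) * L i"
    proof -
      have "(\<Prod>j\<in>?D. L j ^ e' j) = (\<Prod>j\<in>?D. L j ^ e j)" by (intro prod.cong) (auto simp: e'_def)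
      then show ?thesis unfolding rem(2) i(2) by (simp add: e'_def mult_ac)
    qed
    have N: "(\<Prod>j\<in>D. L j ^ e j) * F = (\<Prod>j\<in>D. L j ^ e j) * Y * H' + (\<Prod>j\<in>D. L j ^ e' j) * F3"
      unfolding FX' prode' by (simp add: algebra_simps)
    have "mult_pts r r ((\<Prod>j\<in>D. L j ^ e j) * Y * H')"
      unfolding mult_pts_iff by (intro ballI ideal_power_mult_ge[OF form_ideal_mult_ge XH'])
    then have "mult_pts r r ((\<Prod>j\<in>D. L j ^ e j) * F - (\<Prod>j\<in>D. L j ^ e j) * Y * H')"
      using less.prems(4) unfolding mult_pts_iff by (intro ballI mult_ge_diff) simp_all
    then have m3: "mult_pts r r ((\<Prod>j\<in>D. L j ^ e' j) * F3)" unfolding N by simp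
    have "(\<Sum>j\<in>D. r - e' j) < (\<Sum>j\<in>D. r - e j)"
    proof -
      have "(\<Sum>j\<in>?D. r - e' j) = (\<Sum>j\<in>?D. r - e j)" by (intro sum.cong) (auto simp: e'_def)
      then show ?thesis unfolding rem(1)[of "\<lambda>j. r - e' j"] rem(1)[of "\<lambda>j. r - e j"] i(2)
        using kr by (simp add: e'_def)
    qed
    moreover have "e' j \<le> r" if "j \<in> D" for j using less.prems(1)[OF that] kr by (simp add: e'_def)
    moreover have "e' j \<le> e' l + 1" if "j \<in> D" "l \<in> D" for j l
      using less.prems(2)[OF that] kmax[OF that(1)] kmin[OF that(2)] by (auto simp: e'_def)
    moreover have "hform (t - sum e' D) F3" using h3 unfolding sume' by simp
    ultimately have "(\<Prod>j\<in>D. L j ^ e' j) * F3 \<in> ideal_power I r" using m3 by (rule less.hyps)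
    then show ?thesis unfolding N using XH' idealD(2)[OF power_I_ideal] by blast
  qed
qed

text \<open>Start with no line split off. Symbolic and ordinary power thus agree in degrees at least \<open>r d\<close>.\<close>

lemma fat_forms_in_power:
  assumes "r * d \<le> t" "hform t F" "\<And>v. v \<in> pts \<Longrightarrow> mult_ge v r F"
  shows "F \<in> ideal_power I r"
  using fat_forms_in_power_step[OF assms(1), of "\<lambda>_. 0" F] assms(2,3) by (simp add: mult_pts_iff)

end

section \<open>Symbolic powers of the ideal of finitely many points\<close>

lemma ideal_power_antimono:
  assumes I: "ideal I (ring_of_type_algebra :: 'a::idom ring)" and "m \<le> n"
  shows "ideal_power I n \<subseteq> ideal_power I m"
  using assms(2)
proof (induction n rule: dec_induct)
  case (step n)
  have "ideal_power I (Suc n) \<subseteq> ideal_power I n"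
    using ring.ideal_prod_inter[OF ring_type_ring ideal_ideal_power[OF I] I, of n]
    by (simp add: ideal_power_Suc)
  with step show ?case by blast
qed simp

text \<open>Representatives of distinct projective points; that they are distinct is expressed by lines
  through one and not through the other.\<close>

locale point_set =
  fixes P :: "('k::field^3) set"
  assumes fin: "finite P" and ne: "P \<noteq> {}" and nz: "v \<in> P \<Longrightarrow> v \<noteq> 0"
    and sep: "u \<in> P \<Longrightarrow> v \<in> P \<Longrightarrow> u \<noteq> v \<Longrightarrow> \<exists>l. dot l u = 0 \<and> dot l v \<noteq> 0"
begin

abbreviation J :: "'k ternary_poly set" where "J \<equiv> form_ideal P"

lemma mem_J_iff: "F \<in> J \<longleftrightarrow> (\<forall>v\<in>P. mult_ge v 1 F)"
proof
  show "F \<in> J \<Longrightarrow> \<forall>v\<in>P. mult_ge v 1 F" using form_ideal_mult_ge by blast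
  assume *: "\<forall>v\<in>P. mult_ge v 1 F"
  have "hcomp n F \<in> J" for n
    by (rule form_idealI[OF hform_hcomp]) (use * mult_ge_1_hcomp_iff in blast)
  then have "(\<Sum>n\<in>mdeg ` Poly_Mapping.keys F. hcomp n F) \<in> J"
    by (intro ideal_sum[OF ideal_form_ideal])
  then show "F \<in> J" by (simp only: sum_hcomp[symmetric])
qed

lemma separator:
  assumes v: "v \<in> P"
  shows "\<exists>g. \<not> mult_ge v 1 g \<and> (\<forall>u\<in>P - {v}. mult_ge u 1 g)"
proof -
  have "\<forall>u\<in>P - {v}. \<exists>l. dot l u = 0 \<and> dot l v \<noteq> 0" using sep v by blast
  then obtain l where l: "\<And>u. u \<in> P - {v} \<Longrightarrow> dot (l u) u = 0 \<and> dot (l u) v \<noteq> 0" by metis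
  define g where "g = (\<Prod>u\<in>P - {v}. lin (l u))"
  have h: "hform (\<Sum>u\<in>P - {v}. 1) g" unfolding g_def by (rule hform_prod[OF hform_lin])
  have f: "finite (P - {v})" using fin by simp
  have "poly_eval g v \<noteq> 0" unfolding g_def using l f by (simp add: poly_eval_simps)
  moreover have "poly_eval g u = 0" if u: "u \<in> P - {v}" for u
  proof -
    have "(\<Prod>x\<in>P - {v}. dot (l x) u) = 0" using f by (rule prod_zero) (use u l in blast)
    then show ?thesis unfolding g_def by (simp add: poly_eval_simps)
  qed
  ultimately show ?thesis using mult_ge_1_iff[OF h] by (intro exI[of _ g]) blast
qed

lemma not_mult_ge_1_one: "\<not> mult_ge v 1 1"
  using mult_ge_1_iff[OF hform_1, of v] by (simp add: poly_eval_simps)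

text \<open>The prime ideal of \<open>v\<close> is the annihilator modulo \<open>J\<close> of a polynomial that vanishes at all points
  except \<open>v\<close>.\<close>

lemma point_ideal_associated:
  assumes v: "v \<in> P"
  shows "{F. mult_ge v 1 F} \<in> associated_primes J"
proof -
  obtain g where g: "\<not> mult_ge v 1 g" "\<forall>u\<in>P - {v}. mult_ge u 1 g" using separator[OF v] by blast
  have "{F. mult_ge v 1 F} = {F. F * g \<in> J}"
  proof (intro Collect_cong iffI)
    fix F assume "mult_ge v 1 F"
    then have "mult_ge u 1 (F * g)" if "u \<in> P" for u
      using that g(2) mult_ge_multL[of u 1 F g] mult_ge_multL[of u 1 g F] by (cases "u = v") (simp_all add: mult.commute)
    then show "F * g \<in> J" unfolding mem_J_iff by blast
  next
    fix F assume "F * g \<in> J"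
    then have "mult_ge v 1 (g * F)" using v unfolding mem_J_iff by (simp add: mult.commute)
    then show "mult_ge v 1 F" by (rule mult_ge_cancel[OF g(1)])
  qed
  moreover have "primeideal {F. mult_ge v 1 F} ring_of_type_algebra"
  proof (rule primeidealI[OF ideal_mult_ge cring_type_ring])
    show "carrier ring_of_type_algebra \<noteq> {F. mult_ge v 1 F}" using not_mult_ge_1_one by auto
    fix F G :: "'k ternary_poly"
    assume "F \<otimes>\<^bsub>ring_of_type_algebra\<^esub> G \<in> {F. mult_ge v 1 F}"
    then show "F \<in> {F. mult_ge v 1 F} \<or> G \<in> {F. mult_ge v 1 F}" using mult_ge_cancel[of v F 1 G] by auto
  qed
  ultimately show ?thesis unfolding associated_primes_def by blast
qed

lemma associated_nonempty: "associated_primes J \<noteq> {}"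
  using ne point_ideal_associated by blast

text \<open>The denominator avoids the prime ideal of \<open>v\<close>, so it does not change the order of vanishing at
  \<open>v\<close>.\<close>

lemma symbolic_power_mult_ge:
  assumes "F \<in> symbolic_power J m" "v \<in> P"
  shows "mult_ge v m F"
proof -
  obtain u where u: "\<forall>Q\<in>associated_primes J. u \<notin> Q" "u * F \<in> ideal_power J m"
    using iffD1[OF symbolic_power_iff[OF ideal_form_ideal associated_nonempty] assms(1)] by blast
  have "u \<notin> {F. mult_ge v 1 F}" by (rule bspec[OF u(1) point_ideal_associated[OF assms(2)]])
  then have "\<not> mult_ge v 1 u" by simp
  moreover have "mult_ge v m (u * F)"
    by (rule ideal_power_mult_ge[OF form_ideal_mult_ge[OF assms(2)] u(2)])
  ultimately show ?thesis by (rule mult_ge_cancel)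
qed

text \<open>The polynomials that lie in \<open>J^m\<close> after localizing at the prime ideal of \<open>v\<close>.\<close>

definition local_power :: "'k^3 \<Rightarrow> nat \<Rightarrow> 'k ternary_poly set" where
  "local_power v m = {F. \<exists>g. \<not> mult_ge v 1 g \<and> g * F \<in> ideal_power J m}"

text \<open>Prime avoidance made explicit: weighting the local denominators \<open>g v\<close> with separating polynomials
  \<open>h v\<close> gives a common denominator that vanishes at none of the points.\<close>

lemma local_powers_symbolic:
  assumes "\<And>v. v \<in> P \<Longrightarrow> F \<in> local_power v m"
  shows "F \<in> symbolic_power J m"
proof -
  obtain g where g: "\<And>v. v \<in> P \<Longrightarrow> \<not> mult_ge v 1 (g v) \<and> g v * F \<in> ideal_power J m"
    using assms unfolding local_power_def by (simp add: Bex_def) metis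
  obtain h where h: "\<And>v. v \<in> P \<Longrightarrow> \<not> mult_ge v 1 (h v) \<and> (\<forall>u\<in>P - {v}. mult_ge u 1 (h v))"
    using separator by metis
  define u where "u = (\<Sum>v\<in>P. h v * g v)"
  have "u * F = (\<Sum>v\<in>P. h v * (g v * F))" by (simp add: u_def sum_distrib_right mult.assoc)
  also have "\<dots> \<in> ideal_power J m"
  proof (rule ideal_sum[OF ideal_ideal_power[OF ideal_form_ideal]])
    fix v assume "v \<in> P"
    then show "h v * (g v * F) \<in> ideal_power J m"
      using idealD(3)[OF ideal_ideal_power[OF ideal_form_ideal] conjunct2[OF g]] by simp
  qed
  finally have uF: "u * F \<in> ideal_power J m" .
  have nu: "\<not> mult_ge v 1 u" if v: "v \<in> P" for v
  proof
    assume m: "mult_ge v 1 u"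
    have "mult_ge v 1 (\<Sum>w\<in>P - {v}. g w * h w)"
    proof (intro mult_ge_sum mult_ge_multL)
      fix w assume "w \<in> P - {v}"
      then show "mult_ge v 1 (h w)" using h[of w] v by auto
    qed
    then have "mult_ge v 1 (u - (\<Sum>w\<in>P - {v}. g w * h w))" by (rule mult_ge_diff[OF m])
    also have "u - (\<Sum>w\<in>P - {v}. g w * h w) = h v * g v"
      unfolding u_def by (subst sum.remove[OF fin v]) (simp add: mult.commute)
    finally have "mult_ge v 1 (g v)" using h[OF v] by (auto intro: mult_ge_cancel)
    then show False using g[OF v] by simp
  qed
  have "u \<notin> Q" if Q: "Q \<in> associated_primes J" for Q
  proof
    assume uQ: "u \<in> Q"
    obtain x where x: "Q = {g. g * x \<in> J}" and pQ: "primeideal Q ring_of_type_algebra"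
      using Q unfolding associated_primes_def by blast
    have iQ: "ideal Q ring_of_type_algebra" using pQ by (rule primeideal.axioms(1))
    have "1 \<notin> Q"
    proof
      assume "1 \<in> Q"
      then have "Q = UNIV" using idealD(3)[OF iQ, of 1] by auto
      then show False using primeideal.I_notcarr[OF pQ] by simp
    qed
    then have "x \<notin> J" by (simp add: x)
    moreover have "mult_ge v 1 x" if v: "v \<in> P" for v
    proof -
      have "mult_ge v 1 (u * x)" using uQ v unfolding x mem_J_iff by simp
      then show ?thesis by (rule mult_ge_cancel[OF nu[OF v]])
    qed
    ultimately show False unfolding mem_J_iff by blast
  qed
  with uF have "\<exists>u. (\<forall>Q\<in>associated_primes J. u \<notin> Q) \<and> u * F \<in> ideal_power J m" by blast
  then show ?thesis by (rule iffD2[OF symbolic_power_iff[OF ideal_form_ideal associated_nonempty]])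
qed

lemma not_mult_ge_mult: "\<not> mult_ge v 1 F \<Longrightarrow> \<not> mult_ge v 1 G \<Longrightarrow> \<not> mult_ge v 1 (F * G)"
  using mult_ge_cancel by blast

lemma local_power_0 [simp]: "F \<in> local_power v 0"
  unfolding local_power_def using not_mult_ge_1_one by auto

lemma local_power_mult:
  assumes "F \<in> local_power v m" "G \<in> local_power v n"
  shows "F * G \<in> local_power v (m + n)"
proof -
  obtain f g where fg: "\<not> mult_ge v 1 f" "f * F \<in> ideal_power J m" "\<not> mult_ge v 1 g" "g * G \<in> ideal_power J n"
    using assms unfolding local_power_def by blast
  have "(f * g) * (F * G) = (f * F) * (g * G)" by (simp add: mult_ac)
  also have "\<dots> \<in> ideal_power J (m + n)" by (rule ideal_power_mult[OF ideal_form_ideal fg(2,4)])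
  finally show ?thesis using not_mult_ge_mult[OF fg(1,3)] unfolding local_power_def by blast
qed

lemma local_power_multL: "F \<in> local_power v m \<Longrightarrow> G * F \<in> local_power v m"
  using local_power_mult[OF local_power_0, of F v m G] by simp

lemma local_power_add:
  assumes "F \<in> local_power v m" "G \<in> local_power v m"
  shows "F + G \<in> local_power v m"
proof -
  obtain f g where fg: "\<not> mult_ge v 1 f" "f * F \<in> ideal_power J m" "\<not> mult_ge v 1 g" "g * G \<in> ideal_power J m"
    using assms unfolding local_power_def by blast
  have "(f * g) * (F + G) = g * (f * F) + f * (g * G)" by (simp add: algebra_simps)
  also have "\<dots> \<in> ideal_power J m"
    using fg(2,4) idealD(2,3)[OF ideal_ideal_power[OF ideal_form_ideal]] by blast
  finally show ?thesis using not_mult_ge_mult[OF fg(1,3)] unfolding local_power_def by blast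
qed

lemma local_power_zero: "0 \<in> local_power v m"
  using local_power_multL[of _ v m 0] idealD(1)[OF ideal_ideal_power[OF ideal_form_ideal, of P m]]
    not_mult_ge_1_one[of v]
  by (auto simp: local_power_def)

lemma local_power_sum: "(\<And>x. x \<in> A \<Longrightarrow> f x \<in> local_power v m) \<Longrightarrow> sum f A \<in> local_power v m"
  by (induction A rule: infinite_finite_induct) (auto intro: local_power_add local_power_zero)

lemma local_power_antimono: "m \<le> n \<Longrightarrow> local_power v n \<subseteq> local_power v m"
  unfolding local_power_def using ideal_power_antimono[OF ideal_form_ideal] by blast

lemma local_power_pow: "F \<in> local_power v m \<Longrightarrow> F ^ n \<in> local_power v (m * n)"
  by (induction n) (auto dest: local_power_mult)

lemma local_power_prod:
  "(\<And>x. x \<in> A \<Longrightarrow> f x \<in> local_power v (m x)) \<Longrightarrow> prod f A \<in> local_power v (sum m A)"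
  by (induction A rule: infinite_finite_induct) (auto intro: local_power_mult)

text \<open>Multiplied with a polynomial that vanishes at the other points, a line through \<open>v\<close> lies in
  \<open>J\<close>.\<close>

lemma local_power_lin:
  assumes v: "v \<in> P" and a: "dot a v = 0"
  shows "lin a \<in> local_power v 1"
proof -
  obtain g where g: "\<not> mult_ge v 1 g" "\<forall>u\<in>P - {v}. mult_ge u 1 g" using separator[OF v] by blast
  have va: "mult_ge v 1 (lin a)" by (rule iffD2[OF mult_ge_1_iff[OF hform_lin]]) (simp add: a)
  have "mult_ge u 1 (g * lin a)" if "u \<in> P" for u
    using that g(2) mult_ge_multL[of u 1 "lin a" g] mult_ge_multL[of u 1 g "lin a"] va
    by (cases "u = v") (simp_all add: mult.commute)
  then have "g * lin a \<in> J" unfolding mem_J_iff by blast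
  then show ?thesis using g(1) ideal_power_1 unfolding local_power_def by blast
qed

end

section \<open>Forms in symbolic powers bound the resurgence from below\<close>

text \<open>The power \<open>n\<close> of the irrelevant ideal, described through monomials.\<close>

definition low_ideal :: "nat \<Rightarrow> 'k::field ternary_poly set" where
  "low_ideal n = {F. \<forall>e\<in>Poly_Mapping.keys F. n \<le> mdeg e}"

lemma low_ideal_add: "F \<in> low_ideal n \<Longrightarrow> G \<in> low_ideal n \<Longrightarrow> F + G \<in> low_ideal n"
  using keys_add[of F G] unfolding low_ideal_def by blast

lemma low_ideal_mult: "F \<in> low_ideal m \<Longrightarrow> G \<in> low_ideal n \<Longrightarrow> F * G \<in> low_ideal (m + n)"
  using keys_mult[of F G] unfolding low_ideal_def by (fastforce simp: mdeg_add intro: add_mono)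

lemma ideal_low_ideal: "ideal (low_ideal n) ring_of_type_algebra"
proof (rule ideal_typeI)
  fix a x :: "'a ternary_poly" assume "x \<in> low_ideal n"
  then show "a * x \<in> low_ideal n" using low_ideal_mult[of a 0 x n] by (simp add: low_ideal_def[of 0])
next
  show "(0 :: 'a ternary_poly) \<in> low_ideal n" by (simp add: low_ideal_def)
qed (rule low_ideal_add)

lemma form_ideal_power_degree:
  fixes F :: "'k::field ternary_poly"
  assumes deg: "\<And>n F. hform n F \<Longrightarrow> F \<noteq> 0 \<Longrightarrow> (\<And>v. v \<in> P \<Longrightarrow> poly_eval F v = 0) \<Longrightarrow> d \<le> n"
    and F: "F \<in> ideal_power (form_ideal P) r" "hform t F" "F \<noteq> 0"
  shows "r * d \<le> t"
proof -
  have "form_ideal P \<subseteq> low_ideal d"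
    unfolding form_ideal_def
  proof (rule genideal_least[OF ideal_low_ideal], safe)
    fix F :: "'k ternary_poly" assume "is_form F" and v: "\<forall>v\<in>P. poly_eval F v = 0"
    then obtain n where n: "hform n F" by (auto simp: is_form_iff)
    show "F \<in> low_ideal d"
    proof (cases "F = 0")
      case False
      then have "d \<le> n" using deg[OF n] v by blast
      then show ?thesis using n by (auto simp: low_ideal_def hform_def)
    qed (simp add: low_ideal_def)
  qed
  note sub = this
  have "ideal_power (form_ideal P) r \<subseteq> low_ideal (r * d)"
  proof (rule ideal_power_least[where Q = "\<lambda>r. low_ideal (r * d)"])
    fix m and x y :: "'k ternary_poly" assume "x \<in> low_ideal (m * d)" "y \<in> form_ideal P"
    then show "x * y \<in> low_ideal (Suc m * d)"
      using low_ideal_mult[of x "m * d" y d] sub by (auto simp: add.commute)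
  next
    show "low_ideal (0 * d) = (UNIV :: 'k ternary_poly set)" by (simp add: low_ideal_def)
  qed (rule low_ideal_add)
  with F(1) have "F \<in> low_ideal (r * d)" by blast
  moreover obtain e where "e \<in> Poly_Mapping.keys F" using F(3) keys_eq_empty[of F] by blast
  ultimately show ?thesis using F(2) by (auto simp: low_ideal_def hform_def)
qed

text \<open>The power \<open>F^N\<close> lies in \<open>J^(m N)\<close>, but its degree \<open>N t\<close> is too small for \<open>J^r\<close> as soon as
  \<open>r > N t / d\<close>. The quotients \<open>m N / r\<close> for the least such \<open>r\<close> tend to \<open>m d / t\<close>.\<close>

lemma (in point_set) resurgence_ge:
  assumes d: "0 < d"
    and deg: "\<And>n F. hform n F \<Longrightarrow> F \<noteq> 0 \<Longrightarrow> (\<And>v. v \<in> P \<Longrightarrow> poly_eval F v = 0) \<Longrightarrow> d \<le> n"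
    and F: "hform t F" "F \<noteq> 0" "\<And>v. v \<in> P \<Longrightarrow> F \<in> local_power v m" and m: "0 < m" and t: "0 < t"
  shows "ereal (real m * real d / real t) \<le> resurgence J"
proof -
  have N: "ereal (real m * real d / (real t + real d / real N)) \<le> resurgence J" if N: "0 < N" for N
  proof -
    define r where "r = N * t div d + 1"
    have "F ^ N \<in> symbolic_power J (m * N)" by (intro local_powers_symbolic local_power_pow F(3))
    moreover have "F ^ N \<notin> ideal_power J r"
    proof
      assume "F ^ N \<in> ideal_power J r"
      then have "r * d \<le> t * N"
      proof (rule form_ideal_power_degree[rotated])
        show "hform (t * N) (F ^ N)" by (rule hform_power[OF F(1)])
        show "F ^ N \<noteq> 0" using F(2) by simp
      qed (rule deg)
      moreover have "N * t < r * d" unfolding r_def using d by (simp add: dividend_less_div_times)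
      ultimately show False by (simp add: mult.commute)
    qed
    ultimately have "ereal (real (m * N) / real r) \<le> resurgence J"
      unfolding resurgence_def using m N
      by (intro Sup_upper CollectI exI[of _ "m * N"] exI[of _ r]) (auto simp: r_def)
    moreover have "real m * real d / (real t + real d / real N) \<le> real (m * N) / real r"
    proof -
      have "real r * real d \<le> real N * real t + real d"
      proof -
        have "N * t div d * d \<le> N * t" by simp
        then have "r * d \<le> N * t + d" unfolding r_def by (simp add: add_mult_distrib)
        then have "real (r * d) \<le> real (N * t + d)" by (rule of_nat_mono)
        then show ?thesis by simp
      qed
      then have "real m * (real r * real d) \<le> real m * (real N * real t + real d)"
        by (rule mult_left_mono) simp
      then have le: "real m * (real r * real d) / real r \<le> real m * (real N * real t + real d) / real r"
        by (rule divide_right_mono) simp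
      have r: "0 < real r" by (simp add: r_def)
      have T: "0 < real t + real d / real N" using t by (intro add_pos_nonneg) simp_all
      have "real N * (real t + real d / real N) = real N * real t + real d"
        using N by (simp add: distrib_left)
      then have "real (m * N) / real r * (real t + real d / real N) = real m * (real N * real t + real d) / real r"
        by (simp add: mult.assoc)
      moreover have "real m * (real r * real d) / real r = real m * real d" using r by simp
      ultimately show ?thesis using le unfolding pos_divide_le_eq[OF T] by linarith
    qed
    ultimately show ?thesis by (meson ereal_less_eq(3) order_trans)
  qed
  have "(\<lambda>N. real m * real d / (real t + real d / real N)) \<longlonglongrightarrow> real m * real d / (real t + 0)"
    using t by (intro tendsto_intros lim_const_over_n) auto
  then have "(\<lambda>N. ereal (real m * real d / (real t + real d / real N))) \<longlonglongrightarrow> ereal (real m * real d / real t)"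
    by simp
  then show ?thesis
    by (rule LIMSEQ_le_const2) (use N in \<open>auto intro: exI[of _ 1]\<close>)
qed

section \<open>Forms with prescribed multiplicities\<close>

text \<open>Gaussian elimination of one equation and one unknown at a time.\<close>

lemma homogeneous_system:
  fixes \<phi> :: "'y \<Rightarrow> 'x \<Rightarrow> 'k::field"
  assumes "finite Y" "finite V" "card Y < card V"
  shows "\<exists>c. (\<exists>x\<in>V. c x \<noteq> 0) \<and> (\<forall>y\<in>Y. (\<Sum>x\<in>V. c x * \<phi> y x) = 0)"
  using assms
proof (induction Y arbitrary: V \<phi> rule: finite_induct)
  case empty
  then obtain x where "x \<in> V" by (metis card.empty ex_in_conv less_irrefl)
  then show ?case by (intro exI[of _ "\<lambda>_. 1"]) auto
next
  case (insert z Y)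
  show ?case
  proof (cases "\<forall>x\<in>V. \<phi> z x = 0")
    case True
    have "card Y < card V" using insert by simp
    then obtain c where c: "\<exists>x\<in>V. c x \<noteq> 0" "\<forall>y\<in>Y. (\<Sum>x\<in>V. c x * \<phi> y x) = 0"
      using insert.IH[OF insert.prems(1)] by blast
    then show ?thesis using True by (intro exI[of _ c]) simp
  next
    case False
    then obtain x0 where x0: "x0 \<in> V" "\<phi> z x0 \<noteq> 0" by blast
    define \<psi> where "\<psi> y x = \<phi> y x - \<phi> y x0 / \<phi> z x0 * \<phi> z x" for y x
    have "card Y < card (V - {x0})" using insert x0(1) by simp
    then obtain c where c: "\<exists>x\<in>V - {x0}. c x \<noteq> 0" "\<forall>y\<in>Y. (\<Sum>x\<in>V - {x0}. c x * \<psi> y x) = 0"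
      using insert.IH[of "V - {x0}" \<psi>] insert.prems(1) by blast
    define s where "s = (\<Sum>x\<in>V - {x0}. c x * \<phi> z x)"
    define c' where "c' = c(x0 := - s / \<phi> z x0)"
    have sum': "(\<Sum>x\<in>V. c' x * \<phi> y x) = - s / \<phi> z x0 * \<phi> y x0 + (\<Sum>x\<in>V - {x0}. c x * \<phi> y x)" for y
    proof -
      have "(\<Sum>x\<in>V - {x0}. c' x * \<phi> y x) = (\<Sum>x\<in>V - {x0}. c x * \<phi> y x)"
        by (intro sum.cong) (auto simp: c'_def)
      then show ?thesis by (subst sum.remove[OF insert.prems(1) x0(1)]) (simp add: c'_def)
    qed
    have "(\<Sum>x\<in>V. c' x * \<phi> z x) = 0" unfolding sum' using x0(2) by (simp add: s_def)
    moreover have "(\<Sum>x\<in>V. c' x * \<phi> y x) = 0" if "y \<in> Y" for y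
    proof -
      have "(\<Sum>x\<in>V - {x0}. c x * \<psi> y x) = (\<Sum>x\<in>V - {x0}. c x * \<phi> y x) - \<phi> y x0 / \<phi> z x0 * s"
        by (simp add: \<psi>_def s_def sum_subtractf sum_distrib_left algebra_simps)
      then show ?thesis using c(2) that unfolding sum' by (simp add: algebra_simps)
    qed
    moreover have "\<exists>x\<in>V. c' x \<noteq> 0" using c(1) by (auto simp: c'_def)
    ultimately show ?thesis by (intro exI[of _ c']) simp
  qed
qed

text \<open>Both the exponents of the monomials of degree less than \<open>m\<close> in two local coordinates and, after
  dehomogenizing, the ternary monomials of degree \<open>m - 1\<close>.\<close>

definition triangle :: "nat \<Rightarrow> (nat \<times> nat) set" where
  "triangle m = {(i, j). i + j < m}"

lemma triangle_Suc: "triangle (Suc m) = triangle m \<union> (\<lambda>i. (i, m - i)) ` {..m}"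
  unfolding triangle_def by (auto simp: image_iff)

lemma finite_triangle [simp]: "finite (triangle m)"
  by (rule finite_subset[of _ "{..m} \<times> {..m}"]) (auto simp: triangle_def)

lemma card_triangle: "2 * card (triangle m) = m * (m + 1)"
proof (induction m)
  case (Suc m)
  have "card (triangle (Suc m)) = card (triangle m) + card ((\<lambda>i. (i, m - i)) ` {..m})"
    unfolding triangle_Suc by (rule card_Un_disjoint) (simp, simp, auto simp: triangle_def)
  also have "card ((\<lambda>i. (i, m - i)) ` {..m}) = Suc m"
    by (subst card_image) (auto simp: inj_on_def)
  finally show ?case using Suc by simp
qed (simp add: triangle_def)

text \<open>The monomials in three independent linear forms span the forms of a given degree.\<close>

lemma form_span:
  fixes a b c :: "'k::field^3"
  assumes abc: "dot (cross a b) c \<noteq> 0" and F: "hform n F"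
    and "\<And>F G. F \<in> Q \<Longrightarrow> G \<in> Q \<Longrightarrow> F + G \<in> Q" "\<And>r F. F \<in> Q \<Longrightarrow> Cst r * F \<in> Q"
    and "\<And>i j k. i + j + k = n \<Longrightarrow> lin a ^ i * lin b ^ j * lin c ^ k \<in> Q"
  shows "F \<in> Q"
  using F assms(3-5)
proof (induction arbitrary: Q rule: hform_induct)
  case (Cst r)
  have "lin a ^ 0 * lin b ^ 0 * lin c ^ 0 \<in> Q" by (rule Cst(3)) simp
  from Cst(2)[OF this, of r] show ?case by simp
next
  case (add n F G)
  have "F \<in> Q" by (rule add.IH(1)) (fact add.prems)+
  moreover have "G \<in> Q" by (rule add.IH(2)) (fact add.prems)+
  ultimately show ?case by (rule add.prems(1))
next
  case (Var n F i)
  let ?Q' = "{G. lin a * G \<in> Q \<and> lin b * G \<in> Q \<and> lin c * G \<in> Q}"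
  have "F \<in> ?Q'"
  proof (rule Var.IH)
    fix G H assume "G \<in> ?Q'" "H \<in> ?Q'"
    then show "G + H \<in> ?Q'" by (simp add: distrib_left Var.prems(1))
  next
    fix r G assume "G \<in> ?Q'"
    then show "Cst r * G \<in> ?Q'" by (simp add: mult.left_commute[of _ "Cst r"] Var.prems(2))
  next
    fix i j k :: nat assume ijk: "i + j + k = n"
    have "lin a ^ Suc i * lin b ^ j * lin c ^ k \<in> Q" "lin a ^ i * lin b ^ Suc j * lin c ^ k \<in> Q"
      "lin a ^ i * lin b ^ j * lin c ^ Suc k \<in> Q"
      by (rule Var.prems(3); use ijk in simp)+
    then show "lin a ^ i * lin b ^ j * lin c ^ k \<in> ?Q'" by (simp add: mult_ac)
  qed
  then have F: "lin a * F \<in> Q" "lin b * F \<in> Q" "lin c * F \<in> Q" by simp_all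
  obtain \<alpha> \<beta> \<gamma> where x: "(Var i :: 'k ternary_poly) = Cst \<alpha> * lin a + Cst \<beta> * lin b + Cst \<gamma> * lin c"
    unfolding Var_eq_lin using lin_combination[OF abc] by blast
  have "Var i * F = Cst \<alpha> * (lin a * F) + Cst \<beta> * (lin b * F) + Cst \<gamma> * (lin c * F)"
    unfolding x by (simp add: algebra_simps)
  moreover have "\<dots> \<in> Q" by (intro Var.prems(1,2) F)
  ultimately show ?case by simp
qed

lemma exists_complement:
  fixes v :: "'k::field^3"
  assumes v: "v \<noteq> 0"
  shows "\<exists>a b c. dot a v = 0 \<and> dot b v = 0 \<and> dot (cross a b) c \<noteq> 0"
proof -
  have "cross v (axis 1 1) \<noteq> 0 \<or> cross v (axis 2 1) \<noteq> 0"
    using v by (auto simp: vec3_simps axis_def)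
  then obtain y where "cross v y \<noteq> 0" by blast
  then obtain x where x: "dot (cross v y) x \<noteq> 0" using exists_dot_nonzero by blast
  obtain c where c: "dot v c \<noteq> 0" using exists_dot_nonzero[OF v] by blast
  have "cross (cross v x) (cross v y) = - dot x (cross v y) *s v"
    unfolding cross_cross by simp
  then have "dot (cross (cross v x) (cross v y)) c = - dot x (cross v y) * dot v c"
    by (simp only: dot_scale)
  then have "dot (cross (cross v x) (cross v y)) c \<noteq> 0" using x c by (simp add: dot_commute)
  moreover have "dot (cross v x) v = 0" "dot (cross v y) v = 0" by simp_all
  ultimately show ?thesis by blast
qed

text \<open>Modulo the local power, a form is determined by its \<open>m (m + 1) / 2\<close> Taylor coefficients of
  order less than \<open>m\<close>.\<close>

lemma (in point_set) local_expansion: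
  assumes v: "v \<in> P"
  shows "\<exists>B. \<forall>F. hform n F \<longrightarrow> (\<exists>\<mu>. F - (\<Sum>y\<in>triangle m. Cst (\<mu> y) * B y) \<in> local_power v m)"
proof -
  obtain a b c where abc: "dot a v = 0" "dot b v = 0" "dot (cross a b) c \<noteq> 0"
    using exists_complement[OF nz[OF v]] by blast
  \<comment> \<open>\<open>a\<close> and \<open>b\<close> are local coordinates at \<open>v\<close>, and \<open>c\<close> is nonzero there. For \<open>i + j > n\<close> the exponent
    \<open>n - i - j\<close> is truncated; such terms are given the coefficient zero.\<close>
  define B where "B = (\<lambda>(i, j). lin a ^ i * lin b ^ j * lin c ^ (n - i - j))"
  let ?Q = "{F. \<exists>\<mu>. F - (\<Sum>y\<in>triangle m. Cst (\<mu> y) * B y) \<in> local_power v m}"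
  have "F \<in> ?Q" if F: "hform n F" for F
  proof (rule form_span[OF abc(3) F])
    fix F G assume "F \<in> ?Q" "G \<in> ?Q"
    then obtain \<mu> \<nu> where "F - (\<Sum>y\<in>triangle m. Cst (\<mu> y) * B y) \<in> local_power v m"
      "G - (\<Sum>y\<in>triangle m. Cst (\<nu> y) * B y) \<in> local_power v m" by blast
    from local_power_add[OF this]
    have "F + G - (\<Sum>y\<in>triangle m. Cst (\<mu> y + \<nu> y) * B y) \<in> local_power v m"
      by (simp add: rhomD[OF rhom_Cst] algebra_simps sum.distrib)
    then show "F + G \<in> ?Q" by (intro CollectI exI[of _ "\<lambda>y. \<mu> y + \<nu> y"])
  next
    fix r F assume "F \<in> ?Q"
    then obtain \<mu> where "F - (\<Sum>y\<in>triangle m. Cst (\<mu> y) * B y) \<in> local_power v m" by blast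
    from local_power_multL[OF this, of "Cst r"]
    have "Cst r * F - (\<Sum>y\<in>triangle m. Cst (r * \<mu> y) * B y) \<in> local_power v m"
      by (simp add: rhomD[OF rhom_Cst] algebra_simps sum_distrib_left)
    then show "Cst r * F \<in> ?Q" by (intro CollectI exI[of _ "\<lambda>y. r * \<mu> y"])
  next
    fix i j k assume ijk: "i + j + k = n"
    let ?F = "lin a ^ i * lin b ^ j * lin c ^ k"
    show "?F \<in> ?Q"
    proof (cases "i + j < m")
      case True
      define \<mu> :: "nat \<times> nat \<Rightarrow> 'k" where "\<mu> y = (if y = (i, j) then 1 else 0)" for y
      have "(\<Sum>y\<in>triangle m. Cst (\<mu> y) * B y) = (\<Sum>y\<in>triangle m. if y = (i, j) then B y else 0)"
        by (intro sum.cong) (auto simp: \<mu>_def rhomD[OF rhom_Cst])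
      also have "\<dots> = B (i, j)"
      proof -
        have "(i, j) \<in> triangle m" using True by (simp add: triangle_def)
        then show ?thesis by simp
      qed
      also have "\<dots> = ?F" using ijk by (auto simp: B_def)
      finally have "?F - (\<Sum>y\<in>triangle m. Cst (\<mu> y) * B y) \<in> local_power v m"
        using local_power_zero by simp
      then show ?thesis by (intro CollectI exI[of _ \<mu>])
    next
      case False
      have "lin a ^ i \<in> local_power v (1 * i)" "lin b ^ j \<in> local_power v (1 * j)"
        by (rule local_power_pow[OF local_power_lin[OF v]]; fact)+
      from local_power_multL[OF local_power_mult[OF this], of "lin c ^ k"]
      have "?F \<in> local_power v (i + j)" by (simp add: mult_ac)
      then have "?F \<in> local_power v m" using local_power_antimono[of m "i + j" v] False by auto
      then have "?F - (\<Sum>y\<in>triangle m. Cst 0 * B y) \<in> local_power v m" by (simp add: rhomD[OF rhom_Cst])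
      then show ?thesis by (intro CollectI exI[of _ "\<lambda>_. 0"])
    qed
  qed
  then show ?thesis by blast
qed

text \<open>A form of degree \<open>t\<close> has \<open>(t + 1) (t + 2) / 2\<close> coefficients, and multiplicity \<open>w v\<close> at \<open>v\<close>
  imposes \<open>w v (w v + 1) / 2\<close> linear conditions on them.\<close>

lemma (in point_set) exists_fat_form:
  assumes S: "S \<subseteq> P" and count: "(\<Sum>v\<in>S. w v * (w v + 1)) < (t + 1) * (t + 2)"
  shows "\<exists>G. hform t G \<and> G \<noteq> 0 \<and> (\<forall>v\<in>S. G \<in> local_power v (w v))"
proof -
  have fS: "finite S" using S fin finite_subset by blast
  let ?X = "triangle (t + 1)"
  let ?Y = "Sigma S (\<lambda>v. triangle (w v))"
  \<comment> \<open>The exponents of the monomials of degree \<open>t\<close>, indexed by the exponents of the first two variables.\<close>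
  define ex :: "nat \<times> nat \<Rightarrow> 3 \<Rightarrow>\<^sub>0 nat" where
    "ex = (\<lambda>(i, j). Poly_Mapping.single 1 i + Poly_Mapping.single 2 j + Poly_Mapping.single 3 (t - i - j))"
  have lookup_ex: "Poly_Mapping.lookup (ex (i, j)) 1 = i" "Poly_Mapping.lookup (ex (i, j)) 2 = j" for i j
    by (simp_all add: ex_def lookup_add lookup_single)
  have inj: "x = y" if "ex x = ex y" for x y
    using that lookup_ex by (metis surj_pair)
  have mdeg_ex: "mdeg (ex x) = t" if "x \<in> ?X" for x
    using that by (auto simp: ex_def mdeg_add triangle_def)
  have "2 * card ?Y < 2 * card ?X"
  proof -
    have "card ?Y = (\<Sum>v\<in>S. card (triangle (w v)))" by (rule card_SigmaI) (use fS in auto)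
    then have "2 * card ?Y = (\<Sum>v\<in>S. w v * (w v + 1))" by (simp only: sum_distrib_left card_triangle)
    moreover have "2 * card ?X = (t + 1) * (t + 2)" by (simp add: card_triangle)
    ultimately show ?thesis using count by simp
  qed
  then have card: "card ?Y < card ?X" by simp
  define mon :: "nat \<times> nat \<Rightarrow> 'k ternary_poly" where "mon x = Poly_Mapping.single (ex x) 1" for x
  have hmon: "hform t (mon x)" if "x \<in> ?X" for x
    using mdeg_ex[OF that] by (simp add: hform_def mon_def)
  have "\<forall>v\<in>S. \<exists>B. \<forall>F. hform t F \<longrightarrow> (\<exists>\<mu>. F - (\<Sum>y\<in>triangle (w v). Cst (\<mu> y) * B y) \<in> local_power v (w v))"
    by (intro ballI local_expansion subsetD[OF S])
  from bchoice[OF this] obtain B where B: "\<forall>v\<in>S. \<forall>F. hform t F \<longrightarrow>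
      (\<exists>\<mu>. F - (\<Sum>y\<in>triangle (w v). Cst (\<mu> y) * B v y) \<in> local_power v (w v))" ..
  define \<mu> where "\<mu> v x = (SOME \<mu>. mon x - (\<Sum>y\<in>triangle (w v). Cst (\<mu> y) * B v y) \<in> local_power v (w v))" for v x
  have \<mu>: "mon x - (\<Sum>y\<in>triangle (w v). Cst (\<mu> v x y) * B v y) \<in> local_power v (w v)"
    if "v \<in> S" "x \<in> ?X" for v x
    unfolding \<mu>_def by (rule someI_ex[OF B[rule_format, OF that(1) hmon[OF that(2)]]])
  obtain c where c: "\<exists>x\<in>?X. c x \<noteq> 0" "\<forall>z\<in>?Y. (\<Sum>x\<in>?X. c x * \<mu> (fst z) x (snd z)) = 0"
    using homogeneous_system[OF _ _ card, of "\<lambda>z x. \<mu> (fst z) x (snd z)"] fS by auto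
  define G where "G = (\<Sum>x\<in>?X. Cst (c x) * mon x)"
  have "hform t G" unfolding G_def by (intro hform_sum hform_Cst_mult hmon)
  moreover have "G \<noteq> 0"
  proof -
    obtain x0 where x0: "x0 \<in> ?X" "c x0 \<noteq> 0" using c(1) by blast
    have "Poly_Mapping.lookup G (ex x0) = (\<Sum>x\<in>?X. if x = x0 then c x else 0)"
      unfolding G_def lookup_sum using inj
      by (intro sum.cong) (auto simp: mon_def Cst_def mult_single lookup_single when_def)
    also have "\<dots> = c x0" using x0(1) by simp
    finally show ?thesis using x0(2) by auto
  qed
  moreover have "G \<in> local_power v (w v)" if v: "v \<in> S" for v
  proof -
    let ?R = "\<lambda>x. \<Sum>y\<in>triangle (w v). Cst (\<mu> v x y) * B v y"
    have "(\<Sum>x\<in>?X. Cst (c x) * ?R x) = (\<Sum>y\<in>triangle (w v). Cst (\<Sum>x\<in>?X. c x * \<mu> v x y) * B v y)"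
      by (simp add: rhomD[OF rhom_Cst] sum_distrib_left sum_distrib_right mult.assoc) (rule sum.swap)
    also have "\<dots> = 0"
    proof (rule sum.neutral, rule ballI)
      fix y assume "y \<in> triangle (w v)"
      then have "(v, y) \<in> ?Y" using v by blast
      then have "(\<Sum>x\<in>?X. c x * \<mu> v x y) = 0" using c(2) by fastforce
      then show "Cst (\<Sum>x\<in>?X. c x * \<mu> v x y) * B v y = 0" by (simp only: rhomD(1)[OF rhom_Cst] mult_zero_left)
    qed
    finally have "G = (\<Sum>x\<in>?X. Cst (c x) * (mon x - ?R x))"
      by (simp add: G_def right_diff_distrib sum_subtractf)
    also have "\<dots> \<in> local_power v (w v)" by (intro local_power_sum local_power_multL \<mu>[OF v])
    finally show ?thesis .
  qed
  ultimately show ?thesis by blast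
qed

section \<open>Bounds for the resurgence\<close>

context quasi_star
begin

lemma q_in_pts: "i \<in> D \<Longrightarrow> q i \<in> pts"
  by (simp add: pts_def)

lemma pt_in_pts: "i \<in> D \<Longrightarrow> j \<in> D \<Longrightarrow> i \<noteq> j \<Longrightarrow> pt i j \<in> pts"
  unfolding pts_def by blast

lemma pts_cases:
  assumes "v \<in> pts"
  obtains (q) i where "i \<in> D" "v = q i" | (star) i j where "i \<in> D" "j \<in> D" "i \<noteq> j" "v = pt i j"
  using assms unfolding pts_def by blast

lemma pts_separated:
  assumes "u \<in> pts" "v \<in> pts" "u \<noteq> v"
  shows "\<exists>l. dot l u = 0 \<and> dot l v \<noteq> 0"
  using assms(1)
proof (cases rule: pts_cases)
  case (q i)
  note u = this
  show ?thesis using assms(2)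
  proof (cases rule: pts_cases)
    case (q j)
    then have "j \<noteq> i" using u assms(3) by blast
    then have "dot (a i) (q j) \<noteq> 0" using q u by (intro q_off_lines)
    then show ?thesis using q_on_line[OF u(1)] u q by blast
  next
    case (star j l)
    consider "i = j" | "i = l" | "i \<noteq> j" "i \<noteq> l" by blast
    then show ?thesis
    proof cases
      case 1
      then have "dot (b i) v \<noteq> 0" using b_pt[OF star(1-3)] star(4) by simp
      then show ?thesis using b_q[OF u(1)] u by blast
    next
      case 2
      then have "dot (b i) v \<noteq> 0" using b_pt[OF star(2,1)] star(3,4) by (simp add: pt_commute)
      then show ?thesis using b_q[OF u(1)] u by blast
    next
      case 3
      then have "dot (a i) v \<noteq> 0" using pt_off[OF star(1,2) u(1) star(3)] star(4) by simp
      then show ?thesis using q_on_line[OF u(1)] u by blast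
    qed
  qed
next
  case (star i j)
  note u = this
  show ?thesis using assms(2)
  proof (cases rule: pts_cases)
    case (q k)
    obtain x where x: "x \<in> {i, j}" "x \<noteq> k" using u(3) by blast
    have "dot (a x) v \<noteq> 0" unfolding q(2) by (rule q_off_lines) (use q u x in auto)
    moreover have "dot (a x) u = 0" using x(1) u(4) pt_on by auto
    ultimately show ?thesis by blast
  next
    case (star k l)
    have "{i, j} \<noteq> {k, l}" using u star assms(3) pt_commute[of i j] by (auto simp: doubleton_eq_iff)
    then obtain x where x: "x \<in> {i, j}" "x \<noteq> k" "x \<noteq> l" using u(3) star(3) by auto
    have "dot (a x) v \<noteq> 0" unfolding star(4) by (rule pt_off) (use star u x in auto)
    moreover have "dot (a x) u = 0" using x(1) u(4) pt_on by auto
    ultimately show ?thesis by blast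
  qed
qed

lemma finite_pts: "finite pts"
proof -
  have "pts \<subseteq> q ` D \<union> (\<lambda>(i, j). pt i j) ` (D \<times> D)" unfolding pts_def by auto
  then show ?thesis by (rule finite_subset) simp
qed

sublocale point_set pts
proof
  show "finite pts" by (rule finite_pts)
  show "pts \<noteq> {}" using q_in_pts[of 1] d by auto
  show "v \<noteq> 0" if "v \<in> pts" for v
    using that
  proof (cases rule: pts_cases)
    case (q i) then show ?thesis using q_nonzero[OF q(1)] by simp
  next
    case (star i j) then show ?thesis using pt_nonzero[OF star(1-3)] by simp
  qed
qed (rule pts_separated)

lemma vanishing_form_degree:
  assumes "hform n F" "F \<noteq> 0" "\<And>v. v \<in> pts \<Longrightarrow> poly_eval F v = 0"
  shows "d \<le> n"
  by (rule initial_degree[OF assms(1,2)]) (simp add: mult_pts_iff mult_ge_1_iff[OF assms(1), unfolded One_nat_def] assms(3))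

text \<open>The nonzero components of an element of \<open>I^(m)\<close> have degree at least \<open>m (d + 1) / 2 \<ge> r d\<close>, where
  symbolic and ordinary powers agree.\<close>

lemma symbolic_subset_power:
  assumes "2 * d * r \<le> m * (d + 1)"
  shows "symbolic_power I m \<subseteq> ideal_power I r"
proof
  fix F assume F: "F \<in> symbolic_power I m"
  have rm: "r \<le> m"
  proof -
    have "(d + 1) * r \<le> 2 * d * r" using d by (intro mult_le_mono1) simp
    also have "\<dots> \<le> (d + 1) * m" using assms by (simp add: mult.commute)
    finally show ?thesis by (simp only: mult_le_cancel1)
  qed
  have "hcomp n F \<in> ideal_power I r" for n
  proof (cases "hcomp n F = 0")
    case True
    then show ?thesis using idealD(1)[OF power_I_ideal] by simp
  next
    case False
    have m: "mult_ge v m (hcomp n F)" if "v \<in> pts" for v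
      by (rule mult_ge_hcomp[OF symbolic_power_mult_ge[OF F that]])
    then have "mult_pts m m (hcomp n F)" unfolding mult_pts_iff by blast
    from degree_bound[OF hform_hcomp False this] have "(d - 1) * m + 2 * m \<le> 2 * n" .
    moreover have "(d - 1) * m + 2 * m = m * (d + 1)" using d by (cases d) simp_all
    ultimately have "2 * d * r \<le> 2 * n" using assms by linarith
    then have "r * d \<le> n" by (simp add: mult_ac)
    then show ?thesis by (rule fat_forms_in_power[OF _ hform_hcomp]) (rule mult_ge_mono[OF m rm])
  qed
  then have "(\<Sum>n\<in>mdeg ` Poly_Mapping.keys F. hcomp n F) \<in> ideal_power I r"
    by (intro ideal_sum[OF power_I_ideal])
  then show "F \<in> ideal_power I r" by (simp only: sum_hcomp[symmetric])
qed

lemma resurgence_le: "resurgence I \<le> ereal (2 - 2 / (real d + 1))"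
  unfolding resurgence_def
proof (rule Sup_least)
  fix x assume "x \<in> {ereal (real m / real r) | m r. m > 0 \<and> r > 0 \<and> \<not> symbolic_power I m \<subseteq> ideal_power I r}"
  then obtain m r where x: "x = ereal (real m / real r)"
    and mr: "0 < m" "0 < r" "\<not> symbolic_power I m \<subseteq> ideal_power I r" by blast
  have "m * (d + 1) < 2 * d * r" using symbolic_subset_power[of r m] mr(3) by linarith
  then have "real (m * (d + 1)) < real (2 * d * r)" by (simp only: of_nat_less_iff)
  then have "real m * (real d + 1) \<le> 2 * real d * real r" by (simp add: algebra_simps)
  then have "real m / real r \<le> 2 * real d / (real d + 1)" using mr(2) by (simp add: divide_simps)
  also have "\<dots> = 2 - 2 / (real d + 1)" by (simp add: field_simps)
  finally show "x \<le> ereal (2 - 2 / (real d + 1))" by (simp add: x)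
qed

lemma Lam_local_q:
  assumes i: "i \<in> D"
  shows "Lam D \<in> local_power (q i) 1"
proof -
  have "Lam D = L i * Lam (D - {i})" by (rule prod.remove) (use i in auto)
  then have "Lam D = Lam (D - {i}) * L i" by (simp only: mult.commute)
  then show ?thesis using local_power_multL[OF local_power_lin[OF q_in_pts q_on_line]] i by simp
qed

lemma Lam_local_pt:
  assumes ij: "i \<in> D" "j \<in> D" "i \<noteq> j"
  shows "Lam D \<in> local_power (pt i j) 2"
proof -
  have "Lam D = L i * Lam (D - {i})" by (rule prod.remove) (use ij in auto)
  also have "Lam (D - {i}) = L j * Lam (D - {i} - {j})" by (rule prod.remove) (use ij in auto)
  finally have "Lam D = Lam (D - {i} - {j}) * (L i * L j)" by (simp only: mult_ac)
  moreover have "L i * L j \<in> local_power (pt i j) (1 + 1)"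
    by (intro local_power_mult local_power_lin pt_in_pts pt_on ij)
  ultimately show ?thesis using local_power_multL by (simp add: numeral_2_eq_2)
qed

text \<open>Multiply \<open>G\<close> with the \<open>k\<close>-th power of the product of all lines, which has multiplicity \<open>2 k\<close> at the star
  points but only \<open>k\<close> at the extra points.\<close>

lemma resurgence_ge_of_form:
  assumes k: "0 < k" and G: "hform s G" "G \<noteq> 0" "\<And>i. i \<in> D \<Longrightarrow> G \<in> local_power (q i) k"
  shows "ereal (2 * real k * real d / (real d * real k + real s)) \<le> resurgence I"
proof -
  have h: "hform (d * k + s) (Lam D ^ k * G)"
    using hform_mult[OF hform_power[OF hform_Lam[of D], of k] G(1)] by simp
  have "Lam D ^ k * G \<in> local_power v (2 * k)" if "v \<in> pts" for v
    using that
  proof (cases rule: pts_cases)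
    case (q i)
    have "Lam D ^ k * G \<in> local_power (q i) (1 * k + k)"
      by (intro local_power_mult local_power_pow Lam_local_q G(3) q(1))
    then show ?thesis using q(2) by (simp add: mult_2)
  next
    case (star i j)
    have "G * Lam D ^ k \<in> local_power (pt i j) (2 * k)"
      by (intro local_power_multL local_power_pow Lam_local_pt star(1-3))
    then show ?thesis using star(4) by (simp add: mult.commute)
  qed
  from resurgence_ge[OF _ vanishing_form_degree h _ this]
  have "ereal (real (2 * k) * real d / real (d * k + s)) \<le> resurgence I"
    using d k G(2) Lam_nonzero[of D] by simp
  then show ?thesis by simp
qed

lemma q_inj: "inj_on q D"
proof (rule inj_onI, rule ccontr)
  fix i j assume ij: "i \<in> D" "j \<in> D" "q i = q j" "i \<noteq> j"
  then show False using q_off_lines[of i j] q_on_line[of j] by simp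
qed

lemma exists_uniform_form:
  assumes "d * (k * (k + 1)) < (s + 1) * (s + 2)"
  shows "\<exists>G. hform s G \<and> G \<noteq> 0 \<and> (\<forall>i\<in>D. G \<in> local_power (q i) k)"
proof -
  have "(\<Sum>v\<in>q ` D. k * (k + 1)) = d * (k * (k + 1))"
    unfolding sum_constant card_image[OF q_inj] by simp
  then have "\<exists>G. hform s G \<and> G \<noteq> 0 \<and> (\<forall>v\<in>q ` D. G \<in> local_power v k)"
    using assms by (intro exists_fat_form[of "q ` D" "\<lambda>_. k"]) (auto intro: q_in_pts)
  then show ?thesis by blast
qed

text \<open>The product over all \<open>i\<close> of forms of degree \<open>s\<close> with multiplicity \<open>y\<close> at \<open>q i\<close> and \<open>x\<close> at the other
  extra points. Its ratio of degree to multiplicity can be better than what counting conditions gives for forms with equal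
  multiplicities.\<close>

lemma exists_product_form:
  assumes count: "(d - 1) * (x * (x + 1)) + y * (y + 1) < (s + 1) * (s + 2)"
  shows "\<exists>G. hform (d * s) G \<and> G \<noteq> 0 \<and> (\<forall>i\<in>D. G \<in> local_power (q i) ((d - 1) * x + y))"
proof -
  have "\<exists>G. hform s G \<and> G \<noteq> 0 \<and> (\<forall>j\<in>D. G \<in> local_power (q j) (if j = i then y else x))" if i: "i \<in> D" for i
  proof -
    let ?w = "\<lambda>v. if v = q i then y else x"
    have "(\<Sum>v\<in>q ` D. ?w v * (?w v + 1)) = (\<Sum>j\<in>D. ?w (q j) * (?w (q j) + 1))"
      by (subst sum.reindex[OF q_inj]) simp
    also have "\<dots> = y * (y + 1) + (\<Sum>j\<in>D - {i}. ?w (q j) * (?w (q j) + 1))"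
      by (subst sum.remove[OF _ i]) simp_all
    also have "(\<Sum>j\<in>D - {i}. ?w (q j) * (?w (q j) + 1)) = (\<Sum>j\<in>D - {i}. x * (x + 1))"
      by (intro sum.cong refl) (use i q_inj in \<open>auto simp: inj_on_eq_iff\<close>)
    also have "\<dots> = (d - 1) * (x * (x + 1))" using i by simp
    finally have "(\<Sum>v\<in>q ` D. ?w v * (?w v + 1)) < (s + 1) * (s + 2)" using count by linarith
    moreover have "q ` D \<subseteq> pts" by (simp only: pts_def Un_upper1)
    ultimately have "\<exists>G. hform s G \<and> G \<noteq> 0 \<and> (\<forall>v\<in>q ` D. G \<in> local_power v (?w v))"
      by (intro exists_fat_form)
    then obtain G where G: "hform s G" "G \<noteq> 0" "\<forall>v\<in>q ` D. G \<in> local_power v (?w v)" by blast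
    have "G \<in> local_power (q j) (if j = i then y else x)" if "j \<in> D" for j
    proof -
      have "q j = q i \<longleftrightarrow> j = i" using inj_on_eq_iff[OF q_inj that i] .
      then show ?thesis using G(3) that by force
    qed
    then show ?thesis using G(1,2) by blast
  qed
  then have "\<forall>i\<in>D. \<exists>G. hform s G \<and> G \<noteq> 0 \<and> (\<forall>j\<in>D. G \<in> local_power (q j) (if j = i then y else x))" by blast
  from bchoice[OF this] obtain G where
    G: "\<forall>i\<in>D. hform s (G i) \<and> G i \<noteq> 0 \<and> (\<forall>j\<in>D. G i \<in> local_power (q j) (if j = i then y else x))" ..
  have "hform (\<Sum>i\<in>D. s) (prod G D)" by (rule hform_prod) (use G in blast)
  then have "hform (d * s) (prod G D)" by simp
  moreover have "prod G D \<noteq> 0" using G by simp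
  moreover have "prod G D \<in> local_power (q j) ((d - 1) * x + y)" if j: "j \<in> D" for j
  proof -
    have "prod G D \<in> local_power (q j) (\<Sum>i\<in>D. if j = i then y else x)"
      by (rule local_power_prod) (use G j in blast)
    moreover have "(\<Sum>i\<in>D. if j = i then y else x) = (d - 1) * x + y"
    proof -
      have "(\<Sum>i\<in>D. if j = i then y else x) = y + (\<Sum>i\<in>D - {j}. if j = i then y else x)"
        by (subst sum.remove[OF _ j]) simp_all
      also have "(\<Sum>i\<in>D - {j}. if j = i then y else x) = (\<Sum>i\<in>D - {j}. x)" by (intro sum.cong) auto
      also have "\<dots> = (d - 1) * x" using j by simp
      finally show ?thesis by simp
    qed
    ultimately show ?thesis by simp
  qed
  ultimately show ?thesis by blast
qed

text \<open>For every \<open>k\<close> there is a form of multiplicity \<open>k\<close> at the extra points whose degree is the least integer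
  \<open>s \<ge> sqrt d (k + 1)\<close>; then \<open>k\<close> tends to infinity.\<close>

lemma resurgence_ge_sqrt: "ereal (2 - 2 / (sqrt (real d) + 1)) \<le> resurgence I"
proof -
  let ?x = "sqrt (real d)"
  have x: "0 < ?x" "?x * ?x = real d" using d by simp_all
  have k: "ereal (2 * real d / (real d + ?x + (?x + 1) / real k)) \<le> resurgence I" if k: "0 < k" for k
  proof -
    define s where "s = nat \<lceil>?x * (real k + 1)\<rceil>"
    have "0 \<le> ?x * (real k + 1)" by simp
    then have s: "?x * (real k + 1) \<le> real s" "real s \<le> ?x * (real k + 1) + 1"
      unfolding s_def by linarith+
    have "(?x * (real k + 1)) * (?x * (real k + 1)) \<le> real s * real s"
      by (rule mult_mono) (use s x in auto)
    also have "(?x * (real k + 1)) * (?x * (real k + 1)) = (?x * ?x) * ((real k + 1) * (real k + 1))"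
      by (simp only: mult_ac)
    also have "\<dots> = real (d * ((k + 1) * (k + 1)))" unfolding x(2) by (simp only: of_nat_mult of_nat_add of_nat_1)
    finally have "real (d * ((k + 1) * (k + 1))) \<le> real (s * s)" by simp
    then have "d * ((k + 1) * (k + 1)) \<le> s * s" by (simp only: of_nat_le_iff)
    moreover have "d * (k * (k + 1)) \<le> d * ((k + 1) * (k + 1))" by (intro mult_le_mono) simp_all
    moreover have "s * s < (s + 1) * (s + 2)" by simp
    ultimately have "d * (k * (k + 1)) < (s + 1) * (s + 2)" by linarith
    from exists_uniform_form[OF this] obtain G where
      "hform s G" "G \<noteq> 0" "\<And>i. i \<in> D \<Longrightarrow> G \<in> local_power (q i) k" by blast
    from resurgence_ge_of_form[OF k this]
    have le: "ereal (2 * real k * real d / (real d * real k + real s)) \<le> resurgence I" .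
    have "2 * real d / (real d + ?x + (?x + 1) / real k) = 2 * real k * real d / (real d * real k + (?x * (real k + 1) + 1))"
    proof -
      have "real k * (real d + ?x + (?x + 1) / real k) = real d * real k + (?x * (real k + 1) + 1)"
        using k by (simp add: algebra_simps)
      moreover have "2 * real d / (real d + ?x + (?x + 1) / real k)
          = (real k * (2 * real d)) / (real k * (real d + ?x + (?x + 1) / real k))"
        using k by (subst mult_divide_mult_cancel_left) simp_all
      ultimately show ?thesis by (simp add: mult_ac)
    qed
    also have "\<dots> \<le> 2 * real k * real d / (real d * real k + real s)"
    proof (rule divide_left_mono)
      have "0 < real d * real k" using d k by simp
      then show "0 < (real d * real k + (?x * (real k + 1) + 1)) * (real d * real k + real s)"
        using x k by (intro mult_pos_pos add_pos_nonneg) simp_all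
    qed (use s in simp_all)
    finally show ?thesis using le by (meson ereal_less_eq(3) order_trans)
  qed
  have "(\<lambda>k. 2 * real d / (real d + ?x + (?x + 1) / real k)) \<longlonglongrightarrow> 2 * real d / (real d + ?x + 0)"
  proof (intro tendsto_intros lim_const_over_n)
    show "real d + ?x + 0 \<noteq> 0" using x(1) by linarith
  qed
  moreover have "2 * real d / (real d + ?x + 0) = 2 - 2 / (?x + 1)"
  proof -
    have "2 * real d / (real d + ?x + 0) = (?x * (2 * ?x)) / (?x * (?x + 1))"
      by (simp only: distrib_left mult.left_commute[of ?x 2] x(2) mult_1_right add_0_right)
    also have "\<dots> = 2 * ?x / (?x + 1)" using x(1) by (subst mult_divide_mult_cancel_left) simp_all
    also have "\<dots> = 2 - 2 / (?x + 1)"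
    proof -
      have nz: "?x + 1 \<noteq> 0" using x(1) by linarith
      have "2 * ?x / (?x + 1) + 2 / (?x + 1) = 2 * (?x + 1) / (?x + 1)"
        by (simp only: add_divide_distrib[symmetric] distrib_left mult_1_right)
      also have "\<dots> = 2" using nz by (rule nonzero_mult_div_cancel_right)
      finally show ?thesis by linarith
    qed
    finally show ?thesis .
  qed
  ultimately have "(\<lambda>k. ereal (2 * real d / (real d + ?x + (?x + 1) / real k))) \<longlonglongrightarrow> ereal (2 - 2 / (?x + 1))"
    by simp
  then show ?thesis by (rule LIMSEQ_le_const2) (use k in \<open>auto intro: exI[of _ 1]\<close>)
qed

text \<open>Conics through the points for \<open>d \<le> 5\<close>, and a cubic through them for \<open>d = 9\<close>. In between, products of
  conics through five of the six points, of cubics through seven points that are double at one of them, and of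
  sextics with seven double points and one triple point.\<close>

lemma resurgence_ge_small:
  assumes c: "c 4 = 2" "c 5 = 2" "c 6 = 12/5" "c 7 = 21/8" "c 8 = 48/17" "c 9 = (3 :: real)"
    and d49: "4 \<le> d" "d \<le> 9"
  shows "ereal (2 - 2 * c d / (real d + c d)) \<le> resurgence I"
proof -
  have uniform: "ereal (2 * real k * real d / (real d * real k + real s)) \<le> resurgence I"
    if k: "0 < k" "d * (k * (k + 1)) < (s + 1) * (s + 2)" for k s
  proof -
    obtain G where "hform s G" "G \<noteq> 0" "\<forall>i\<in>D. G \<in> local_power (q i) k"
      using exists_uniform_form[OF k(2)] by blast
    then show ?thesis by (intro resurgence_ge_of_form[OF k(1)]) auto
  qed
  have product: "ereal (2 * real ((d - 1) * x + y) * real d / (real d * real ((d - 1) * x + y) + real (d * s))) \<le> resurgence I"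
    if k: "0 < (d - 1) * x + y" "(d - 1) * (x * (x + 1)) + y * (y + 1) < (s + 1) * (s + 2)" for x y s
  proof -
    obtain G where "hform (d * s) G" "G \<noteq> 0" "\<forall>i\<in>D. G \<in> local_power (q i) ((d - 1) * x + y)"
      using exists_product_form[OF k(2)] by blast
    then show ?thesis by (intro resurgence_ge_of_form[OF k(1)]) auto
  qed
  consider "d = 4" | "d = 5" | "d = 6" | "d = 7" | "d = 8" | "d = 9" using d49 by linarith
  then show ?thesis
  proof cases
    case 1 then show ?thesis using uniform[of 1 2] unfolding 1 c(1) by simp
  next
    case 2 then show ?thesis using uniform[of 1 2] unfolding 2 c(2) by simp
  next
    case 3 then show ?thesis using product[of 1 0 2] unfolding 3 c(3) by simp
  next
    case 4 then show ?thesis using product[of 1 2 3] unfolding 4 c(4) by simp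
  next
    case 5 then show ?thesis using product[of 2 3 6] unfolding 5 c(5) by simp
  next
    case 6 then show ?thesis using uniform[of 1 3] unfolding 6 c(6) by simp
  qed
qed

end

section \<open>From points and lines to coordinates\<close>

lemma poly_eval_scale:
  assumes "hform n F"
  shows "poly_eval F (k *s v) = k ^ n * poly_eval F v"
  unfolding poly_eval_def sum_distrib_left
proof (intro sum.cong refl)
  fix e assume "e \<in> Poly_Mapping.keys F"
  then have n: "mdeg e = n" using assms by (simp add: hform_def)
  have "(\<Prod>i\<in>UNIV. (k *s v) $ i ^ Poly_Mapping.lookup e i) = k ^ n * (\<Prod>i\<in>UNIV. v $ i ^ Poly_Mapping.lookup e i)"
    unfolding n[symmetric] mdeg_def power_sum prod.distrib[symmetric] by (simp add: power_mult_distrib)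
  then show "Poly_Mapping.lookup F e * (\<Prod>i\<in>UNIV. (k *s v) $ i ^ Poly_Mapping.lookup e i) =
      k ^ n * (Poly_Mapping.lookup F e * (\<Prod>i\<in>UNIV. v $ i ^ Poly_Mapping.lookup e i))"
    by (simp add: mult_ac)
qed

definition proj_class :: "'k::field^3 \<Rightarrow> 'k ppoint" where
  "proj_class v = {w. \<exists>k. k \<noteq> 0 \<and> w = k *s v}"

lemma proj_plane_eq: "proj_plane = proj_class ` {v. v \<noteq> 0}"
proof -
  have "proj_rel `` {v} = proj_class v" if "v \<noteq> 0" for v :: "'k::field^3"
    using that by (auto simp: proj_rel_def proj_class_def)
  then show ?thesis unfolding proj_plane_def quotient_def by auto
qed

lemma self_in_proj_class: "v \<in> proj_class v"
  by (auto simp: proj_class_def intro: exI[of _ 1])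

lemma proj_class_scale:
  assumes k: "k \<noteq> 0"
  shows "proj_class (k *s v) = proj_class v"
proof (intro equalityI subsetI)
  fix w assume "w \<in> proj_class (k *s v)"
  then obtain l where "l \<noteq> 0" "w = (l * k) *s v" by (auto simp: proj_class_def vector_smult_assoc)
  then show "w \<in> proj_class v" using k unfolding proj_class_def by (intro CollectI exI[of _ "l * k"]) simp
next
  fix w assume "w \<in> proj_class v"
  then obtain l where "l \<noteq> 0" "w = l *s v" by (auto simp: proj_class_def)
  then show "w \<in> proj_class (k *s v)" using k unfolding proj_class_def
    by (intro CollectI exI[of _ "l / k"]) (simp add: vector_smult_assoc)
qed

definition line_of :: "'k::field^3 \<Rightarrow> 'k ppoint set" where
  "line_of a = {p \<in> proj_plane. \<forall>v\<in>p. dot a v = 0}"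

lemma is_line_iff: "is_line L \<longleftrightarrow> (\<exists>a. a \<noteq> 0 \<and> L = line_of a)"
  by (simp add: is_line_def line_of_def dot_def)

lemma proj_class_in_line_of: "v \<noteq> 0 \<Longrightarrow> proj_class v \<in> line_of a \<longleftrightarrow> dot a v = 0"
  using self_in_proj_class[of v]
  by (auto simp: line_of_def proj_plane_eq proj_class_def dot_scale)

lemma line_of_scale: "k \<noteq> 0 \<Longrightarrow> line_of (k *s a) = line_of a"
  by (auto simp: line_of_def dot_scale)

lemma line_of_cases:
  assumes "p \<in> line_of a"
  obtains v where "v \<noteq> 0" "p = proj_class v" "dot a v = 0"
proof -
  obtain v where v: "v \<noteq> 0" "p = proj_class v" using assms by (auto simp: line_of_def proj_plane_eq)
  then show ?thesis using that assms proj_class_in_line_of by blast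
qed

text \<open>Choose equations for the lines and coordinate vectors for the points. For the auxiliary line \<open>b i\<close> it is
  enough to separate \<open>q i\<close> from one star point of \<open>L_i\<close>: then \<open>b i\<close> meets \<open>L_i\<close> in \<open>q i\<close> only.\<close>

lemma quasi_star_coordinates:
  fixes Z :: "'k::field ppoint set"
  assumes Z: "quasi_star_configuration d Z"
  obtains a q b where "quasi_star d a q b" "Z = proj_class ` quasi_star.pts d a q"
proof -
  from Z obtain L Q where d: "3 \<le> d" and gen: "general_lines d L" and Q: "\<And>i. i \<in> {1..d} \<Longrightarrow> Q i \<in> L i"
    "Q ` {1..d} \<inter> star_configuration d L = {}" and ZQ: "Z = Q ` {1..d} \<union> star_configuration d L"
    unfolding quasi_star_configuration_def by blast
  let ?D = "{1..d}"
  have "\<forall>i\<in>?D. \<exists>a. a \<noteq> 0 \<and> L i = line_of a" using gen by (auto simp: general_lines_def is_line_iff)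
  from bchoice[OF this] obtain a where a: "\<forall>i\<in>?D. a i \<noteq> 0 \<and> L i = line_of (a i)" ..
  have "\<forall>i\<in>?D. \<exists>v. v \<noteq> 0 \<and> Q i = proj_class v \<and> dot (a i) v = 0"
  proof
    fix i assume i: "i \<in> ?D"
    then have "Q i \<in> line_of (a i)" using Q(1) a by auto
    then show "\<exists>v. v \<noteq> 0 \<and> Q i = proj_class v \<and> dot (a i) v = 0" by (rule line_of_cases) blast
  qed
  from bchoice[OF this] obtain q where q: "\<forall>i\<in>?D. q i \<noteq> 0 \<and> Q i = proj_class (q i) \<and> dot (a i) (q i) = 0" ..
  have star: "p \<in> star_configuration d L" if "i \<in> ?D" "j \<in> ?D" "i \<noteq> j" "p \<in> L i" "p \<in> L j" for i j p
    unfolding star_configuration_def using that by blast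
  have off: "dot (a j) (q i) \<noteq> 0" if ij: "i \<in> ?D" "j \<in> ?D" "i \<noteq> j" for i j
  proof
    assume "dot (a j) (q i) = 0"
    then have "Q i \<in> L j" using q a ij proj_class_in_line_of by metis
    then have "Q i \<in> star_configuration d L" using star[OF ij Q(1)[OF ij(1)]] by blast
    then show False using Q(2) ij(1) by blast
  qed
  have distinct: "cross (a i) (a j) \<noteq> 0" if ij: "i \<in> ?D" "j \<in> ?D" "i \<noteq> j" for i j
  proof
    assume "cross (a i) (a j) = 0"
    then obtain k where k: "a j = k *s a i" using cross_eq_0D a ij(1) by blast
    then have "k \<noteq> 0" using a ij(2) by auto
    then have "L i = L j" using a ij k line_of_scale by metis
    then show False using gen ij unfolding general_lines_def inj_on_def by blast
  qed
  have three: "dot (a k) (cross (a i) (a j)) \<noteq> 0"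
    if ijk: "i \<in> ?D" "j \<in> ?D" "k \<in> ?D" "i \<noteq> j" "i \<noteq> k" "j \<noteq> k" for i j k
  proof
    assume "dot (a k) (cross (a i) (a j)) = 0"
    then have "proj_class (cross (a i) (a j)) \<in> L i \<inter> L j \<inter> L k"
      using a ijk proj_class_in_line_of[OF distinct[OF ijk(1,2,4)]] by simp
    then show False using gen ijk unfolding general_lines_def by blast
  qed
  have "\<forall>i\<in>?D. \<exists>b. dot b (q i) = 0 \<and> (\<forall>j\<in>?D. i \<noteq> j \<longrightarrow> dot b (cross (a i) (a j)) \<noteq> 0)"
  proof
    fix i assume i: "i \<in> ?D"
    obtain j where j: "j \<in> ?D" "i \<noteq> j" using d by (intro that[of "if i = 1 then 2 else 1"]) auto
    have "\<not> (\<exists>k. cross (a i) (a j) = k *s q i)"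
    proof
      assume "\<exists>k. cross (a i) (a j) = k *s q i"
      then obtain k where k: "cross (a i) (a j) = k *s q i" ..
      have "k * dot (a j) (q i) = 0" using dot_cross(2)[of "a j" "a i"] unfolding k by (simp add: dot_scale)
      then have "k = 0" using off[OF i j(1,2)] by simp
      then show False using k distinct[OF i j] by simp
    qed
    then obtain b where b: "dot b (q i) = 0" "dot b (cross (a i) (a j)) \<noteq> 0"
      using exists_separating q i by blast
    have ba: "cross (a i) b \<noteq> 0"
    proof
      assume "cross (a i) b = 0"
      then obtain k where "b = k *s a i" using cross_eq_0D a i by blast
      then show False using b(2) by (simp add: dot_scale)
    qed
    obtain k where k: "q i = k *s cross (a i) b" using orthogonal_unique[OF ba] q i b(1) by blast
    have "dot b (cross (a i) (a l)) \<noteq> 0" if l: "l \<in> ?D" "i \<noteq> l" for l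
    proof
      assume "dot b (cross (a i) (a l)) = 0"
      moreover have "dot b (cross (a i) (a l)) = - dot (a l) (cross (a i) b)"
        using dot_cross_swap[of "a i" "a l" b] by (simp add: dot_commute)
      ultimately have "dot (a l) (q i) = 0" unfolding k by (simp add: dot_scale)
      then show False using off[OF i l] by simp
    qed
    then show "\<exists>b. dot b (q i) = 0 \<and> (\<forall>j\<in>?D. i \<noteq> j \<longrightarrow> dot b (cross (a i) (a j)) \<noteq> 0)"
      using b(1) by blast
  qed
  from bchoice[OF this] obtain b where
    b: "\<forall>i\<in>?D. dot (b i) (q i) = 0 \<and> (\<forall>j\<in>?D. i \<noteq> j \<longrightarrow> dot (b i) (cross (a i) (a j)) \<noteq> 0)" ..
  interpret qs: quasi_star d a q b
  proof
    show "2 \<le> d" using d by simp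
  qed (use q off distinct three b in blast)+
  have "star_configuration d L = {proj_class (qs.pt i j) | i j. i \<in> ?D \<and> j \<in> ?D \<and> i \<noteq> j}"
  proof (intro equalityI subsetI)
    fix p assume "p \<in> star_configuration d L"
    then obtain i j where ij: "i \<in> ?D" "j \<in> ?D" "i \<noteq> j" "p \<in> L i" "p \<in> L j"
      unfolding star_configuration_def by blast
    obtain v where v: "v \<noteq> 0" "p = proj_class v" "dot (a i) v = 0"
      using ij(4) a ij(1) line_of_cases by metis
    have "dot (a j) v = 0" using ij(5) a ij(2) v proj_class_in_line_of by metis
    then obtain k where k: "v = k *s cross (a i) (a j)" using orthogonal_unique[OF distinct[OF ij(1-3)] v(3)] by blast
    then have "k \<noteq> 0" using v(1) by auto
    have "v = k *s qs.pt i j \<or> v = (- k) *s qs.pt i j"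
      using qs.pt_cases[of i j] k by auto
    then have "p = proj_class (qs.pt i j)" using v(2) \<open>k \<noteq> 0\<close> proj_class_scale by (metis neg_equal_0_iff_equal)
    then show "p \<in> {proj_class (qs.pt i j) | i j. i \<in> ?D \<and> j \<in> ?D \<and> i \<noteq> j}" using ij by blast
  next
    fix p assume "p \<in> {proj_class (qs.pt i j) | i j. i \<in> ?D \<and> j \<in> ?D \<and> i \<noteq> j}"
    then obtain i j where ij: "i \<in> ?D" "j \<in> ?D" "i \<noteq> j" "p = proj_class (qs.pt i j)" by blast
    have "p \<in> line_of (a i)" "p \<in> line_of (a j)"
      unfolding ij(4) proj_class_in_line_of[OF qs.pt_nonzero[OF ij(1-3)]] by (rule qs.pt_on)+
    then show "p \<in> star_configuration d L" using star[OF ij(1-3)] a ij by auto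
  qed
  moreover have "Q ` ?D = proj_class ` q ` ?D" using q by force
  moreover have "proj_class ` {qs.pt i j | i j. i \<in> ?D \<and> j \<in> ?D \<and> i \<noteq> j} =
      {proj_class (qs.pt i j) | i j. i \<in> ?D \<and> j \<in> ?D \<and> i \<noteq> j}"
    by blast
  ultimately have "Z = proj_class ` qs.pts"
    unfolding ZQ qs.pts_def image_Un by simp
  then show ?thesis using that qs.quasi_star_axioms by blast
qed

lemma vanishing_ideal_proj_class: "vanishing_ideal (proj_class ` P) = form_ideal P"
proof -
  have "(\<forall>p\<in>proj_class ` P. \<forall>v\<in>p. poly_eval F v = 0) \<longleftrightarrow> (\<forall>v\<in>P. poly_eval F v = 0)"
    if "is_form F" for F :: "'a ternary_poly"
  proof -
    obtain n where n: "hform n F" using \<open>is_form F\<close> by (auto simp: is_form_iff)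
    show ?thesis
    proof
      show "\<forall>p\<in>proj_class ` P. \<forall>v\<in>p. poly_eval F v = 0 \<Longrightarrow> \<forall>v\<in>P. poly_eval F v = 0"
        using self_in_proj_class by blast
    qed (auto simp: proj_class_def poly_eval_scale[OF n])
  qed
  then have "{F. is_form F \<and> (\<forall>p\<in>proj_class ` P. \<forall>v\<in>p. poly_eval F v = 0)} =
      {F. is_form F \<and> (\<forall>v\<in>P. poly_eval F v = 0)}"
    by blast
  then show ?thesis by (simp add: vanishing_ideal_def form_ideal_def)
qed

theorem theorem4p3:
  fixes d :: nat and Z :: "'k::alg_closed_field ppoint set" and c :: "nat \<Rightarrow> real"
  assumes Z: "quasi_star_configuration d Z"
    and c: "c 4 = 2" "c 5 = 2" "c 6 = 12/5" "c 7 = 21/8" "c 8 = 48/17" "c 9 = 3"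
  shows "(4 \<le> d \<and> d \<le> 9 \<longrightarrow>
            ereal (2 - 2 * c d / (real d + c d)) \<le> resurgence (vanishing_ideal Z) \<and>
            resurgence (vanishing_ideal Z) \<le> ereal (2 - 2 / (real d + 1))) \<and>
         (10 \<le> d \<longrightarrow>
            ereal (2 - 2 / (sqrt (real d) + 1)) \<le> resurgence (vanishing_ideal Z) \<and>
            resurgence (vanishing_ideal Z) \<le> ereal (2 - 2 / (real d + 1)))"
proof -
  obtain a q b where qs: "quasi_star d a q b" and Zp: "Z = proj_class ` quasi_star.pts d a q"
    by (rule quasi_star_coordinates[OF Z])
  interpret quasi_star d a q b by (rule qs)
  have "vanishing_ideal Z = form_ideal pts" unfolding Zp by (rule vanishing_ideal_proj_class)
  then show ?thesis
    using resurgence_le resurgence_ge_sqrt resurgence_ge_small[OF c] by simp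
qed

end
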